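(* Let $m\le n$ be positive integers, let $U$ be an open subset of $\mathbb R^n$, let $V$ be an $m$-dimensional varifold in $U$ such that $\|\delta V\|$ is a Radon measure and $\Theta^m(\|V\|,z)\ge1$ for $\|V\|$ almost all $z$; if $m>1$ suppose additionally that $\mathbf h(V;\cdot)\in\mathbf L_m^{\mathrm{loc}}(\|V\|,\mathbb R^n)$ and $\delta V(g)=-\int g(z)\bullet\mathbf h(V;z)\,d\|V\|z$ for $g\in C_c^\infty(U,\mathbb R^n)$. Let $H$ be the family of all connected components of $\operatorname{spt}\|V\|$. Then the following four statements hold. (1) If $C\in H$, then $C=\bigcup\{\operatorname{spt}\|W\|:W\in G,\ C\cap\operatorname{spt}\|W\|\ne\varnothing\}$ whenever $G$ is a decomposition of $V$. (2) If $C\in H$, then $V\,\partial C=0$. (3) $\operatorname{card}(H\cap\{C:C\cap K\ne\varnothing\})<\infty$ whenever $K$ is a compact subset of $U$. (4) If $C\in H$, then $C$ is open relative to $\operatorname{spt}\|V\|$.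
   Context: $\mathbf G(n,m)$ is the set of $m$-dimensional linear subspaces of $\mathbb R^n$; $S_\natural$ is the orthogonal projection onto $S$; $\sigma\bullet\tau=\operatorname{trace}(\sigma^*\circ\tau)$. $B(z,r)$ is the closed ball; $\alpha(m)$ is the Lebesgue measure of the unit ball of $\mathbb R^m$; $\Theta^m(\phi,z)=\lim_{r\to0+}\phi(B(z,r))/(\alpha(m)r^m)$. $\mathbf L^{\mathrm{loc}}_m$ means $m$-th power integrable on compact subsets of $U$. $\operatorname{spt}$ is the support relative to $U$. An $m$-dimensional varifold $V$ in $U$ is a Radon measure over $U\times\mathbf G(n,m)$, with weight $\|V\|(A)=V(A\times\mathbf G(n,m))$; first variation $\delta V(g)=\int Dg(z)\bullet S_\natural\,dV(z,S)$ for $g\in C_c^\infty(U,\mathbb R^n)$, with total variation measure $\|\delta V\|$. $\mathbf h(V;\cdot)$ is the generalised mean curvature vector, i.e. $-\mathbf h(V;\cdot)\|V\|$ is the part of $\delta V$ absolutely continuous with respect to $\|V\|$. If $\|\delta V\|$ is Radon there is a $\|\delta V\|$ measurable unit vector field $\eta(V,\cdot)$ with $\delta V(g)=\int g\bullet\eta(V,\cdot)\,d\|\delta V\|$; $((\delta V)\llcorner E)(g)=\int_E g\bullet\eta(V,\cdot)\,d\|\delta V\|$. For a $\|V\|+\|\delta V\|$ measurable set $E$, the distributional $V$ boundary of $E$ is $V\,\partial E=(\delta V)\llcorner E-\delta(V\llcorner(E\times\mathbf G(n,m)))$. A varifold $V$ with $\|\delta V\|$ Radon is indecomposable if there is no $\|V\|+\|\delta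 V\|$ measurable set $B$ with $\|V\|(B)>0$, $\|V\|(U\setminus B)>0$ and $V\,\partial B=0$. $W$ is a component of $V$ if $W$ is a nonzero indecomposable $m$-dimensional varifold in $U$ and there is a $\|V\|+\|\delta V\|$ measurable set $A$ with $W=V\llcorner(A\times\mathbf G(n,m))$ and $V\,\partial A=0$. A set $G$ of $m$-dimensional varifolds in $U$ is a decomposition of $V$ if: (i) each member of $G$ is a component of $V$; (ii) whenever $W,X$ are distinct members of $G$ there are disjoint $\|V\|+\|\delta V\|$ measurable sets $A,B$ with $V\,\partial A=0=V\,\partial B$, $W=V\llcorner(A\times\mathbf G(n,m))$ and $X=V\llcorner(B\times\mathbf G(n,m))$; (iii) $V(f)=\sum_{W\in G}W(f)$ for every continuous compactly supported $f:U\times\mathbf G(n,m)\to\mathbb R$. *)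

theory Defs
  imports "HOL-Analysis.Analysis"
begin

definition orth_proj :: "'a::euclidean_space set \<Rightarrow> 'a \<Rightarrow> 'a" where
  "orth_proj S x = (THE y. y \<in> S \<and> (\<forall>w\<in>S. orthogonal (x - y) w))"

lemma orth_proj_unique:
  assumes "subspace S" "y \<in> S" "\<forall>w\<in>S. orthogonal (x - y) w"
  shows "orth_proj S x = y"
  unfolding orth_proj_def
proof (rule the_equality)
  fix y' assume y': "y' \<in> S \<and> (\<forall>w\<in>S. orthogonal (x - y') w)"
  have d: "y' - y \<in> S" using assms y' by (simp add: subspace_diff)
  have "(x - y) \<bullet> (y' - y) = 0" "(x - y') \<bullet> (y' - y) = 0"
    using d assms y' by (auto simp: orthogonal_def)
  then have "((x - y) - (x - y')) \<bullet> (y' - y) = 0" by (simp only: inner_diff_left)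
  then show "y' = y" by simp
qed (use assms in auto)

lemma orth_proj:
  assumes "subspace S"
  shows "orth_proj S x \<in> S" and "\<forall>w\<in>S. orthogonal (x - orth_proj S x) w"
proof -
  obtain y z where "y \<in> span S" "\<And>w. w \<in> span S \<Longrightarrow> orthogonal z w" "x = y + z"
    using orthogonal_subspace_decomp_exists[of S x] by metis
  then have y: "y \<in> S" "\<forall>w\<in>S. orthogonal (x - y) w"
    using assms by (auto simp: span_eq_iff[THEN iffD2])
  with orth_proj_unique[OF assms y]
  show "orth_proj S x \<in> S" "\<forall>w\<in>S. orthogonal (x - orth_proj S x) w" by auto
qed

lemma linear_orth_proj:
  assumes "subspace S" shows "linear (orth_proj S)"
proof (rule linearI)
  fix x y and c :: real
  show "orth_proj S (x + y) = orth_proj S x + orth_proj S y"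
    using orth_proj[OF assms, of x] orth_proj[OF assms, of y]
    by (intro orth_proj_unique[OF assms])
       (auto simp: orthogonal_def algebra_simps subspace_add[OF assms])
  show "orth_proj S (c *\<^sub>R x) = c *\<^sub>R orth_proj S x"
    using orth_proj[OF assms, of x]
    by (intro orth_proj_unique[OF assms])
       (auto simp: orthogonal_def algebra_simps subspace_scale[OF assms])
qed

text \<open>
  The linear subspaces of all dimensions form one type, topologised by identifying a
  subspace with the matrix of its orthogonal projection; the subset of subspaces of
  dimension \<open>m\<close> then carries the usual topology of the Grassmannian.
\<close>

typedef (overloaded) 'n subsp = "{S :: (real^'n::finite) set. subspace S}"
  morphisms carrier_of Subsp
  by (rule exI[of _ UNIV]) simp

definition proj_matrix :: "'n::finite subsp \<Rightarrow> real^'n^'n" where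
  "proj_matrix S = matrix (orth_proj (carrier_of S))"

lemma inj_proj_matrix: "inj proj_matrix"
proof (rule injI)
  fix S T :: "'n::finite subsp" assume eq: "proj_matrix S = proj_matrix T"
  have sub: "subspace (carrier_of R)" for R :: "'n::finite subsp" using carrier_of[of R] by simp
  have "proj_matrix R *v x = orth_proj (carrier_of R) x" for R :: "'n::finite subsp" and x
    unfolding proj_matrix_def by (simp add: matrix_works linear_orth_proj[OF sub])
  with eq have "orth_proj (carrier_of S) = orth_proj (carrier_of T)" by (metis ext)
  moreover have "carrier_of R = range (orth_proj (carrier_of R))" for R :: "'n::finite subsp"
  proof
    show "range (orth_proj (carrier_of R)) \<subseteq> carrier_of R" using orth_proj[OF sub] by auto
    show "carrier_of R \<subseteq> range (orth_proj (carrier_of R))"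
    proof
      fix x assume "x \<in> carrier_of R"
      then have "orth_proj (carrier_of R) x = x"
        by (intro orth_proj_unique[OF sub]) (auto simp: orthogonal_def)
      then show "x \<in> range (orth_proj (carrier_of R))" by (metis rangeI)
    qed
  qed
  ultimately show "S = T" by (metis carrier_of_inject)
qed

instantiation subsp :: (finite) metric_space
begin

definition dist_subsp :: "'a subsp \<Rightarrow> 'a subsp \<Rightarrow> real" where
  "dist_subsp S T = dist (proj_matrix S) (proj_matrix T)"

definition uniformity_subsp :: "('a subsp \<times> 'a subsp) filter" where
  "uniformity_subsp = (INF e\<in>{0<..}. principal {(S, T). dist S T < e})"

definition open_subsp :: "'a subsp set \<Rightarrow> bool" where
  "open_subsp A = (\<forall>S\<in>A. \<forall>\<^sub>F (S', T) in uniformity. S' = S \<longrightarrow> T \<in> A)"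

instance
proof
  fix S T R :: "'a subsp"
  show "dist S T = 0 \<longleftrightarrow> S = T"
    by (simp add: dist_subsp_def inj_eq[OF inj_proj_matrix])
  show "dist S T \<le> dist S R + dist T R"
    unfolding dist_subsp_def by (rule dist_triangle2)
qed (simp_all add: uniformity_subsp_def open_subsp_def)

end

definition Grass :: "nat \<Rightarrow> 'n::finite subsp set" where
  "Grass m = {S. dim (carrier_of S) = m}"

primrec C_k :: "nat \<Rightarrow> ('a::real_normed_vector \<Rightarrow> 'b::real_normed_vector) \<Rightarrow> bool" where
  "C_k 0 f \<longleftrightarrow> continuous_on UNIV f"
| "C_k (Suc k) f \<longleftrightarrow> (\<forall>x. f differentiable (at x)) \<and>
     (\<forall>v. C_k k (\<lambda>x. frechet_derivative f (at x) v))"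

text \<open>
  A field in \<open>C\<^sub>c\<^sup>\<infinity>(U, \<real>\<^sup>n)\<close> is represented by its extension by zero to the
  whole space.
\<close>

definition test_fields :: "(real^'n::finite) set \<Rightarrow> (real^'n \<Rightarrow> real^'n) set" where
  "test_fields U = {g. (\<forall>k. C_k k g) \<and> compact (closure {x. g x \<noteq> 0}) \<and>
     closure {x. g x \<noteq> 0} \<subseteq> U}"

text \<open>
  Radon measures over \<open>U\<close> and over \<open>U \<times> G(n,m)\<close> are represented by their restrictions
  to the Borel sets. These spaces are locally compact with a countable base, so that a Borel
  measure is Radon as soon as it is finite on compact sets. The measurable sets of the
  corresponding Radon (outer) measure are the members of the completed \<open>\<sigma>\<close>-algebra.
\<close>

definition radon_on :: "'a::topological_space set \<Rightarrow> 'a measure \<Rightarrow> bool" where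
  "radon_on X M \<longleftrightarrow> sets M = sets (restrict_space borel X) \<and>
     (\<forall>K. compact K \<and> K \<subseteq> X \<longrightarrow> emeasure M K < \<infinity>)"

definition add_measure :: "'a measure \<Rightarrow> 'a measure \<Rightarrow> 'a measure" where
  "add_measure M N = measure_of (space M) (sets M) (\<lambda>A. emeasure M A + emeasure N A)"

definition spt :: "'a::topological_space set \<Rightarrow> 'a measure \<Rightarrow> 'a set" where
  "spt U M = U - \<Union>{G. open G \<and> G \<subseteq> U \<and> emeasure M G = 0}"

definition has_density ::
    "'a::metric_space set \<Rightarrow> nat \<Rightarrow> 'a measure \<Rightarrow> 'a \<Rightarrow> ennreal \<Rightarrow> bool" where
  "has_density U m M z \<theta> \<longleftrightarrow>
     ((\<lambda>r. emeasure M (cball z r \<inter> U) / ennreal (unit_ball_vol (real m) * r ^ m))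
        \<longlongrightarrow> \<theta>) (at_right 0)"

type_synonym 'n varif = "((real^'n) \<times> 'n subsp) measure"

definition varifold :: "(real^'n::finite) set \<Rightarrow> nat \<Rightarrow> 'n varif \<Rightarrow> bool" where
  "varifold U m V \<longleftrightarrow> radon_on (U \<times> Grass m) V"

definition weight :: "(real^'n::finite) set \<Rightarrow> 'n varif \<Rightarrow> (real^'n) measure" where
  "weight U V = distr V (restrict_space borel U) fst"

definition first_var :: "'n::finite varif \<Rightarrow> (real^'n \<Rightarrow> real^'n) \<Rightarrow> real" where
  "first_var V g =
     (LINT p|V. trace (transpose (matrix (frechet_derivative g (at (fst p)))) ** proj_matrix (snd p)))"

text \<open>
  The value of \<open>\<parallel>\<delta>V\<parallel>\<close> on an open set is the supremum of \<open>\<delta>V\<close> over test fields of length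
  at most one supported there; on other sets it is the infimum over open supersets. Its
  restriction to Borel sets is countably additive for every varifold, so the use
  of \<open>measure_of\<close> below does not change any value.
\<close>

definition var_outer :: "(real^'n::finite) set \<Rightarrow> 'n varif \<Rightarrow> (real^'n) set \<Rightarrow> ennreal" where
  "var_outer U V A =
     (INF G\<in>{G. open G \<and> A \<subseteq> G \<and> G \<subseteq> U}.
        SUP g\<in>{g \<in> test_fields G. \<forall>x. norm (g x) \<le> 1}. ennreal (first_var V g))"

definition var_measure :: "(real^'n::finite) set \<Rightarrow> 'n varif \<Rightarrow> (real^'n) measure" where
  "var_measure U V = measure_of U (sets (restrict_space borel U)) (var_outer U V)"

definition radon_var :: "(real^'n::finite) set \<Rightarrow> 'n varif \<Rightarrow> bool" where
  "radon_var U V \<longleftrightarrow> radon_on U (var_measure U V)"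

text \<open>
  The field \<open>\<eta>(V,\<cdot>)\<close> exists if \<open>\<parallel>\<delta>V\<parallel>\<close> is Radon and is then unique up to equality
  almost everywhere; nothing below depends on the representative.
\<close>

definition is_eta ::
    "(real^'n::finite) set \<Rightarrow> 'n varif \<Rightarrow> (real^'n \<Rightarrow> real^'n) \<Rightarrow> bool" where
  "is_eta U V e \<longleftrightarrow> e \<in> borel_measurable (completion (var_measure U V)) \<and>
     (\<forall>z\<in>U. norm (e z) = 1) \<and>
     (\<forall>g\<in>test_fields U. first_var V g = (LINT z|completion (var_measure U V). g z \<bullet> e z))"

definition eta :: "(real^'n::finite) set \<Rightarrow> 'n varif \<Rightarrow> real^'n \<Rightarrow> real^'n" where
  "eta U V = (SOME e. is_eta U V e)"

definition first_var_on ::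
    "(real^'n::finite) set \<Rightarrow> 'n varif \<Rightarrow> (real^'n) set \<Rightarrow> (real^'n \<Rightarrow> real^'n) \<Rightarrow> real" where
  "first_var_on U V E g = (LINT z:E|completion (var_measure U V). g z \<bullet> eta U V z)"

text \<open>
  Lebesgue decomposition of \<open>\<delta>V\<close> with respect to \<open>\<parallel>V\<parallel>\<close>: the singular part is the
  restriction of \<open>\<delta>V\<close> to some \<open>\<parallel>V\<parallel>\<close> null set \<open>Z\<close>, and the remainder has density
  \<open>- h\<close>. As for \<open>\<eta>(V,\<cdot>)\<close>, the function \<open>h\<close> is unique up to equality almost everywhere.
\<close>

definition is_mean_curv ::
    "(real^'n::finite) set \<Rightarrow> 'n varif \<Rightarrow> (real^'n \<Rightarrow> real^'n) \<Rightarrow> bool" where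
  "is_mean_curv U V h \<longleftrightarrow> h \<in> borel_measurable (completion (weight U V)) \<and>
     (\<forall>K. compact K \<and> K \<subseteq> U \<longrightarrow> set_integrable (completion (weight U V)) K h) \<and>
     (\<exists>Z\<in>null_sets (weight U V). \<forall>g\<in>test_fields U.
        first_var V g = - (LINT z|completion (weight U V). g z \<bullet> h z) + first_var_on U V Z g)"

definition mean_curv :: "(real^'n::finite) set \<Rightarrow> 'n varif \<Rightarrow> real^'n \<Rightarrow> real^'n" where
  "mean_curv U V = (SOME h. is_mean_curv U V h)"

definition var_sets :: "(real^'n::finite) set \<Rightarrow> 'n varif \<Rightarrow> (real^'n) set set" where
  "var_sets U V = sets (completion (add_measure (weight U V) (var_measure U V)))"

text \<open>The varifold obtained by restricting \<open>V\<close> to \<open>E \<times> G(n,m)\<close>; the completion is needed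
  since \<open>E\<close> need not be a Borel set.\<close>

definition restr_varifold :: "nat \<Rightarrow> 'n::finite varif \<Rightarrow> (real^'n) set \<Rightarrow> 'n varif" where
  "restr_varifold m V E =
     measure_of (space V) (sets V) (\<lambda>B. emeasure (completion V) (B \<inter> (E \<times> Grass m)))"

definition boundary ::
    "(real^'n::finite) set \<Rightarrow> nat \<Rightarrow> 'n varif \<Rightarrow> (real^'n) set \<Rightarrow> (real^'n \<Rightarrow> real^'n) \<Rightarrow> real" where
  "boundary U m V E g = first_var_on U V E g - first_var (restr_varifold m V E) g"

definition zero_boundary ::
    "(real^'n::finite) set \<Rightarrow> nat \<Rightarrow> 'n varif \<Rightarrow> (real^'n) set \<Rightarrow> bool" where
  "zero_boundary U m V E \<longleftrightarrow> (\<forall>g\<in>test_fields U. boundary U m V E g = 0)"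

definition indecomposable :: "(real^'n::finite) set \<Rightarrow> nat \<Rightarrow> 'n varif \<Rightarrow> bool" where
  "indecomposable U m V \<longleftrightarrow> radon_var U V \<and>
     \<not> (\<exists>B\<in>var_sets U V. emeasure (completion (weight U V)) B > 0 \<and>
          emeasure (completion (weight U V)) (U - B) > 0 \<and> zero_boundary U m V B)"

definition is_component ::
    "(real^'n::finite) set \<Rightarrow> nat \<Rightarrow> 'n varif \<Rightarrow> 'n varif \<Rightarrow> bool" where
  "is_component U m V W \<longleftrightarrow> varifold U m W \<and> emeasure W (space W) \<noteq> 0 \<and> indecomposable U m W \<and>
     (\<exists>A\<in>var_sets U V. W = restr_varifold m V A \<and> zero_boundary U m V A)"

definition decomposition ::
    "(real^'n::finite) set \<Rightarrow> nat \<Rightarrow> 'n varif \<Rightarrow> 'n varif set \<Rightarrow> bool" where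
  "decomposition U m V G \<longleftrightarrow>
     (\<forall>W\<in>G. is_component U m V W) \<and>
     (\<forall>W\<in>G. \<forall>X\<in>G. W \<noteq> X \<longrightarrow>
        (\<exists>A\<in>var_sets U V. \<exists>B\<in>var_sets U V. A \<inter> B = {} \<and>
           zero_boundary U m V A \<and> zero_boundary U m V B \<and>
           W = restr_varifold m V A \<and> X = restr_varifold m V B)) \<and>
     (\<forall>f :: (real^'n) \<times> 'n subsp \<Rightarrow> real.
        continuous_on (U \<times> Grass m) f \<and>
        (\<exists>K. compact K \<and> K \<subseteq> U \<times> Grass m \<and> (\<forall>p \<in> U \<times> Grass m - K. f p = 0)) \<longrightarrow>
        ((\<lambda>W. LINT p|W. f p) has_sum (LINT p|V. f p)) G)"

end

theory Submission
  imports Defs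
begin

text \<open>
  Idea. Multiplying test fields by cutoff functions shows \<open>V \<partial> E = 0\<close> for every relatively clopen
  subset \<open>E\<close> of \<open>spt \<parallel>V\<parallel>\<close>. Suppose \<open>V \<partial> A = 0\<close> and \<open>z \<notin> A\<close>, and put \<open>\<mu> = \<parallel>V\<parallel> \<llcorner> A\<close>, so that the
  first variation of \<open>V \<llcorner> (A \<times> G(n,m))\<close> is controlled by \<open>\<nu> = \<parallel>\<delta>V\<parallel> \<llcorner> A\<close>. At a point of positive upper
  density of \<open>\<mu>\<close>, the monotonicity identity yields a scale \<open>t \<le> \<rho>\<close> with
  \<open>\<mu> (B(x,5t)) \<le> C \<rho> \<nu> (B(x,t))\<close>, where \<open>\<rho>\<close> is comparable to the \<open>m\<close>-th root of the total mass; a Vitali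
  covering gives \<open>\<mu> (B(z,r')) \<le> C \<rho> \<nu> (B(z,r))\<close> and, by Young's inequality and the smallness of
  \<open>\<nu>\<close> (or of the integral of \<open>\<bar>h\<bar>\<^sup>m\<close>) on small punctured balls, \<open>\<mu> (B(z,r')) \<le> (1/2)\<^sup>m \<mu> (B(z,r))\<close>.
  Iterating over shrinking radii, \<open>\<mu>\<close> either vanishes on \<open>B(z,R/2)\<close> or has mass at least
  \<open>\<epsilon>\<close> in \<open>B(z,R)\<close>, with \<open>R\<close> and \<open>\<epsilon>\<close> independent of \<open>A\<close>.

  Hence disjoint families of clopen subsets of the support meeting a small ball have bounded
  cardinality, which makes quasi-components open and equal to components, and the supports of
  the members of a decomposition are locally finite. These supports are connected by
  indecomposability, and their union is dense, hence by local finiteness all of \<open>spt \<parallel>V\<parallel>\<close>.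
\<close>

section \<open>Smooth functions\<close>

text \<open>The exponent \<open>m\<close> on the curvature is critical: the L^m norm of h, like the
  total variation for \<open>m = 1\<close>, does not become small under rescaling, so smallness can
  only come from shrinking a ball about a fixed point. For \<open>m > 1\<close> this is absolute
  continuity of the integral. For \<open>m = 1\<close> an atom of the variation at the centre
  survives, so the local bound is confined to sets missing the centre; among disjoint sets at most
  one contains it. The radius and the mass threshold must be the same for all sets, since then
  finite mass limits their number. The factor (1/2)^m is dictated by the iteration: the gaps between
  consecutive radii halve, and \<rho>, of the order of the m-th root of the mass, has to stay below
  a fixed fraction of the gap. The field \<open>eta\<close> is a choice; its existence, a duality
  statement for L^1, must be established before boundaries can be estimated. A decomposition offers
  disjoint sets only for pairs of members, varying with the pair, so its members are counted through
  the sum formula tested against a cutoff.\<close>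

definition smooth :: "('a::real_normed_vector \<Rightarrow> 'b::real_normed_vector) \<Rightarrow> bool" where
  "smooth f \<longleftrightarrow> (\<forall>k. C_k k f)"

lemma frechet_derivative_eqI:
  "(f has_derivative f') (at x) \<Longrightarrow> frechet_derivative f (at x) = f'"
  by (rule frechet_derivative_at[symmetric])

lemma C_k_SucI:
  assumes "\<And>x. (f has_derivative f' x) (at x)" "\<And>v. C_k k (\<lambda>x. f' x v)"
  shows "C_k (Suc k) f"
  using assms frechet_derivative_eqI[OF assms(1)]
  by (auto simp: differentiable_def intro: assms(1))

lemma C_k_SucD:
  assumes "C_k (Suc k) f"
  shows "(f has_derivative frechet_derivative f (at x)) (at x)"
    "C_k k (\<lambda>x. frechet_derivative f (at x) v)"
  using assms by (auto simp: frechet_derivative_works)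

lemma C_k_Suc_imp: "C_k (Suc k) f \<Longrightarrow> C_k k f"
proof (induction k arbitrary: f)
  case 0
  then have "continuous (at x) f" for x
    using C_k_SucD(1)[OF 0] has_derivative_continuous by blast
  then show ?case by (simp add: continuous_on_eq_continuous_at)
next
  case (Suc k)
  show ?case
    by (rule C_k_SucI[OF C_k_SucD(1)[OF Suc.prems]]) (rule Suc.IH, rule C_k_SucD(2)[OF Suc.prems])
qed

lemma C_k_const: "C_k k (\<lambda>x. c)"
proof (induction k arbitrary: c)
  case (Suc k)
  show ?case by (rule C_k_SucI[where f' = "\<lambda>x v. 0"]) (auto simp: Suc)
qed simp

lemma C_k_bounded_linear: "bounded_linear f \<Longrightarrow> C_k k f"
proof (cases k)
  case 0
  assume "bounded_linear f"
  then show ?thesis by (simp add: 0 linear_continuous_on)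
next
  case (Suc j)
  assume f: "bounded_linear f"
  show ?thesis unfolding Suc
    by (rule C_k_SucI[OF bounded_linear_imp_has_derivative[OF f] C_k_const])
qed

lemma C_k_add: "C_k k f \<Longrightarrow> C_k k g \<Longrightarrow> C_k k (\<lambda>x. f x + g x)"
proof (induction k arbitrary: f g)
  case 0
  then show ?case by (auto intro: continuous_intros)
next
  case (Suc k)
  show ?case
    by (rule C_k_SucI[OF has_derivative_add[OF C_k_SucD(1)[OF Suc.prems(1)] C_k_SucD(1)[OF Suc.prems(2)]]])
      (rule Suc.IH[OF C_k_SucD(2)[OF Suc.prems(1)] C_k_SucD(2)[OF Suc.prems(2)]])
qed

text \<open>One induction serves products, scalar multiples and inner products. The product rule
  mixes a factor with the derivative of the other one, so both factors are also needed at the lower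
  order, which \<open>C_k_Suc_imp\<close> provides.\<close>

lemma C_k_bilinear:
  assumes p: "bounded_bilinear h"
  shows "C_k k f \<Longrightarrow> C_k k g \<Longrightarrow> C_k k (\<lambda>x. h (f x) (g x))"
proof (induction k arbitrary: f g)
  case 0
  then show ?case by (auto intro: bounded_bilinear.continuous_on[OF p])
next
  case (Suc k)
  show ?case
    by (rule C_k_SucI[OF bounded_bilinear.FDERIV[OF p C_k_SucD(1)[OF Suc.prems(1)] C_k_SucD(1)[OF Suc.prems(2)]]])
      (intro C_k_add Suc.IH C_k_SucD(2)[OF Suc.prems(1)] C_k_SucD(2)[OF Suc.prems(2)]
          C_k_Suc_imp[OF Suc.prems(1)] C_k_Suc_imp[OF Suc.prems(2)])
qed

lemma C_k_inverse:
  fixes f :: "'a::real_normed_vector \<Rightarrow> real"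
  assumes nz: "\<And>x. f x \<noteq> 0"
  shows "C_k k f \<Longrightarrow> C_k k (\<lambda>x. inverse (f x))"
proof (induction k)
  case 0
  then show ?case by (auto intro!: continuous_intros simp: nz)
next
  case (Suc k)
  note i = Suc.IH[OF C_k_Suc_imp[OF Suc.prems]]
  show ?case
  proof (rule C_k_SucI[where f' = "\<lambda>x v. (- 1) * (inverse (f x) * frechet_derivative f (at x) v * inverse (f x))"])
    show "((\<lambda>x. inverse (f x)) has_derivative
        (\<lambda>v. - 1 * (inverse (f x) * frechet_derivative f (at x) v * inverse (f x)))) (at x)" for x
      using Deriv.has_derivative_inverse[OF nz C_k_SucD(1)[OF Suc.prems], of x] by simp
    show "C_k k (\<lambda>x. - 1 * (inverse (f x) * frechet_derivative f (at x) v * inverse (f x)))" for v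
      by (intro C_k_bilinear[OF bounded_bilinear_mult] C_k_const i C_k_SucD(2)[OF Suc.prems])
  qed
qed

text \<open>The function u^(-n) exp(-1/u), extended by zero. The case \<open>n = 0\<close> supplies
  the cutoffs; the whole family is introduced because it is closed under differentiation up to
  linear combinations, so that smoothness becomes one induction with \<open>n\<close>
  arbitrary.\<close>

definition flat :: "nat \<Rightarrow> real \<Rightarrow> real" where
  "flat n u = (if u > 0 then (1 / u) ^ n * exp (- (1 / u)) else 0)"

lemma tendsto_flat_0: "(flat n \<longlongrightarrow> 0) (at 0)"
proof -
  have "((\<lambda>u::real. (1 / u) ^ n / exp (1 / u)) \<longlongrightarrow> 0) (at_right 0)"
    by (rule filterlim_compose[OF tendsto_power_div_exp_0]) (simp add: divide_inverse filterlim_inverse_at_top_right)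
  then have r: "(flat n \<longlongrightarrow> 0) (at_right 0)"
    by (rule Lim_transform_eventually)
      (auto simp: flat_def eventually_at_filter exp_minus divide_inverse)
  have l: "(flat n \<longlongrightarrow> 0) (at_left 0)"
    by (rule Lim_transform_eventually[OF tendsto_const])
      (auto simp: flat_def eventually_at_filter)
  show ?thesis using l r by (simp add: filterlim_split_at)
qed

lemma DERIV_flat: "(flat n has_real_derivative (flat (n + 2) u - n * flat (n + 1) u)) (at u)"
proof (cases u "0::real" rule: linorder_cases)
  case less
  have "((\<lambda>_. 0) has_real_derivative 0) (at u)" by simp
  then have "(flat n has_real_derivative 0) (at u)"
    by (rule DERIV_cong_ev[THEN iffD1, rotated -1])
      (use less eventually_nhds_in_open[of "{..<0}" u] in \<open>auto simp: flat_def elim!: eventually_mono\<close>)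
  then show ?thesis using less by (simp add: flat_def)
next
  case equal
  \<comment> \<open>The difference quotient of \<open>flat n\<close> at the origin is
    \<open>flat (Suc n)\<close>, whose limit is already known to be 0.\<close>
  have "(\<lambda>h. (flat n (0 + h) - flat n 0) / h) \<midarrow>0\<rightarrow> 0"
    by (rule Lim_transform_eventually[OF tendsto_flat_0[of "Suc n"]])
       (auto simp: flat_def eventually_at_filter divide_simps)
  then show ?thesis by (simp add: equal DERIV_def flat_def)
next
  case greater
  have "((\<lambda>u. inverse u) has_real_derivative - (inverse u)\<^sup>2) (at u)"
    using DERIV_inverse[of u] greater by (simp add: power2_eq_square)
  note d = DERIV_mult[OF DERIV_power[OF this, of n] DERIV_chain2[OF DERIV_exp DERIV_minus[OF this]]]
  have "((\<lambda>u. inverse u ^ n * exp (- inverse u)) has_real_derivative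
     (flat (n + 2) u - n * flat (n + 1) u)) (at u)"
    by (rule DERIV_cong[OF d], use greater in \<open>cases n\<close>)
       (auto simp: flat_def divide_inverse algebra_simps power2_eq_square)
  then show ?thesis
    by (rule DERIV_cong_ev[THEN iffD1, rotated -1])
      (use greater eventually_nhds_in_open[of "{0<..}" u] in \<open>auto simp: flat_def divide_inverse elim!: eventually_mono\<close>)
qed

lemma C_k_flat: "C_k k q \<Longrightarrow> C_k k (\<lambda>x. flat n (q x))"
proof (induction k arbitrary: n)
  case 0
  have "continuous_on UNIV (flat n)"
    by (meson DERIV_flat DERIV_isCont continuous_at_imp_continuous_on)
  with 0 show ?case using continuous_on_compose2[of UNIV "flat n" UNIV q] by auto
next
  case (Suc k)
  note i = Suc.IH[OF C_k_Suc_imp[OF Suc.prems]]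
  show ?case
  proof (rule C_k_SucI)
    show "((\<lambda>x. flat n (q x)) has_derivative
      (\<lambda>v. frechet_derivative q (at x) v * (flat (n + 2) (q x) + (- real n) * flat (n + 1) (q x)))) (at x)" for x
      using has_derivative_in_compose[OF C_k_SucD(1)[OF Suc.prems, of x]
          DERIV_flat[of n "q x", unfolded has_field_derivative_def, THEN has_derivative_at_withinI]]
      by (simp add: mult.commute)
    show "C_k k (\<lambda>x. frechet_derivative q (at x) v * (flat (n + 2) (q x) + (- real n) * flat (n + 1) (q x)))" for v
      by (intro C_k_bilinear[OF bounded_bilinear_mult] C_k_const C_k_add i C_k_SucD(2)[OF Suc.prems])
  qed
qed

lemma
  shows smooth_const: "smooth (\<lambda>x. c)"
    and smooth_bounded_linear: "bounded_linear f \<Longrightarrow> smooth f"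
    and smooth_add: "smooth f \<Longrightarrow> smooth g \<Longrightarrow> smooth (\<lambda>x. f x + g x)"
    and smooth_bilinear: "bounded_bilinear p \<Longrightarrow> smooth f' \<Longrightarrow> smooth g' \<Longrightarrow> smooth (\<lambda>x. p (f' x) (g' x))"
    and smooth_inverse: "(\<And>x. h x \<noteq> (0::real)) \<Longrightarrow> smooth h \<Longrightarrow> smooth (\<lambda>x. inverse (h x))"
    and smooth_flat: "smooth h \<Longrightarrow> smooth (\<lambda>x. flat n (h x))"
  by (auto simp: smooth_def C_k_const C_k_bounded_linear C_k_add C_k_bilinear C_k_inverse C_k_flat)

lemmas smooth_scaleR = smooth_bilinear[OF bounded_bilinear_scaleR]
lemmas smooth_mult = smooth_bilinear[OF bounded_bilinear_mult]
lemmas smooth_inner = smooth_bilinear[OF bounded_bilinear_inner]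

lemma smooth_ident: "smooth (\<lambda>x. x)"
  by (simp add: smooth_bounded_linear bounded_linear_ident)

lemma smooth_diff:
  assumes "smooth f" "smooth g" shows "smooth (\<lambda>x. f x - g x)"
  using smooth_add[OF assms(1) smooth_scaleR[OF smooth_const[of "-1"] assms(2)]] by simp

lemma smooth_cmult: "smooth f \<Longrightarrow> smooth (\<lambda>x. c * (f x :: real))"
  by (rule smooth_mult[OF smooth_const])

lemma smooth_sum: "(\<And>i. i \<in> I \<Longrightarrow> smooth (f i)) \<Longrightarrow> smooth (\<lambda>x. \<Sum>i\<in>I. f i x)"
  by (induction I rule: infinite_finite_induct) (auto intro: smooth_const smooth_add)

lemma smooth_imp_continuous_on: "smooth f \<Longrightarrow> continuous_on A f"
  using continuous_on_subset[of UNIV f A] C_k.simps(1)[of f] unfolding smooth_def by blast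

lemma smooth_has_derivative:
  "smooth f \<Longrightarrow> (f has_derivative frechet_derivative f (at x)) (at x)"
  using C_k_SucD(1)[of 0 f] by (simp add: smooth_def del: C_k.simps)

lemma smooth_derivative: "smooth f \<Longrightarrow> smooth (\<lambda>x. frechet_derivative f (at x) v)"
  using C_k_SucD(2) by (auto simp: smooth_def simp del: C_k.simps)

section \<open>Smooth transitions and cutoff functions\<close>

lemma flat_pos: "u > 0 \<Longrightarrow> flat n u > 0"
  by (simp add: flat_def)

lemma flat_nonneg: "flat n u \<ge> 0"
  by (simp add: flat_def)

lemma flat_nonpos: "u \<le> 0 \<Longrightarrow> flat n u = 0"
  by (simp add: flat_def)

definition step :: "real \<Rightarrow> real" where
  "step u = flat 0 u * inverse (flat 0 u + flat 0 (1 - u))"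

text \<open>The numbers u and 1 - u are never both nonpositive, so one of the summands is
  positive.\<close>

lemma step_denominator: "flat 0 u + flat 0 (1 - u) > 0"
  using flat_pos[of u 0] flat_pos[of "1 - u" 0] flat_nonneg[of 0 u] flat_nonneg[of 0 "1 - u"]
  by (cases "u > 0") (auto intro: add_pos_nonneg add_nonneg_pos)

lemma step_props: "0 \<le> step u" "step u \<le> 1" "u \<le> 0 \<Longrightarrow> step u = 0" "u \<ge> 1 \<Longrightarrow> step u = 1"
  using step_denominator[of u] flat_nonneg[of 0 u] flat_nonneg[of 0 "1 - u"]
  by (auto simp: step_def flat_nonpos field_simps)

lemma smooth_step: "smooth q \<Longrightarrow> smooth (\<lambda>x. step (q x))"
  unfolding step_def using step_denominator
  by (intro smooth_mult smooth_flat smooth_inverse smooth_add smooth_diff smooth_const)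
     (auto simp: less_le)

text \<open>A finite sum of bumps on balls is bounded below on \<open>K\<close> by a positive
  constant, and \<open>step\<close> flattens it to 1 there. Equality with 1 on an open
  neighbourhood, and not merely on \<open>K\<close>, makes the derivative of the cutoff vanish near
  \<open>K\<close>; this is what allows cutoffs to pass through \<open>divg\<close>.\<close>

lemma smooth_Urysohn:
  fixes K W :: "'a::euclidean_space set"
  assumes K: "compact K" and W: "open W" "K \<subseteq> W"
  obtains \<phi> N :: _ where "smooth \<phi>" "\<And>x. 0 \<le> \<phi> x" "\<And>x. \<phi> x \<le> (1::real)"
    "open N" "K \<subseteq> N" "\<And>x. x \<in> N \<Longrightarrow> \<phi> x = 1"
    "compact (closure {x. \<phi> x \<noteq> 0})" "closure {x. \<phi> x \<noteq> 0} \<subseteq> W"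
proof -
  have "\<forall>x\<in>K. \<exists>r>0. cball x r \<subseteq> W"
    using W open_contains_cball by (metis subsetD)
  then obtain r where r: "\<And>x. x \<in> K \<Longrightarrow> r x > 0" "\<And>x. x \<in> K \<Longrightarrow> cball x (r x) \<subseteq> W" by metis
  obtain F where F: "F \<subseteq> K" "finite F" "K \<subseteq> (\<Union>x\<in>F. ball x (r x))"
    by (rule compactE_image[OF K, of K "\<lambda>x. ball x (r x)"]) (use r in auto)
  define b where "b x = (\<lambda>y. flat 0 (1 - ((y - x) \<bullet> (y - x)) * inverse ((r x)\<^sup>2)))" for x
  have sb: "smooth (b x)" for x
    unfolding b_def by (intro smooth_flat smooth_diff smooth_mult smooth_inner smooth_const smooth_ident)
  have b_out: "b x y = 0" if "y \<notin> ball x (r x)" "x \<in> F" for x y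
  proof -
    have rx: "r x > 0" using that F r by auto
    have "r x ^ 2 \<le> (norm (y - x))^2" using that rx by (auto simp: dist_norm norm_minus_commute)
    then show ?thesis using rx by (auto simp: b_def flat_nonpos power2_norm_eq_inner[symmetric] field_simps)
  qed
  have b_in: "b x y > 0" if "y \<in> ball x (r x)" "x \<in> F" for x y
  proof -
    have rx: "r x > 0" using that F r by auto
    have "(norm (y - x))^2 < r x ^ 2" using that rx by (auto simp: dist_norm norm_minus_commute intro!: power_strict_mono)
    then show ?thesis using rx by (auto simp: b_def intro!: flat_pos simp: power2_norm_eq_inner[symmetric] field_simps)
  qed
  have b_nonneg: "b x y \<ge> 0" for x y by (simp add: b_def flat_nonneg)
  define B where "B y = (\<Sum>x\<in>F. b x y)" for y
  have sB: "smooth B" unfolding B_def by (intro smooth_sum sb)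
  have B_pos: "B y > 0" if yK: "y \<in> K" for y
  proof -
    obtain x where x: "x \<in> F" "y \<in> ball x (r x)" using F yK by blast
    show ?thesis unfolding B_def by (rule sum_pos2[OF F(2) x(1)]) (auto intro: b_in[OF x(2,1)] b_nonneg)
  qed
  \<comment> \<open>Half the minimum of \<open>B\<close> over \<open>K\<close>, so that
    \<open>K\<close> lies in the open set where \<open>B\<close> exceeds \<open>c\<close>; for empty
    \<open>K\<close> any positive number will do.\<close>
  obtain c where c: "c > 0" "\<And>y. y \<in> K \<Longrightarrow> c < B y"
  proof (cases "K = {}")
    case True
    then show ?thesis using that[of 1] by auto
  next
    case False
    then obtain z where "z \<in> K" "\<And>y. y \<in> K \<Longrightarrow> B z \<le> B y"
      using continuous_attains_inf[OF K False smooth_imp_continuous_on[OF sB]] by auto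
    then show ?thesis using B_pos[of z] that[of "B z / 2"] by fastforce
  qed
  define \<phi> where "\<phi> y = step (inverse c * B y)" for y
  show thesis
  proof
    show "smooth \<phi>" unfolding \<phi>_def by (intro smooth_step smooth_cmult sB)
    show "0 \<le> \<phi> x" "\<phi> x \<le> 1" for x by (auto simp: \<phi>_def step_props)
    have "open (B -` {c<..})"
      using continuous_open_vimage[of "{c<..}" B] smooth_imp_continuous_on[OF sB, of UNIV]
      by (simp add: continuous_on_open_vimage)
    then show "open {y. c < B y}" by (simp add: vimage_def)
    show "K \<subseteq> {y. c < B y}" using c by auto
    show "\<phi> x = 1" if "x \<in> {y. c < B y}" for x
      using that c by (auto simp: \<phi>_def field_simps intro!: step_props)
    have "{x. \<phi> x \<noteq> 0} \<subseteq> (\<Union>x\<in>F. cball x (r x))"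
    proof
      fix y assume "y \<in> {x. \<phi> x \<noteq> 0}"
      then have "B y \<noteq> 0" by (auto simp: \<phi>_def step_props)
      then obtain x where "x \<in> F" "b x y \<noteq> 0" unfolding B_def by (meson sum.not_neutral_contains_not_neutral)
      then show "y \<in> (\<Union>x\<in>F. cball x (r x))" using b_out[of y x] by force
    qed
    moreover have cm: "compact (\<Union>x\<in>F. cball x (r x))" using F by (intro compact_UN) auto
    ultimately have sub: "closure {x. \<phi> x \<noteq> 0} \<subseteq> (\<Union>x\<in>F. cball x (r x))"
      by (simp add: closure_minimal compact_imp_closed)
    then show "closure {x. \<phi> x \<noteq> 0} \<subseteq> W" using r F by blast
    show "compact (closure {x. \<phi> x \<noteq> 0})"
      using sub cm by (meson closed_closure compact_closure bounded_subset compact_imp_bounded closure_subset order_trans)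
  qed
qed

section \<open>Test fields\<close>

lemma test_fieldsD:
  assumes "g \<in> test_fields U"
  shows "smooth g" "compact (closure {x. g x \<noteq> 0})" "closure {x. g x \<noteq> 0} \<subseteq> U" "\<And>x. g x \<noteq> 0 \<Longrightarrow> x \<in> U"
  using assms closure_subset[of "{x. g x \<noteq> 0}"] by (auto simp: test_fields_def smooth_def)

lemma closure_support_outside: "x \<notin> closure {x. g x \<noteq> 0} \<Longrightarrow> g x = 0"
  using closure_subset[of "{x. g x \<noteq> 0}"] by auto

lemma test_fieldsI:
  assumes "smooth g" "compact K" "K \<subseteq> U" "\<And>x. x \<notin> K \<Longrightarrow> g x = 0"
  shows "g \<in> test_fields U"
proof -
  have "closure {x. g x \<noteq> 0} \<subseteq> K"
    using assms by (intro closure_minimal) (auto simp: compact_imp_closed)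
  then show ?thesis using assms
    by (auto simp: test_fields_def smooth_def intro: compact_closure[THEN iffD2] bounded_subset[OF compact_imp_bounded] closure_subset[THEN subset_trans])
qed

lemma test_fields_mono: "U \<subseteq> W \<Longrightarrow> test_fields U \<subseteq> test_fields W"
  by (auto simp: test_fields_def)

lemma test_fields_zero: "(\<lambda>x. 0) \<in> test_fields U"
  by (rule test_fieldsI[where K = "{}"]) (auto intro: smooth_const)

lemma test_fields_add:
  assumes "f \<in> test_fields U" "g \<in> test_fields U"
  shows "(\<lambda>x. f x + g x) \<in> test_fields U"
proof (rule test_fieldsI)
  let ?K = "closure {x. f x \<noteq> 0} \<union> closure {x. g x \<noteq> 0}"
  show "compact ?K" "?K \<subseteq> U" "smooth (\<lambda>x. f x + g x)"
    using test_fieldsD[OF assms(1)] test_fieldsD[OF assms(2)] by (auto intro: smooth_add)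
  show "f x + g x = 0" if "x \<notin> ?K" for x
    using that closure_support_outside[of x f] closure_support_outside[of x g] by auto
qed

lemma test_fields_smooth_mult:
  assumes "g \<in> test_fields U" "smooth (\<phi> :: _ \<Rightarrow> real)"
  shows "(\<lambda>x. \<phi> x *\<^sub>R g x) \<in> test_fields U"
proof (rule test_fieldsI)
  let ?K = "closure {x. g x \<noteq> 0}"
  show "compact ?K" "?K \<subseteq> U" "smooth (\<lambda>x. \<phi> x *\<^sub>R g x)"
    using test_fieldsD[OF assms(1)] assms(2) by (auto intro: smooth_scaleR)
  show "\<phi> x *\<^sub>R g x = 0" if "x \<notin> ?K" for x
    using that closure_subset[of "{x. g x \<noteq> 0}"] by auto
qed

lemma test_fields_scale: "g \<in> test_fields U \<Longrightarrow> (\<lambda>x. c *\<^sub>R g x) \<in> test_fields U"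
  by (rule test_fields_smooth_mult[OF _ smooth_const])

text \<open>The cutoff is 1 on a whole neighbourhood of \<open>K\<close>, hence the closed support
  of the second piece stays away from \<open>K\<close>. Cutting a field in this way underlies both
  the subadditivity of the variation and the bound of the first variation by an integral.\<close>

lemma test_fields_split:
  assumes g: "g \<in> test_fields U" and K: "compact K" and W: "open W" "K \<subseteq> W"
  obtains \<phi> where "smooth \<phi>" "\<And>x. 0 \<le> \<phi> x" "\<And>x. \<phi> x \<le> (1::real)" "\<And>x. x \<in> K \<Longrightarrow> \<phi> x = 1"
    "(\<lambda>x. \<phi> x *\<^sub>R g x) \<in> test_fields (U \<inter> W)" "(\<lambda>x. (1 - \<phi> x) *\<^sub>R g x) \<in> test_fields (U - K)"
proof -
  obtain \<phi> N where \<phi>: "smooth \<phi>" "\<And>x. 0 \<le> \<phi> x" "\<And>x. \<phi> x \<le> (1::real)"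
    "open N" "K \<subseteq> N" "\<And>x. x \<in> N \<Longrightarrow> \<phi> x = 1"
    "compact (closure {x. \<phi> x \<noteq> 0})" "closure {x. \<phi> x \<noteq> 0} \<subseteq> W"
    using smooth_Urysohn[OF K W] by metis
  note G = test_fieldsD[OF g]
  show thesis
  proof
    show "(\<lambda>x. \<phi> x *\<^sub>R g x) \<in> test_fields (U \<inter> W)"
    proof (rule test_fieldsI)
      show "compact (closure {x. g x \<noteq> 0} \<inter> closure {x. \<phi> x \<noteq> 0})" using G \<phi> by auto
      show "closure {x. g x \<noteq> 0} \<inter> closure {x. \<phi> x \<noteq> 0} \<subseteq> U \<inter> W" using G \<phi> by auto
    qed (use G \<phi> closure_subset[of "{x. g x \<noteq> 0}"] closure_subset[of "{x. \<phi> x \<noteq> 0}"] in \<open>auto intro!: smooth_scaleR\<close>)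
    show "(\<lambda>x. (1 - \<phi> x) *\<^sub>R g x) \<in> test_fields (U - K)"
    proof (rule test_fieldsI)
      show "compact (closure {x. g x \<noteq> 0} - N)" using G \<phi> by (auto intro: compact_diff)
      show "closure {x. g x \<noteq> 0} - N \<subseteq> U - K" using G \<phi> by auto
    qed (use G \<phi> closure_subset[of "{x. g x \<noteq> 0}"] in \<open>auto intro!: smooth_scaleR smooth_diff smooth_const\<close>)
  qed (use \<phi> in auto)
qed

section \<open>The Grassmannian and varifolds\<close>

lemma subspace_carrier_of: "subspace (carrier_of S)"
  using carrier_of[of S] by simp

lemma proj_matrix_mult: "proj_matrix S *v x = orth_proj (carrier_of S) x"
  by (simp add: proj_matrix_def matrix_works linear_orth_proj[OF subspace_carrier_of])

lemma orth_proj_fixed: "subspace S \<Longrightarrow> x \<in> S \<Longrightarrow> orth_proj S x = x"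
  by (rule orth_proj_unique) (auto simp: orthogonal_def)

lemma orth_proj_inner:
  assumes "subspace S" shows "x \<bullet> orth_proj S y = orth_proj S x \<bullet> orth_proj S y"
proof -
  have "(x - orth_proj S x) \<bullet> orth_proj S y = 0"
    using orth_proj(2)[OF assms, of x] orth_proj(1)[OF assms, of y] by (auto simp: orthogonal_def)
  then show ?thesis by (simp add: inner_diff_left)
qed

lemma proj_matrix_idem: "proj_matrix S ** proj_matrix S = proj_matrix S"
  by (simp add: matrix_eq matrix_vector_mul_assoc[symmetric] proj_matrix_mult
      orth_proj_fixed orth_proj subspace_carrier_of)

lemma transpose_proj_matrix: "transpose (proj_matrix S) = proj_matrix S"
proof -
  have "(transpose (proj_matrix S) *v x) \<bullet> y = (proj_matrix S *v x) \<bullet> y" for x y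
    using orth_proj_inner[OF subspace_carrier_of, of x S y] orth_proj_inner[OF subspace_carrier_of, of y S x]
    unfolding transpose_matrix_vector dot_lmul_matrix proj_matrix_mult by (metis inner_commute)
  then show ?thesis by (metis matrix_eq vector_eq_rdot)
qed

lemma inner_proj_matrix_le: "x \<bullet> (proj_matrix S *v x) \<le> x \<bullet> x"
proof -
  let ?p = "orth_proj (carrier_of S) x"
  have "x \<bullet> x = ?p \<bullet> ?p + (x - ?p) \<bullet> (x - ?p)"
    using orth_proj_inner[OF subspace_carrier_of, of x S x] by (simp add: algebra_simps inner_commute)
  then show ?thesis
    using orth_proj_inner[OF subspace_carrier_of, of x S x] inner_ge_zero[of "x - ?p"]
    by (simp add: proj_matrix_mult)
qed

lemma trace_eq_sum_inner: "trace A = (\<Sum>b\<in>Basis. b \<bullet> (A *v b))"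
proof -
  have "(\<Sum>b\<in>Basis. b \<bullet> (A *v b)) = (\<Sum>i\<in>UNIV. axis i 1 \<bullet> (A *v axis i 1))"
    by (simp add: Basis_vec_def sum.UNION_disjoint inj_on_def axis_eq_axis sum.reindex
        image_UN[symmetric] UNION_singleton_eq_range)
  then show ?thesis
    by (simp add: trace_def matrix_vector_mul_component inner_axis' matrix_vector_mult_basis column_def)
qed

text \<open>In an orthonormal basis \<open>B\<close> of the subspace the projection of x is the sum
  of (x \<bullet> b) b. Exchanging the two sums and using Parseval over \<open>Basis\<close> leaves
  the sum of the squared lengths of the members of \<open>B\<close>.\<close>

lemma trace_proj_matrix: "trace (proj_matrix S) = dim (carrier_of S)"
proof -
  note sub = subspace_carrier_of[of S]
  obtain B where B: "B \<subseteq> carrier_of S" "pairwise orthogonal B" "\<And>x. x \<in> B \<Longrightarrow> norm x = 1"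
    "independent B" "card B = dim (carrier_of S)" "span B = carrier_of S"
    using orthonormal_basis_subspace[OF sub] by metis
  have fin: "finite B" using B(4) independent_imp_finite by blast
  have P: "orth_proj (carrier_of S) x = (\<Sum>b\<in>B. (x \<bullet> b) *\<^sub>R b)" for x
  proof (rule orth_proj_unique[OF sub])
    show "(\<Sum>b\<in>B. (x \<bullet> b) *\<^sub>R b) \<in> carrier_of S"
      using B(1) by (intro subspace_sum sub subspace_scale) auto
    have "(x - (\<Sum>b\<in>B. (x \<bullet> b) *\<^sub>R b)) \<bullet> c = 0" if c: "c \<in> B" for c
    proof -
      have "(\<Sum>b\<in>B. (x \<bullet> b) * (b \<bullet> c)) = (\<Sum>b\<in>B. if b = c then x \<bullet> c else 0)"
        using B(2,3) c by (intro sum.cong)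
          (auto simp: pairwise_def orthogonal_def dot_square_norm)
      then show ?thesis using fin c by (simp add: inner_diff_left inner_sum_left)
    qed
    then show "\<forall>w\<in>carrier_of S. orthogonal (x - (\<Sum>b\<in>B. (x \<bullet> b) *\<^sub>R b)) w"
      using orthogonal_to_span[of _ B] B(6) by (auto simp: orthogonal_def)
  qed
  have "trace (proj_matrix S) = (\<Sum>e\<in>Basis. \<Sum>b\<in>B. (b \<bullet> e) * (b \<bullet> e))"
    by (simp add: trace_eq_sum_inner proj_matrix_mult P inner_sum_right inner_commute)
  also have "\<dots> = (\<Sum>b\<in>B. b \<bullet> b)"
    by (subst sum.swap) (simp add: euclidean_inner[symmetric])
  also have "\<dots> = card B" using B(3) by (simp add: dot_square_norm)
  finally show ?thesis using B(5) by simp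
qed

text \<open>Describes the Grassmannian by polynomial equations on matrices, which makes closedness
  evident; the dimension enters as the trace, a continuous quantity. Conversely, a symmetric
  idempotent matrix is the projection onto its range.\<close>

lemma proj_matrix_Grass:
  "proj_matrix ` Grass m = {P :: real^'n::finite^'n. transpose P = P \<and> P ** P = P \<and> trace P = real m}"
proof (intro equalityI subsetI)
  fix P :: "real^'n^'n"
  assume "P \<in> proj_matrix ` Grass m"
  then show "P \<in> {P. transpose P = P \<and> P ** P = P \<and> trace P = real m}"
    by (auto simp: transpose_proj_matrix proj_matrix_idem trace_proj_matrix Grass_def)
next
  fix P :: "real^'n^'n"
  assume "P \<in> {P. transpose P = P \<and> P ** P = P \<and> trace P = real m}"
  then have P: "transpose P = P" "P ** P = P" "trace P = real m" by auto
  have sub: "subspace (range ((*v) P))"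
    by (intro linear_subspace_image) auto
  define S where "S = Subsp (range ((*v) P))"
  have S: "carrier_of S = range ((*v) P)" by (simp add: S_def Subsp_inverse sub)
  have "orth_proj (range ((*v) P)) x = P *v x" for x
  proof (rule orth_proj_unique[OF sub])
    have "(x - P *v x) \<bullet> (P *v y) = 0" for y
    proof -
      have "(x - P *v x) \<bullet> (P *v y) = (P *v (x - P *v x)) \<bullet> y"
        by (metis P(1) dot_lmul_matrix vector_transpose_matrix)
      also have "P *v (x - P *v x) = 0"
        by (simp add: matrix_vector_mult_diff_distrib matrix_vector_mul_assoc P)
      finally show ?thesis by simp
    qed
    then show "\<forall>w\<in>range ((*v) P). orthogonal (x - P *v x) w" by (auto simp: orthogonal_def)
  qed simp
  then have "proj_matrix S *v x = P *v x" for x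
    by (simp add: proj_matrix_mult S)
  then have eq: "proj_matrix S = P" by (simp add: matrix_eq)
  then have "S \<in> Grass m" using P(3) trace_proj_matrix[of S] by (simp add: Grass_def)
  then show "P \<in> proj_matrix ` Grass m" using eq by blast
qed

lemma continuous_on_proj_matrix: "continuous_on A proj_matrix"
  unfolding continuous_on_iff by (auto simp: dist_subsp_def)

lemma compact_Grass: "compact (Grass m :: 'n::finite subsp set)"
proof -
  let ?X = "proj_matrix ` (Grass m :: 'n subsp set)"
  have "bounded ?X"
  proof -
    have "norm (proj_matrix S) \<le> real CARD('n) * real CARD('n)" for S :: "'n subsp"
    proof -
      have "\<bar>proj_matrix S $ i $ j\<bar> \<le> 1" for i j
      proof -
        let ?x = "axis j 1 :: real^'n"
        let ?p = "orth_proj (carrier_of S) ?x"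
        have "?p \<bullet> ?p \<le> 1"
          using inner_proj_matrix_le[of ?x S] orth_proj_inner[OF subspace_carrier_of, of ?x S ?x]
          by (simp add: proj_matrix_mult inner_axis_axis)
        then have "norm ?p \<le> 1" by (simp add: norm_le_square)
        moreover have "proj_matrix S $ i $ j = ?p $ i"
          by (simp add: proj_matrix_mult[symmetric] matrix_vector_mult_basis column_def)
        ultimately show ?thesis using component_le_norm_cart[of ?p i] by simp
      qed
      then have "norm (proj_matrix S $ i) \<le> real CARD('n)" for i
        using norm_le_l1_cart[of "proj_matrix S $ i"] sum_bounded_above[of UNIV "\<lambda>j. \<bar>proj_matrix S $ i $ j\<bar>" 1]
        by simp
      then show ?thesis
        using sum_bounded_above[of UNIV "\<lambda>i. norm (proj_matrix S $ i)" "real CARD('n)"]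
          L2_set_le_sum[of UNIV "\<lambda>i. norm (proj_matrix S $ i)"] by (simp add: norm_vec_def)
    qed
    then show ?thesis by (auto simp: bounded_iff)
  qed
  moreover have "closed ?X"
  proof -
    have "closed {P :: real^'n^'n. (\<chi> i j. P $ j $ i) = P}"
      by (intro closed_Collect_eq continuous_intros)
    moreover have "closed {P :: real^'n^'n. (\<chi> i j. \<Sum>k\<in>UNIV. P $ i $ k * P $ k $ j) = P}"
      by (intro closed_Collect_eq continuous_intros)
    moreover have "closed {P :: real^'n^'n. (\<Sum>i\<in>UNIV. P $ i $ i) = real m}"
      by (intro closed_Collect_eq continuous_intros)
    ultimately show ?thesis
      unfolding proj_matrix_Grass transpose_def matrix_matrix_mult_def trace_def
      by (intro closed_Collect_conj)
  qed
  ultimately have X: "compact ?X" by (simp add: compact_eq_bounded_closed)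
  \<comment> \<open>The metric of \<open>subsp\<close> is pulled back along
    \<open>proj_matrix\<close>, so the inverse is an isometry on the image and compactness can be
    carried back.\<close>
  have "continuous_on ?X (inv proj_matrix)"
    unfolding continuous_on_iff by (auto simp: inv_f_f[OF inj_proj_matrix] dist_subsp_def)
  then have "compact (inv proj_matrix ` ?X)" using X by (rule compact_continuous_image)
  then show ?thesis by (simp add: image_inv_f_f[OF inj_proj_matrix])
qed

text \<open>The integrand \<open>D g(z) \<bullet> S\<^sub>\<natural>\<close> of the first variation at \<open>(z, S)\<close>.\<close>

definition divg :: "(real^'n::finite \<Rightarrow> real^'n) \<Rightarrow> (real^'n) \<times> 'n subsp \<Rightarrow> real" where
  "divg g p = trace (transpose (matrix (frechet_derivative g (at (fst p)))) ** proj_matrix (snd p))"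

lemma first_var_divg: "first_var V g = (LINT p|V. divg g p)"
  by (simp add: first_var_def divg_def)

lemma divg_eq_sum:
  "divg g p = (\<Sum>i\<in>UNIV. \<Sum>k\<in>UNIV. frechet_derivative g (at (fst p)) (axis i 1) $ k * proj_matrix (snd p) $ k $ i)"
  by (simp add: divg_def trace_def matrix_matrix_mult_def transpose_def matrix_def)

text \<open>\<open>frechet_derivative\<close> is a choice from the relation
  \<open>has_derivative\<close>. Local agreement makes the two relations identical, so the choices
  coincide without any differentiability assumption.\<close>

lemma divg_cong:
  assumes "open N" "fst p \<in> N" "\<And>y. y \<in> N \<Longrightarrow> f y = g y"
  shows "divg f p = divg g p"
proof -
  have "(f has_derivative D) (at (fst p)) \<longleftrightarrow> (g has_derivative D) (at (fst p))" for D
    using has_derivative_transform_within_open[OF _ assms(1,2), of f D UNIV g]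
      has_derivative_transform_within_open[OF _ assms(1,2), of g D UNIV f] assms(3) by auto
  then show ?thesis by (simp add: divg_def frechet_derivative_def)
qed

lemma divg_add: "smooth f \<Longrightarrow> smooth g \<Longrightarrow> divg (\<lambda>x. f x + g x) p = divg f p + divg g p"
  by (simp add: divg_eq_sum frechet_derivative_eqI[OF has_derivative_add[OF smooth_has_derivative smooth_has_derivative]]
      sum.distrib algebra_simps)

lemma divg_scale: "smooth f \<Longrightarrow> divg (\<lambda>x. c *\<^sub>R f x) p = c * divg f p"
  by (simp add: divg_eq_sum frechet_derivative_eqI[OF has_derivative_scaleR_right[OF smooth_has_derivative]]
      sum_distrib_left mult.assoc)

lemma divg_zero: "divg (\<lambda>x. 0) p = 0"
  by (simp add: divg_eq_sum)

lemma divg_outside: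
  assumes "fst p \<notin> closure {x. g x \<noteq> 0}" shows "divg g p = 0"
proof -
  have "divg g p = divg (\<lambda>x. 0) p"
    by (rule divg_cong[where N = "- closure {x. g x \<noteq> 0}"])
       (use assms closure_subset[of "{x. g x \<noteq> 0}"] in auto)
  then show ?thesis by (simp add: divg_zero)
qed

lemma continuous_on_divg:
  assumes "smooth g" shows "continuous_on A (divg g)"
proof -
  have "continuous_on A (\<lambda>p. frechet_derivative g (at (fst p)) v)" for v
    by (rule continuous_on_compose2[OF smooth_imp_continuous_on[OF smooth_derivative[OF assms], of UNIV]])
       (auto intro: continuous_intros)
  moreover have "continuous_on A (\<lambda>p. proj_matrix (snd p))"
    by (rule continuous_on_compose2[OF continuous_on_proj_matrix[of UNIV]]) (auto intro: continuous_intros)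
  ultimately show ?thesis unfolding divg_eq_sum by (intro continuous_intros)
qed

section \<open>Radon measures, supports and the weight of a varifold\<close>

lemma sets_restrict_open: "open U \<Longrightarrow> sets (restrict_space borel U) = {A. A \<in> sets borel \<and> A \<subseteq> U}"
  by (auto simp: sets_restrict_space_iff sets_restrict_space)

lemma radon_onD:
  assumes "radon_on X M"
  shows "sets M = sets (restrict_space borel X)" "space M = X"
    "\<And>K. compact K \<Longrightarrow> K \<subseteq> X \<Longrightarrow> emeasure M K < \<infinity>"
  using assms sets_eq_imp_space_eq[of M "restrict_space borel X"] by (auto simp: radon_on_def space_restrict_space)

lemma radon_integrable_continuous:
  fixes X :: "'a::t2_space set"
  assumes M: "radon_on X M" and f: "continuous_on X (f :: 'a \<Rightarrow> real)"
    and K: "compact K" "K \<subseteq> X" "\<And>p. p \<in> X - K \<Longrightarrow> f p = 0"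
  shows "integrable M f"
proof -
  have meas: "f \<in> borel_measurable M"
    using borel_measurable_continuous_on_restrict[OF f] measurable_cong_sets[OF radon_onD(1)[OF M] refl] by blast
  have KM: "K \<in> sets M"
    using K by (auto simp: radon_onD(1)[OF M] sets_restrict_space compact_imp_closed intro!: image_eqI[of _ _ K])
  have "bounded (f ` K)"
    by (intro compact_imp_bounded compact_continuous_image continuous_on_subset[OF f] K)
  then obtain B where "\<And>p. p \<in> K \<Longrightarrow> norm (f p) \<le> B" by (auto simp: bounded_iff)
  then show ?thesis
    using K(3) by (intro integrableI_bounded_set[OF KM meas radon_onD(3)[OF M K(1,2)], of B])
      (auto simp: radon_onD(2)[OF M])
qed

text \<open>By the Lindelof property the union of all null open sets is the union of countably many
  of them, and hence null.\<close>

lemma spt_null: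
  fixes M :: "'a::second_countable_topology measure"
  assumes U: "open U" and M: "sets M = sets (restrict_space borel U)"
  shows "U - spt U M \<in> null_sets M" "closedin (top_of_set U) (spt U M)" "spt U M \<subseteq> U"
    "spt U M \<in> sets M"
proof -
  let ?F = "{G. open G \<and> G \<subseteq> U \<and> emeasure M G = 0}"
  obtain F where F: "F \<subseteq> ?F" "countable F" "\<Union>F = \<Union>?F"
    using Lindelof[of ?F] by auto
  have eq: "U - spt U M = \<Union>?F" by (auto simp: spt_def)
  have "F \<subseteq> null_sets M" using F(1) by (auto simp: null_sets_def M sets_restrict_open[OF U])
  then have "\<Union>F \<in> null_sets M" using null_sets_UN'[OF F(2), of id M] by auto
  then show 1: "U - spt U M \<in> null_sets M" using F(3) eq by simp
  have "open (\<Union>?F)" by auto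
  then show "closedin (top_of_set U) (spt U M)"
    unfolding spt_def closedin_closed by (intro exI[of _ "- \<Union>?F"]) auto
  show "spt U M \<subseteq> U" by (auto simp: spt_def)
  then have "spt U M = U - (U - spt U M)" by auto
  moreover have "U \<in> sets M" using U by (simp add: M sets_restrict_open[OF U])
  ultimately show "spt U M \<in> sets M" using 1 by (metis null_setsD2 sets.Diff)
qed

lemma open_diff_spt: "open (U - spt U M)"
proof -
  have "U - spt U M = \<Union>{G. open G \<and> G \<subseteq> U \<and> emeasure M G = 0}" by (auto simp: spt_def)
  then show ?thesis by auto
qed

lemma spt_iff: "z \<in> spt U M \<longleftrightarrow> z \<in> U \<and> (\<forall>G. open G \<longrightarrow> z \<in> G \<longrightarrow> G \<subseteq> U \<longrightarrow> emeasure M G \<noteq> 0)"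
  by (auto simp: spt_def)

text \<open>Nothing is assumed about the first variation, so that the locale can be interpreted for
  \<open>restr_varifold m V A\<close>, for which no such information is available
  beforehand.\<close>

locale open_varifold =
  fixes U :: "(real^'n::finite) set" and m :: nat and V :: "'n varif"
  assumes open_U: "open U" and varifold: "varifold U m V"
begin

lemma radon_V: "radon_on (U \<times> Grass m) V"
  using varifold by (simp add: varifold_def)

lemmas sets_V = radon_onD(1)[OF radon_V] and space_V = radon_onD(2)[OF radon_V]

abbreviation \<mu> :: "(real^'n) measure" where "\<mu> \<equiv> weight U V"

lemma sets_U_iff: "A \<in> sets (restrict_space borel U) \<longleftrightarrow> A \<in> sets borel \<and> A \<subseteq> U"
  by (simp add: sets_restrict_open[OF open_U])

lemma sets_weight: "sets \<mu> = sets (restrict_space borel U)"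
  by (simp add: weight_def)

lemma sets_weight_iff: "A \<in> sets \<mu> \<longleftrightarrow> A \<in> sets borel \<and> A \<subseteq> U"
  by (simp add: sets_weight sets_U_iff)

lemma space_weight: "space \<mu> = U"
  by (simp add: weight_def space_restrict_space)

lemma measurable_fst_V: "fst \<in> measurable V (restrict_space borel U)"
proof -
  have "fst \<in> borel_measurable (restrict_space borel (U \<times> Grass m))"
    by (rule borel_measurable_continuous_on_restrict) (auto intro: continuous_intros)
  then have "fst \<in> borel_measurable V"
    using measurable_cong_sets[OF sets_V refl] by blast
  then show ?thesis by (rule measurable_restrict_space2[rotated]) (auto simp: space_V)
qed

lemma cylinder_sets: "A \<in> sets \<mu> \<Longrightarrow> A \<times> Grass m \<in> sets V"
  using measurable_sets[OF measurable_fst_V, of A]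
  by (auto simp: sets_weight sets_U_iff space_V vimage_def Sigma_def elim!: back_subst[of "\<lambda>x. x \<in> sets V"])

lemma emeasure_weight: "A \<in> sets \<mu> \<Longrightarrow> emeasure \<mu> A = emeasure V (A \<times> Grass m)"
  by (subst weight_def, subst emeasure_distr[OF measurable_fst_V])
     (auto simp: sets_weight sets_U_iff space_V intro!: arg_cong[of _ _ "emeasure V"])

lemma radon_weight: "radon_on U \<mu>"
  unfolding radon_on_def
proof (intro conjI allI impI sets_weight, elim conjE)
  fix K assume K: "compact K" "K \<subseteq> U"
  then have "emeasure \<mu> K = emeasure V (K \<times> Grass m)"
    by (intro emeasure_weight) (auto simp: sets_weight_iff compact_imp_closed)
  also have "\<dots> < \<infinity>"
    using K by (intro radon_onD(3)[OF radon_V] compact_Times compact_Grass) auto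
  finally show "emeasure \<mu> K < \<infinity>" .
qed

lemma integrable_divg:
  assumes "g \<in> test_fields U" shows "integrable V (divg g)"
  using test_fieldsD[OF assms]
  by (intro radon_integrable_continuous[OF radon_V continuous_on_divg, where K = "closure {x. g x \<noteq> 0} \<times> Grass m"])
     (auto intro: compact_Times compact_Grass intro!: divg_outside)

lemma first_var_add:
  "f \<in> test_fields U \<Longrightarrow> g \<in> test_fields U \<Longrightarrow> first_var V (\<lambda>x. f x + g x) = first_var V f + first_var V g"
  using integrable_divg[of f] integrable_divg[of g]
  by (simp add: first_var_divg divg_add test_fieldsD(1))

lemma first_var_scale:
  "f \<in> test_fields U \<Longrightarrow> first_var V (\<lambda>x. c *\<^sub>R f x) = c * first_var V f"
  using integrable_divg[of f]
  by (simp add: first_var_divg divg_scale test_fieldsD(1))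

lemmas spt_null = spt_null[OF open_U sets_weight]

end

section \<open>The total variation measure\<close>

context open_varifold
begin

definition open_var :: "(real^'n) set \<Rightarrow> ennreal" where
  "open_var G = (SUP g\<in>{g \<in> test_fields G. \<forall>x. norm (g x) \<le> 1}. ennreal (first_var V g))"

lemma open_var_mono: "G \<subseteq> G' \<Longrightarrow> open_var G \<le> open_var G'"
  unfolding open_var_def using test_fields_mono[of G G'] by (intro SUP_subset_mono) auto

lemma var_outer_eq_INF: "var_outer U V A = (INF G\<in>{G. open G \<and> A \<subseteq> G \<and> G \<subseteq> U}. open_var G)"
  by (simp add: var_outer_def open_var_def)

lemma var_outer_mono: "A \<subseteq> B \<Longrightarrow> var_outer U V A \<le> var_outer U V B"
  unfolding var_outer_eq_INF by (intro INF_superset_mono) auto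

lemma var_outer_open: "open G \<Longrightarrow> G \<subseteq> U \<Longrightarrow> var_outer U V G = open_var G"
  unfolding var_outer_eq_INF
  by (intro antisym INF_lower INF_greatest) (auto intro: open_var_mono)

lemma var_outer_le: "open G \<Longrightarrow> A \<subseteq> G \<Longrightarrow> G \<subseteq> U \<Longrightarrow> var_outer U V A \<le> open_var G"
  unfolding var_outer_eq_INF by (intro INF_lower) auto

lemma first_var_zero: "first_var V (\<lambda>x. 0) = 0"
  by (simp add: first_var_divg divg_zero)

lemma open_var_empty: "open_var {} = 0"
proof -
  have "first_var V g = 0" if "g \<in> test_fields {}" for g
  proof -
    have "g = (\<lambda>x. 0)" using test_fieldsD(4)[OF that] by auto
    then show ?thesis by (simp add: first_var_zero)
  qed
  then have "open_var {} \<le> 0" unfolding open_var_def by (intro SUP_least) auto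
  then show ?thesis by simp
qed

lemma ennreal_add_le: "ennreal (a + b) \<le> ennreal a + ennreal b"
proof -
  have "ennreal (a + b) \<le> ennreal (max 0 a + max 0 b)" by (intro ennreal_leI) auto
  also have "\<dots> = ennreal a + ennreal b" by (subst ennreal_plus) (auto simp: ennreal_max_0)
  finally show ?thesis .
qed

lemma first_var_le_open_var:
  assumes g: "g \<in> test_fields G" and G: "G \<subseteq> U" and c: "\<And>x. norm (g x) \<le> c"
  shows "ennreal (first_var V g) \<le> ennreal c * open_var G"
proof (cases "c > 0")
  case True
  have "(\<lambda>x. (1 / c) *\<^sub>R g x) \<in> test_fields G" by (rule test_fields_scale[OF g])
  then have "ennreal (first_var V (\<lambda>x. (1 / c) *\<^sub>R g x)) \<le> open_var G"
    unfolding open_var_def using c True by (intro SUP_upper) (auto simp: field_simps)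
  then have "ennreal c * ennreal (first_var V (\<lambda>x. (1 / c) *\<^sub>R g x)) \<le> ennreal c * open_var G"
    by (rule mult_left_mono) simp
  also have "ennreal c * ennreal (first_var V (\<lambda>x. (1 / c) *\<^sub>R g x)) = ennreal (first_var V g)"
    using True first_var_scale[OF subsetD[OF test_fields_mono[OF G] g], of "1 / c"]
    by (simp add: ennreal_mult'[symmetric])
  finally show ?thesis .
next
  case False
  then have "g = (\<lambda>x. 0)" using c by (metis norm_le_zero_iff order_trans linorder_not_less)
  then show ?thesis by (simp add: first_var_zero)
qed

lemma first_var_split:
  assumes g: "g \<in> test_fields U"
    and "(\<lambda>x. \<phi> x *\<^sub>R g x) \<in> test_fields U" "(\<lambda>x. (1 - \<phi> x) *\<^sub>R g x) \<in> test_fields U"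
  shows "first_var V g = first_var V (\<lambda>x. \<phi> x *\<^sub>R g x) + first_var V (\<lambda>x. (1 - \<phi> x) *\<^sub>R g x)"
  using first_var_add[OF assms(2,3)] by (simp add: algebra_simps)

lemma test_fields_closure_support:
  "g \<in> test_fields G \<Longrightarrow> g \<in> test_fields (closure {x. g x \<noteq> 0})"
  by (auto simp: test_fields_def)

lemma open_var_Un:
  assumes "open G1" "open G2" "G1 \<subseteq> U" "G2 \<subseteq> U"
  shows "open_var (G1 \<union> G2) \<le> open_var G1 + open_var G2"
  unfolding open_var_def[of "G1 \<union> G2"]
proof (rule SUP_least, clarify)
  fix g assume g: "g \<in> test_fields (G1 \<union> G2)" "\<forall>x. norm (g x) \<le> 1"
  let ?S = "closure {x. g x \<noteq> 0}"
  note D = test_fieldsD[OF g(1)]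
  \<comment> \<open>The set \<open>?S - G2\<close> is compact and contained in \<open>G1\<close>. A
    cutoff that is 1 near it and supported in \<open>G1\<close> leaves a remainder living in
    \<open>G2\<close>.\<close>
  obtain \<phi> where \<phi>: "\<And>x. 0 \<le> \<phi> x" "\<And>x. \<phi> x \<le> (1::real)"
    "(\<lambda>x. \<phi> x *\<^sub>R g x) \<in> test_fields (?S \<inter> G1)" "(\<lambda>x. (1 - \<phi> x) *\<^sub>R g x) \<in> test_fields (?S - (?S - G2))"
    by (rule test_fields_split[OF test_fields_closure_support[OF g(1)], of "?S - G2" G1])
       (use D assms in \<open>auto intro: compact_diff\<close>)
  have 1: "(\<lambda>x. \<phi> x *\<^sub>R g x) \<in> test_fields G1" by (rule subsetD[OF test_fields_mono \<phi>(3)]) auto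
  have 2: "(\<lambda>x. (1 - \<phi> x) *\<^sub>R g x) \<in> test_fields G2" by (rule subsetD[OF test_fields_mono \<phi>(4)]) auto
  have b: "norm (\<phi> x *\<^sub>R g x) \<le> 1" "norm ((1 - \<phi> x) *\<^sub>R g x) \<le> 1" for x
    using \<phi>(1,2)[of x] g(2) by (auto intro!: mult_le_one)
  have "first_var V g = first_var V (\<lambda>x. \<phi> x *\<^sub>R g x) + first_var V (\<lambda>x. (1 - \<phi> x) *\<^sub>R g x)"
    using assms subsetD[OF test_fields_mono 1] subsetD[OF test_fields_mono 2] subsetD[OF test_fields_mono g(1)]
    by (intro first_var_split) auto
  then have "ennreal (first_var V g) \<le> ennreal (first_var V (\<lambda>x. \<phi> x *\<^sub>R g x)) + ennreal (first_var V (\<lambda>x. (1 - \<phi> x) *\<^sub>R g x))"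
    by (simp add: ennreal_add_le)
  also have "\<dots> \<le> open_var G1 + open_var G2"
    using first_var_le_open_var[OF 1 assms(3) b(1)] first_var_le_open_var[OF 2 assms(4) b(2)]
    by (intro add_mono) auto
  finally show "ennreal (first_var V g) \<le> open_var G1 + open_var G2" .
qed

text \<open>The support of a test field is compact and therefore contained in a finite subunion, so
  countable subadditivity reduces to the finite case.\<close>

lemma open_var_UN:
  assumes G: "\<And>i::nat. open (G i)" "\<And>i. G i \<subseteq> U"
  shows "open_var (\<Union>i. G i) \<le> (\<Sum>i. open_var (G i))"
  unfolding open_var_def[of "\<Union>i. G i"]
proof (rule SUP_least, clarify)
  have fin: "open_var (\<Union>i<n. G i) \<le> (\<Sum>i<n. open_var (G i))" for n
  proof (induction n)
    case 0
    then show ?case by (simp add: open_var_empty)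
  next
    case (Suc n)
    have "open_var (\<Union>i<Suc n. G i) = open_var ((\<Union>i<n. G i) \<union> G n)"
      by (simp add: lessThan_Suc Un_commute)
    also have "\<dots> \<le> open_var (\<Union>i<n. G i) + open_var (G n)" using G by (intro open_var_Un) auto
    also have "\<dots> \<le> (\<Sum>i<Suc n. open_var (G i))" using Suc by (simp add: add_mono)
    finally show ?case .
  qed
  fix g assume g: "g \<in> test_fields (\<Union>i. G i)" "\<forall>x. norm (g x) \<le> 1"
  note D = test_fieldsD[OF g(1)]
  obtain I where I: "finite I" "closure {x. g x \<noteq> 0} \<subseteq> (\<Union>i\<in>I. G i)"
    by (rule compactE_image[OF D(2), of UNIV G]) (use D G in auto)
  obtain n where "I \<subseteq> {..<n}" using finite_nat_iff_bounded I(1) by blast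
  then have "closure {x. g x \<noteq> 0} \<subseteq> (\<Union>i<n. G i)" using I(2) by blast
  then have "g \<in> test_fields (\<Union>i<n. G i)" using g(1) by (auto simp: test_fields_def)
  then have "ennreal (first_var V g) \<le> open_var (\<Union>i<n. G i)"
    unfolding open_var_def using g(2) by (intro SUP_upper) auto
  also have "\<dots> \<le> (\<Sum>i<n. open_var (G i))" by (rule fin)
  also have "\<dots> \<le> (\<Sum>i. open_var (G i))" by (rule sum_le_suminf) auto
  finally show "ennreal (first_var V g) \<le> (\<Sum>i. open_var (G i))" .
qed

lemma var_outer_approx:
  assumes "var_outer U V A < \<infinity>" "0 < e"
  obtains G where "open G" "A \<subseteq> G" "G \<subseteq> U" "open_var G \<le> var_outer U V A + ennreal e"
proof -
  have "var_outer U V A < var_outer U V A + ennreal e"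
    using assms ennreal_add_left_cancel_less[of "var_outer U V A" 0 "ennreal e"] by auto
  then show thesis
    unfolding var_outer_eq_INF[of A] Inf_less_iff using that by (force simp: var_outer_eq_INF)
qed

lemma outer_measure_space_var_outer: "outer_measure_space (Pow U) (var_outer U V)"
  unfolding outer_measure_space_def
proof (intro conjI)
  have "var_outer U V {} \<le> open_var {}" by (rule var_outer_le) auto
  also have "\<dots> = 0" by (rule open_var_empty)
  finally show "positive (Pow U) (var_outer U V)" by (simp add: positive_def)
  show "increasing (Pow U) (var_outer U V)" by (simp add: increasing_def var_outer_mono)
  show "countably_subadditive (Pow U) (var_outer U V)"
    unfolding countably_subadditive_def
  proof (intro allI impI)
    fix A :: "nat \<Rightarrow> _" assume A: "range A \<subseteq> Pow U"
    show "var_outer U V (\<Union>i. A i) \<le> (\<Sum>i. var_outer U V (A i))"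
    proof (cases "\<exists>i. var_outer U V (A i) = \<infinity>")
      case True
      then obtain i where i: "var_outer U V (A i) = \<infinity>" by blast
      have "var_outer U V (A i) = (\<Sum>j\<in>{i}. var_outer U V (A j))" by simp
      also have "\<dots> \<le> (\<Sum>i. var_outer U V (A i))"
        by (rule sum_le_suminf) auto
      finally show ?thesis using i by (simp add: top_unique)
    next
      case False
      show ?thesis
      proof (rule ennreal_le_epsilon)
        fix e :: real assume e: "e > 0"
        have "\<exists>G. open G \<and> A i \<subseteq> G \<and> G \<subseteq> U \<and> open_var G \<le> var_outer U V (A i) + ennreal (e * (1/2) ^ Suc i)" for i
        proof -
          have "var_outer U V (A i) < \<infinity>" "0 < e * (1/2) ^ Suc i"
            using False e by (simp_all add: less_top)
          then show ?thesis by (rule var_outer_approx) blast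
        qed
        then obtain G where G: "\<And>i. open (G i)" "\<And>i. A i \<subseteq> G i" "\<And>i. G i \<subseteq> U"
          "\<And>i. open_var (G i) \<le> var_outer U V (A i) + ennreal (e * (1/2) ^ Suc i)" by metis
        have "var_outer U V (\<Union>i. A i) \<le> open_var (\<Union>i. G i)"
          by (intro var_outer_le open_UN ballI UN_mono UN_least G subset_refl)
        also have "\<dots> \<le> (\<Sum>i. open_var (G i))" by (rule open_var_UN) (use G in auto)
        also have "\<dots> \<le> (\<Sum>i. var_outer U V (A i) + ennreal (e * (1/2) ^ Suc i))"
          by (intro suminf_le G) auto
        also have "\<dots> = (\<Sum>i. var_outer U V (A i)) + (\<Sum>i. ennreal (e * (1/2) ^ Suc i))"
          by (intro suminf_add[symmetric]) auto
        also have "(\<Sum>i. ennreal (e * (1/2) ^ Suc i)) = ennreal e"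
          using sums_mult[OF power_half_series, of e] e by (intro suminf_ennreal_eq) auto
        finally show "var_outer U V (\<Union>i. A i) \<le> (\<Sum>i. var_outer U V (A i)) + ennreal e" .
      qed
    qed
  qed
qed

text \<open>The Caratheodory criterion for open sets \<open>W\<close>. A competitor
  \<open>g1\<close> on \<open>G \<inter> W\<close> has compact support; any competitor on the rest
  of \<open>G\<close> has support disjoint from it, so their sum still has length at most one. The
  rest contains \<open>G - W\<close>.\<close>

lemma open_var_disjoint:
  assumes G: "open G" "G \<subseteq> U" and W: "open W"
  shows "var_outer U V (G \<inter> W) + var_outer U V (G - W) \<le> open_var G"
proof -
  have 1: "ennreal (first_var V g1) + ennreal (first_var V g2) \<le> open_var G"
    if g: "g1 \<in> test_fields (G \<inter> W)" "\<forall>x. norm (g1 x) \<le> 1"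
      "g2 \<in> test_fields (G - closure {x. g1 x \<noteq> 0})" "\<forall>x. norm (g2 x) \<le> 1" for g1 g2
  proof -
    have t: "g1 \<in> test_fields G" "g2 \<in> test_fields G"
      using subsetD[OF test_fields_mono g(1)] subsetD[OF test_fields_mono g(3)] by auto
    have b: "first_var V g \<le> first_var V h \<Longrightarrow> h \<in> test_fields G \<Longrightarrow> \<forall>x. norm (h x) \<le> 1 \<Longrightarrow> ennreal (first_var V g) \<le> open_var G" for g h
      unfolding open_var_def by (rule SUP_upper2[of h]) (auto intro: ennreal_leI)
    have n: "norm (g1 x + g2 x) \<le> 1" for x
    proof (cases "x \<in> closure {x. g1 x \<noteq> 0}")
      case True
      then have "g2 x = 0" using test_fieldsD(4)[OF g(3), of x] by blast
      then show ?thesis using g(2) by simp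
    next
      case False
      then show ?thesis using closure_support_outside[of x g1] g(4) by simp
    qed
    have s: "first_var V (\<lambda>x. g1 x + g2 x) = first_var V g1 + first_var V g2"
      using t test_fields_mono[OF G(2)] by (intro first_var_add) auto
    \<comment> \<open>\<open>ennreal\<close> truncates negative numbers to 0, so it is additive only
      if both values are nonnegative. Otherwise one summand is 0 and the other is bounded by a
      single competitor.\<close>
    show ?thesis
    proof (cases "first_var V g1 \<ge> 0 \<and> first_var V g2 \<ge> 0")
      case True
      then have "ennreal (first_var V g1) + ennreal (first_var V g2) = ennreal (first_var V (\<lambda>x. g1 x + g2 x))"
        by (simp add: s)
      also have "\<dots> \<le> open_var G" by (rule b[OF order_refl test_fields_add[OF t]]) (use n in auto)
      finally show ?thesis .
    next
      case False
      then show ?thesis using b[OF order_refl t(1) g(2)] b[OF order_refl t(2) g(4)]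
        by (auto simp: not_le ennreal_neg)
    qed
  qed
  have 2: "ennreal (first_var V g1) + var_outer U V (G - W) \<le> open_var G"
    if g: "g1 \<in> test_fields (G \<inter> W)" "\<forall>x. norm (g1 x) \<le> 1" for g1
  proof -
    let ?K = "closure {x. g1 x \<noteq> 0}"
    have "var_outer U V (G - W) \<le> open_var (G - ?K)"
      using G test_fieldsD[OF g(1)] by (intro var_outer_le) auto
    then have "ennreal (first_var V g1) + var_outer U V (G - W) \<le> ennreal (first_var V g1) + open_var (G - ?K)"
      by (rule add_left_mono)
    also have "\<dots> = (SUP g2\<in>{g \<in> test_fields (G - ?K). \<forall>x. norm (g x) \<le> 1}. ennreal (first_var V g1) + ennreal (first_var V g2))"
      unfolding open_var_def using test_fields_zero
      by (intro ennreal_SUP_add_right) (force intro: test_fields_zero)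
    also have "\<dots> \<le> open_var G" by (rule SUP_least) (use 1[OF g] in auto)
    finally show ?thesis .
  qed
  have "var_outer U V (G \<inter> W) + var_outer U V (G - W) = open_var (G \<inter> W) + var_outer U V (G - W)"
    using G W by (subst var_outer_open) auto
  also have "\<dots> = (SUP g\<in>{g \<in> test_fields (G \<inter> W). \<forall>x. norm (g x) \<le> 1}. ennreal (first_var V g) + var_outer U V (G - W))"
    unfolding open_var_def by (intro ennreal_SUP_add_left[symmetric]) (force intro: test_fields_zero)
  also have "\<dots> \<le> open_var G" by (rule SUP_least) (use 2 in auto)
  finally show ?thesis .
qed

lemma open_in_lambda_system:
  assumes "open W" "W \<subseteq> U"
  shows "W \<in> lambda_system U (Pow U) (var_outer U V)"
proof -
  interpret sigma_algebra U "Pow U" by (rule sigma_algebra_Pow)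
  have "var_outer U V (A \<inter> W) + var_outer U V (A - W) = var_outer U V A" if A: "A \<subseteq> U" for A
  proof (rule antisym)
    show "var_outer U V (A \<inter> W) + var_outer U V (A - W) \<le> var_outer U V A"
      unfolding var_outer_eq_INF[of A]
    proof (rule INF_greatest, clarify)
      fix G assume G: "open G" "A \<subseteq> G" "G \<subseteq> U"
      have "var_outer U V (A \<inter> W) + var_outer U V (A - W) \<le> var_outer U V (G \<inter> W) + var_outer U V (G - W)"
        using G by (intro add_mono var_outer_mono) auto
      also have "\<dots> \<le> open_var G" by (rule open_var_disjoint[OF G(1,3) assms(1)])
      finally show "var_outer U V (A \<inter> W) + var_outer U V (A - W) \<le> open_var G" .
    qed
    have "subadditive (Pow U) (var_outer U V)"
      using outer_measure_space_var_outer
      by (auto simp: outer_measure_space_def intro: countably_subadditive_subadditive)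
    then have "var_outer U V ((A \<inter> W) \<union> (A - W)) \<le> var_outer U V (A \<inter> W) + var_outer U V (A - W)"
      by (rule subadditiveD) (use A in auto)
    then show "var_outer U V A \<le> var_outer U V (A \<inter> W) + var_outer U V (A - W)"
      by (simp add: Int_Diff_Un)
  qed
  then show ?thesis using assms by (auto simp: lambda_system_eq)
qed

section \<open>The total variation as a Borel measure\<close>

abbreviation \<beta> :: "(real^'n) measure" where "\<beta> \<equiv> var_measure U V"

lemma sets_var: "sets \<beta> = sets (restrict_space borel U)"
  unfolding var_measure_def using sets.sigma_sets_eq[of "restrict_space borel U"]
    sets.space_closed[of "restrict_space borel U"]
  by (simp add: space_restrict_space sets_measure_of)

lemma sets_var_iff: "A \<in> sets \<beta> \<longleftrightarrow> A \<in> sets borel \<and> A \<subseteq> U"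
  by (simp add: sets_var sets_U_iff)

lemma space_var: "space \<beta> = U"
  unfolding var_measure_def using sets.space_closed[of "restrict_space borel U"]
  by (simp add: space_restrict_space space_measure_of)

text \<open>\<open>measure_of\<close> returns the zero measure unless the given function is
  countably additive. That it is follows from Caratheodory's theorem, since the system of measurable
  sets contains the open subsets of \<open>U\<close> and hence all its Borel subsets.\<close>

lemma emeasure_var:
  assumes A: "A \<in> sets \<beta>" shows "emeasure \<beta> A = var_outer U V A"
proof -
  let ?L = "lambda_system U (Pow U) (var_outer U V)"
  interpret P: sigma_algebra U "Pow U" by (rule sigma_algebra_Pow)
  have ms: "measure_space U ?L (var_outer U V)"
    by (rule P.caratheodory_lemma[OF outer_measure_space_var_outer])
  then interpret L: sigma_algebra U ?L by (simp add: measure_space_def)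
  have "(\<lambda>x. x) \<in> borel_measurable (sigma U ?L)"
    by (rule borel_measurableI)
       (use open_in_lambda_system open_U in \<open>auto simp: L.space_closed Int_commute
          L.sigma_sets_eq sets_measure_of[OF L.space_closed] space_measure_of[OF L.space_closed]\<close>)
  then have sub: "B \<in> ?L" if "B \<in> sets (restrict_space borel U)" for B
    using measurable_sets[of "\<lambda>x. x" "sigma U ?L" borel B] that sets_U_iff[of B]
    by (auto simp: L.sigma_sets_eq sets_measure_of[OF L.space_closed] space_measure_of[OF L.space_closed] Int_absorb2)
  have sa: "sigma_algebra U (sets (restrict_space borel U))"
    using sets.sigma_algebra_axioms[of "restrict_space borel U"] by (simp add: space_restrict_space)
  have "measure_space U (sets (restrict_space borel U)) (var_outer U V)"
    using measure_down[OF ms sa] sub by auto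
  then show ?thesis
    using A unfolding sets_var
    by (simp add: var_measure_def emeasure_measure_of_sigma measure_space_def)
qed

lemma borel_measurable_var: "continuous_on U f \<Longrightarrow> f \<in> borel_measurable \<beta>"
  using borel_measurable_continuous_on_restrict measurable_cong_sets[OF sets_var refl] by blast

lemma emeasure_var_open: "open G \<Longrightarrow> G \<subseteq> U \<Longrightarrow> emeasure \<beta> G = open_var G"
  by (subst emeasure_var) (auto simp: sets_var_iff var_outer_open)

lemma var_outer_regular:
  assumes "A \<in> sets \<beta>" "emeasure \<beta> A < \<infinity>" "0 < e"
  obtains G where "open G" "A \<subseteq> G" "G \<subseteq> U" "emeasure \<beta> G \<le> emeasure \<beta> A + ennreal e"
  using var_outer_approx[of A e] assms
  by (metis emeasure_var emeasure_var_open)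

lemma var_outside_spt: "emeasure \<beta> (U - spt U \<mu>) = 0"
proof -
  have "first_var V g = 0" if g: "g \<in> test_fields (U - spt U \<mu>)" for g
  proof -
    have "AE p in V. divg g p = 0"
    proof (rule AE_I)
      show "(U - spt U \<mu>) \<times> Grass m \<in> sets V" using spt_null(1) by (intro cylinder_sets) auto
      show "emeasure V ((U - spt U \<mu>) \<times> Grass m) = 0"
        using spt_null(1) emeasure_weight[of "U - spt U \<mu>"] by (auto simp: null_sets_def)
      show "{p \<in> space V. divg g p \<noteq> 0} \<subseteq> (U - spt U \<mu>) \<times> Grass m"
        using test_fieldsD(3)[OF g] divg_outside[of _ g] by (force simp: space_V)
    qed
    then show ?thesis by (simp add: first_var_divg integral_eq_zero_AE)
  qed
  then have "open_var (U - spt U \<mu>) = 0"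
    unfolding open_var_def using test_fields_zero[of "U - spt U \<mu>"] by (auto intro!: antisym SUP_least)
  then show ?thesis using open_diff_spt by (subst emeasure_var_open) auto
qed

end

locale radon_varifold = open_varifold U m V for U :: "(real^'n::finite) set" and m :: nat and V :: "'n varif" +
  assumes radon_var: "radon_var U V"
begin

lemma radon_on_var: "radon_on U \<beta>"
  using radon_var by (simp add: radon_var_def)

lemma compact_sets_var: "compact K \<Longrightarrow> K \<subseteq> U \<Longrightarrow> K \<in> sets \<beta>"
  by (simp add: sets_var_iff compact_imp_closed)

lemma integrable_var:
  assumes "continuous_on U f" "compact K" "K \<subseteq> U" "\<And>x. x \<in> U - K \<Longrightarrow> f x = (0::real)"
  shows "integrable \<beta> f"
  by (rule radon_integrable_continuous[OF radon_on_var assms])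

lemma integrable_norm_test: "g \<in> test_fields U \<Longrightarrow> integrable \<beta> (\<lambda>x. norm (g x))"
  by (rule integrable_var[where K = "closure {x. g x \<noteq> 0}"])
    (blast intro: continuous_on_norm smooth_imp_continuous_on test_fieldsD(1), blast dest: test_fieldsD,
      blast dest: test_fieldsD, metis closure_support_outside DiffD2 norm_zero)

lemma first_var_le_measure:
  assumes "open G" "G \<subseteq> U" "g \<in> test_fields G" "\<And>x. norm (g x) \<le> c" "emeasure \<beta> G < \<infinity>" "0 \<le> c"
  shows "first_var V g \<le> c * measure \<beta> G"
proof -
  have "ennreal (first_var V g) \<le> ennreal c * emeasure \<beta> G"
    using first_var_le_open_var[OF assms(3,2,4)] emeasure_var_open[OF assms(1,2)] by simp
  also have "\<dots> = ennreal (c * measure \<beta> G)"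
    using assms by (simp add: emeasure_eq_ennreal_measure ennreal_mult less_top)
  finally show ?thesis using assms by (simp add: ennreal_le_iff)
qed

text \<open>The definition of the variation controls \<open>first_var\<close> only by the supremum
  norm times the measure. Peeling off the layers of height \<open>e\<close> of the norm of
  \<open>g\<close> from the top turns this into an integral bound: each layer is cut out by a cutoff
  on a slightly larger open set, on which the supremum bound loses little. The number
  \<open>d\<close> is the total slack of the cuts.\<close>

lemma first_var_le_layers:
  assumes e: "0 < e"
  shows "g \<in> test_fields U \<Longrightarrow> (\<And>x. g x = 0 \<or> norm (g x) < real n * e) \<Longrightarrow> 0 < d \<Longrightarrow>
    first_var V g \<le> (LINT x:closure {x. g x \<noteq> 0}|\<beta>. norm (g x) + e) + d"
proof (induction n arbitrary: g d)
  case 0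
  have "g x = 0" for x using "0.prems"(2)[of x] by simp
  then have "g = (\<lambda>x. 0)" by blast
  then show ?case using "0.prems"(3) by (simp add: first_var_zero set_lebesgue_integral_def)
next
  case (Suc n)
  define S where "S = closure {x. g x \<noteq> 0}"
  note D = test_fieldsD[OF Suc.prems(1), folded S_def]
  \<comment> \<open>The top layer. On it the norm of \<open>g\<close> plus \<open>e\<close> is at
    least \<open>c\<close>, the bound for \<open>g\<close> everywhere, so paying \<open>c\<close>
    times its measure is covered by the integral over \<open>C\<close>.\<close>
  define C where "C = S \<inter> {x. real n * e \<le> norm (g x)}"
  have C: "compact C" "C \<subseteq> U" unfolding C_def using D
    by (auto intro!: compact_Int_closed closed_Collect_le continuous_on_const continuous_on_norm smooth_imp_continuous_on[OF D(1)])
  define c where "c = real (Suc n) * e"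
  have c: "0 < c" using e by (simp add: c_def)
  have gc: "norm (g x) \<le> c" for x using Suc.prems(2)[of x] c by (auto simp: c_def)
  \<comment> \<open>The excess measure is multiplied by the bound \<open>c\<close>; this choice
    makes it cost d/2 and leaves d/2 for the induction hypothesis.\<close>
  obtain G where G: "open G" "C \<subseteq> G" "G \<subseteq> U" "emeasure \<beta> G \<le> emeasure \<beta> C + ennreal (d / (2 * c))"
    by (rule var_outer_regular[OF compact_sets_var[OF C] radon_onD(3)[OF radon_on_var C], of "d / (2 * c)"])
      (use c Suc.prems(3) in auto)
  have finC: "emeasure \<beta> C < \<infinity>" by (rule radon_onD(3)[OF radon_on_var C])
  then have finG: "emeasure \<beta> G < \<infinity>" using G(4) by (auto simp: less_top[symmetric] top_unique)
  have mG: "measure \<beta> G \<le> measure \<beta> C + d / (2 * c)"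
    using G(4) finC finG c Suc.prems(3)
    by (simp add: emeasure_eq_ennreal_measure less_top[symmetric] ennreal_plus[symmetric] ennreal_le_iff del: ennreal_plus)
  obtain \<phi> where \<phi>: "\<And>x. 0 \<le> \<phi> x" "\<And>x. \<phi> x \<le> (1::real)" "\<And>x. x \<in> C \<Longrightarrow> \<phi> x = 1"
    "(\<lambda>x. \<phi> x *\<^sub>R g x) \<in> test_fields (S \<inter> G)" "(\<lambda>x. (1 - \<phi> x) *\<^sub>R g x) \<in> test_fields (S - C)"
    unfolding S_def by (rule test_fields_split[OF test_fields_closure_support[OF Suc.prems(1)] C(1) G(1,2)]) blast
  have 1: "(\<lambda>x. \<phi> x *\<^sub>R g x) \<in> test_fields G" by (rule subsetD[OF test_fields_mono \<phi>(4)]) auto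
  have 2: "(\<lambda>x. (1 - \<phi> x) *\<^sub>R g x) \<in> test_fields U" by (rule subsetD[OF test_fields_mono \<phi>(5)]) (use D in auto)
  define g' where "g' = (\<lambda>x. (1 - \<phi> x) *\<^sub>R g x)"
  define S' where "S' = closure {x. g' x \<noteq> 0}"
  have S': "compact S'" "S' \<subseteq> S - C" using test_fieldsD[OF \<phi>(5)] by (auto simp: S'_def g'_def)
  have g'g: "norm (g' x) \<le> norm (g x)" for x
    using \<phi>(1,2)[of x] by (auto simp: g'_def intro!: mult_left_le_one_le)
  have split: "first_var V g = first_var V (\<lambda>x. \<phi> x *\<^sub>R g x) + first_var V g'"
    unfolding g'_def by (rule first_var_split[OF Suc.prems(1) subsetD[OF test_fields_mono[OF G(3)] 1] 2])
  have I: "set_integrable \<beta> K (\<lambda>x. norm (h x) + e)" if "compact K" "K \<subseteq> U" "continuous_on UNIV h" for K and h :: "_ \<Rightarrow> real^'n"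
  proof -
    have "bounded ((\<lambda>x. norm (h x) + e) ` K)"
      by (intro compact_imp_bounded compact_continuous_image continuous_intros continuous_on_subset[OF that(3)] that) auto
    then obtain B where B: "\<And>x. x \<in> K \<Longrightarrow> norm (norm (h x) + e) \<le> B" by (auto simp: bounded_iff)
    have "(\<lambda>x. norm (h x) + e) \<in> borel_measurable \<beta>"
      by (intro borel_measurable_var continuous_intros continuous_on_subset[OF that(3)]) auto
    then show ?thesis unfolding set_integrable_def
      using compact_sets_var[OF that(1,2)] B radon_onD(3)[OF radon_on_var that(1,2)]
      by (intro integrableI_bounded_set[of K \<beta> _ B]) (auto simp: indicator_def)
  qed
  have cg: "continuous_on UNIV g" "continuous_on UNIV g'"
    using D(1) test_fieldsD(1)[OF 2] by (auto simp: g'_def intro: smooth_imp_continuous_on)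
  have "first_var V g' \<le> (LINT x:S'|\<beta>. norm (g' x) + e) + d / 2"
    unfolding S'_def
  proof (rule Suc.IH)
    show "g' \<in> test_fields U" using 2 by (simp add: g'_def)
    show "g' x = 0 \<or> norm (g' x) < real n * e" for x
    proof (cases "x \<in> C \<or> x \<notin> S")
      case True
      then have "g' x = 0" using \<phi>(3)[of x] closure_support_outside[of x g] by (auto simp: g'_def S_def)
      then show ?thesis by simp
    next
      case False
      then have "norm (g x) < real n * e" by (auto simp: C_def)
      then show ?thesis using g'g[of x] by linarith
    qed
  qed (use Suc.prems in auto)
  moreover have "(LINT x:S'|\<beta>. norm (g' x) + e) \<le> (LINT x:S'|\<beta>. norm (g x) + e)"
    using I[OF S'(1) _ cg(1)] I[OF S'(1) _ cg(2)] S'(2) D(3) g'g by (intro set_integral_mono) auto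
  moreover have "first_var V (\<lambda>x. \<phi> x *\<^sub>R g x) \<le> c * measure \<beta> G"
  proof (rule first_var_le_measure[OF G(1,3) 1 _ finG])
    show "norm (\<phi> x *\<^sub>R g x) \<le> c" for x
      using \<phi>(1,2)[of x] gc[of x] mult_left_le_one_le[of "norm (g x)" "\<phi> x"] by simp
  qed (use c in auto)
  moreover have "c * measure \<beta> G \<le> c * measure \<beta> C + d / 2"
  proof -
    have "c * measure \<beta> G \<le> c * (measure \<beta> C + d / (2 * c))" using mG c by simp
    also have "\<dots> = c * measure \<beta> C + d / 2" using c by (simp add: distrib_left)
    finally show ?thesis .
  qed
  moreover have "c * measure \<beta> C \<le> (LINT x:C|\<beta>. norm (g x) + e)"
  proof -
    have "c * measure \<beta> C = (LINT x:C|\<beta>. c)"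
      using finC compact_sets_var[OF C] by (simp add: set_lebesgue_integral_def)
    also have "\<dots> \<le> (LINT x:C|\<beta>. norm (g x) + e)"
      using I[OF C cg(1)] finC compact_sets_var[OF C]
      by (intro set_integral_mono) (auto simp: set_integrable_def C_def c_def algebra_simps)
    finally show ?thesis .
  qed
  \<comment> \<open>The remaining field is supported off \<open>C\<close>, so the two integrals are
    over disjoint subsets of \<open>S\<close>.\<close>
  moreover have "(LINT x:C|\<beta>. norm (g x) + e) + (LINT x:S'|\<beta>. norm (g x) + e) \<le> (LINT x:S|\<beta>. norm (g x) + e)"
  proof -
    have "(LINT x:C|\<beta>. norm (g x) + e) + (LINT x:S'|\<beta>. norm (g x) + e) = (LINT x:C \<union> S'|\<beta>. norm (g x) + e)"
      using S' C D(3) I[OF C cg(1)] I[OF S'(1) _ cg(1)] by (intro set_integral_Un[symmetric]) auto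
    also have "\<dots> \<le> (LINT x:S|\<beta>. norm (g x) + e)"
      unfolding set_lebesgue_integral_def
      using I[OF D(2,3) cg(1)] I[of "C \<union> S'" g] S' C D(2,3) e cg(1)
      by (intro integral_mono) (auto simp: set_integrable_def indicator_def C_def split: if_splits)
    finally show ?thesis .
  qed
  ultimately show ?case using split by (simp add: S_def)
qed

theorem first_var_le:
  assumes g: "g \<in> test_fields U"
  shows "first_var V g \<le> (LINT x|\<beta>. norm (g x))"
proof -
  let ?S = "closure {x. g x \<noteq> 0}"
  note D = test_fieldsD[OF g]
  have S: "?S \<in> sets \<beta>" "emeasure \<beta> ?S < \<infinity>"
    using compact_sets_var[OF D(2,3)] radon_onD(3)[OF radon_on_var D(2,3)] by auto
  have "bounded (g ` ?S)"
    by (intro compact_imp_bounded compact_continuous_image smooth_imp_continuous_on D)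
  then obtain B where B: "\<And>x. x \<in> ?S \<Longrightarrow> norm (g x) \<le> B" by (auto simp: bounded_iff)
  have le: "first_var V g \<le> (LINT x|\<beta>. norm (g x)) + (e * measure \<beta> ?S + e)" if e: "0 < e" for e
  proof -
    obtain n where n: "B < real n * e" using ex_less_of_nat_mult[OF e] by blast
    have "first_var V g \<le> (LINT x:?S|\<beta>. norm (g x) + e) + e"
      by (rule first_var_le_layers[OF e g _ e, of n]) (use B n closure_support_outside in \<open>metis less_le_trans not_le\<close>)
    also have "(LINT x:?S|\<beta>. norm (g x) + e) = (LINT x|\<beta>. norm (g x) + e * indicator ?S x)"
      unfolding set_lebesgue_integral_def
    proof (rule Bochner_Integration.integral_cong[OF refl])
      fix x show "indicator ?S x *\<^sub>R (norm (g x) + e) = norm (g x) + e * indicator ?S x"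
        using closure_support_outside[of x g] by (cases "x \<in> ?S") auto
    qed
    also have "\<dots> = (LINT x|\<beta>. norm (g x)) + e * measure \<beta> ?S"
      using integrable_norm_test[OF g] S by (subst Bochner_Integration.integral_add) auto
    finally show ?thesis by simp
  qed
  show ?thesis
  proof (rule field_le_epsilon)
    fix d :: real assume d: "0 < d"
    \<comment> \<open>With this layer height the error \<open>e * measure \<beta> ?S + e\<close> is
      exactly \<open>d\<close>; the added 1 covers a support of measure zero.\<close>
    define e where "e = d / (measure \<beta> ?S + 1)"
    have p: "measure \<beta> ?S + 1 > 0" using measure_nonneg[of \<beta> ?S] by linarith
    then have "0 < e" using d by (simp add: e_def)
    moreover have "e * measure \<beta> ?S + e = e * (measure \<beta> ?S + 1)" by (simp add: algebra_simps)
    moreover have "\<dots> = d" using p by (simp add: e_def)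
    ultimately show "first_var V g \<le> (LINT x|\<beta>. norm (g x)) + d" using le[of e] by simp
  qed
qed

end

section \<open>Representation of the first variation by a unit field\<close>

text \<open>The dual of L^1 is L^infinity, obtained from the Radon-Nikodym theorem. A functional of
  norm at most one plus the integral is positive, hence gives a positive measure; its density,
  corrected for the added integral, represents the functional.\<close>

lemma (in sigma_finite_measure) L1_dual:
  fixes \<Phi> :: "('a \<Rightarrow> real) \<Rightarrow> real"
  assumes add: "\<And>f g. integrable M f \<Longrightarrow> integrable M g \<Longrightarrow> \<Phi> (\<lambda>x. f x + g x) = \<Phi> f + \<Phi> g"
    and scale: "\<And>c f. integrable M f \<Longrightarrow> \<Phi> (\<lambda>x. c * f x) = c * \<Phi> f"
    and bound: "\<And>f. integrable M f \<Longrightarrow> \<bar>\<Phi> f\<bar> \<le> (LINT x|M. \<bar>f x\<bar>)"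
  obtains \<zeta> where "\<zeta> \<in> borel_measurable M" "\<And>x. \<bar>\<zeta> x\<bar> \<le> 1"
    "\<And>f. integrable M f \<Longrightarrow> \<Phi> f = (LINT x|M. f x * \<zeta> x)"
proof -
  \<comment> \<open>Dominated convergence, transferred to \<Phi> by the L^1 bound. It provides
    countable additivity of \<open>q\<close> and later the limit step of the induction over
    integrable functions.\<close>
  have cont: "(\<lambda>i. \<Phi> (s i)) \<longlonglongrightarrow> \<Phi> f"
    if s: "\<And>i. integrable M (s i)" and f: "integrable M f" and u: "integrable M u"
      and lim: "\<And>x. x \<in> space M \<Longrightarrow> (\<lambda>i. s i x) \<longlonglongrightarrow> f x"
      and dom: "\<And>i x. x \<in> space M \<Longrightarrow> \<bar>s i x\<bar> \<le> u x" for s :: "nat \<Rightarrow> 'a \<Rightarrow> real" and f u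
  proof -
    have "(\<lambda>i. LINT x|M. \<bar>s i x - f x\<bar>) \<longlonglongrightarrow> (LINT x|M. (0::real))"
    proof (rule integral_dominated_convergence[where w = "\<lambda>x. u x + \<bar>f x\<bar>"])
      show "AE x in M. (\<lambda>i. \<bar>s i x - f x\<bar>) \<longlonglongrightarrow> 0"
        using lim by (auto intro!: AE_I2 tendsto_rabs_zero LIM_zero)
      show "AE x in M. norm \<bar>s i x - f x\<bar> \<le> u x + \<bar>f x\<bar>" for i
      proof (rule AE_I2)
        fix x assume "x \<in> space M"
        then show "norm \<bar>s i x - f x\<bar> \<le> u x + \<bar>f x\<bar>" using dom[of x i] by auto
      qed
    qed (use s f u in auto)
    then have L: "(\<lambda>i. LINT x|M. \<bar>s i x - f x\<bar>) \<longlonglongrightarrow> 0" by simp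
    have "\<bar>\<Phi> (s i) - \<Phi> f\<bar> \<le> (LINT x|M. \<bar>s i x - f x\<bar>)" for i
      using bound[of "\<lambda>x. s i x + (-1) * f x"] add[OF s, of "\<lambda>x. (-1) * f x" i] scale[OF f, of "-1"] s f
      by simp
    then have "(\<lambda>i. \<Phi> (s i) - \<Phi> f) \<longlonglongrightarrow> 0"
      by (intro Lim_null_comparison[OF _ L]) auto
    then show ?thesis by (simp add: LIM_zero_iff)
  qed
  \<comment> \<open>A strictly positive integrable weight replaces the possibly infinite measure by
    a finite one: multiplied by \<open>w\<close>, every measurable indicator is an admissible
    argument of \<Phi>.\<close>
  obtain h where h: "h \<in> borel_measurable M" "integral\<^sup>N M h \<noteq> \<infinity>" "\<forall>x\<in>space M. 0 < h x \<and> h x < \<infinity>"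
    using Ex_finite_integrable_function by blast
  define w where "w x = enn2real (h x)" for x
  have wm[measurable]: "w \<in> borel_measurable M" using h(1) unfolding w_def by measurable
  have wpos: "w x > 0" if "x \<in> space M" for x using h(3) that by (auto simp: w_def enn2real_positive_iff)
  have wnn: "w x \<ge> 0" for x by (simp add: w_def)
  have "integral\<^sup>N M w = integral\<^sup>N M h"
    using h(3) by (intro nn_integral_cong) (auto simp: w_def)
  then have wi: "integrable M w" using h(2) wnn by (intro integrableI_nonneg) (auto simp: less_top)
  have wA: "integrable M (\<lambda>x. indicator A x * w x)" if "A \<in> sets M" for A
    using integrable_mult_indicator[OF that wi] by simp
  \<comment> \<open>The added integral makes the set function nonnegative because of the bound on
    \<Phi>; it is subtracted again in \<open>k\<close>.\<close>
  define q where "q A = \<Phi> (\<lambda>x. indicator A x * w x) + (LINT x|M. indicator A x * w x)" for A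
  have q_nonneg: "q A \<ge> 0" if "A \<in> sets M" for A
    using bound[OF wA[OF that]] wnn by (auto simp: q_def abs_mult)
  have q_le: "q A \<le> 2 * (LINT x|M. indicator A x * w x)" if "A \<in> sets M" for A
    using bound[OF wA[OF that]] wnn by (auto simp: q_def abs_mult)
  have q_Un: "q (A \<union> B) = q A + q B" if "A \<in> sets M" "B \<in> sets M" "A \<inter> B = {}" for A B
  proof -
    have "(\<lambda>x. indicator (A \<union> B) x * w x) = (\<lambda>x. indicator A x * w x + indicator B x * w x)"
      using that(3) by (intro ext) (auto split: split_indicator)
    then show ?thesis using add[OF wA[OF that(1)] wA[OF that(2)]] wA[OF that(1)] wA[OF that(2)]
      by (simp add: q_def)
  qed
  define Q where "Q = measure_of (space M) (sets M) (\<lambda>A. ennreal (q A))"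
  have setsQ: "sets Q = sets M" by (simp add: Q_def)
  have zero: "q {} = 0" using q_le[of "{}"] q_nonneg[of "{}"] by simp
  have Q: "emeasure Q A = ennreal (q A)" if "A \<in> sets M" for A
    unfolding Q_def
  proof (rule emeasure_measure_of_sigma[OF sets.sigma_algebra_axioms _ _ that])
    show "positive (sets M) (\<lambda>A. ennreal (q A))" by (simp add: positive_def zero)
    show "countably_additive (sets M) (\<lambda>A. ennreal (q A))"
    proof (rule countably_additiveI)
      fix A :: "nat \<Rightarrow> 'a set" assume A: "range A \<subseteq> sets M" "disjoint_family A" "(\<Union>i. A i) \<in> sets M"
      have m: "(\<Union>i<n. A i) \<in> sets M" for n using A by auto
      have "(\<Sum>i<n. q (A i)) = q (\<Union>i<n. A i)" for n
      proof (induction n)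
        case 0 then show ?case by (simp add: zero)
      next
        case (Suc n)
        have "(\<Union>i<Suc n. A i) = (\<Union>i<n. A i) \<union> A n" by (auto simp: lessThan_Suc)
        moreover have "(\<Union>i<n. A i) \<inter> A n = {}"
        proof -
          have "A i \<inter> A n = {}" if "i < n" for i using A(2) that by (auto simp: disjoint_family_on_def)
          then show ?thesis by auto
        qed
        ultimately show ?case using q_Un[OF m[of n], of "A n"] A(1) Suc by auto
      qed
      moreover have "(\<lambda>n. q (\<Union>i<n. A i)) \<longlonglongrightarrow> q (\<Union>i. A i)"
      proof -
        have lim: "(\<lambda>n. indicator (\<Union>i<n. A i) x * w x) \<longlonglongrightarrow> indicator (\<Union>i. A i) x * w x" for x
          by (intro tendsto_mult_right LIMSEQ_indicator_UN)
        have dom: "\<bar>indicator (\<Union>i<n. A i) x * w x\<bar> \<le> w x" for n x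
          using wnn[of x] by (auto simp: indicator_def)
        show ?thesis unfolding q_def
        proof (intro tendsto_add cont[OF wA[OF m] wA[OF A(3)] wi lim dom])
          show "(\<lambda>n. LINT x|M. indicator (\<Union>i<n. A i) x * w x) \<longlonglongrightarrow> (LINT x|M. indicator (\<Union>i. A i) x * w x)"
            by (rule integral_dominated_convergence[where w = w]) (use lim dom wA[OF m] wA[OF A(3)] wi in auto)
        qed
      qed
      ultimately have "(\<lambda>i. q (A i)) sums q (\<Union>i. A i)" by (simp add: sums_def)
      then show "(\<Sum>i. ennreal (q (A i))) = ennreal (q (\<Union>i. A i))"
        using A(1) q_nonneg by (intro suminf_ennreal_eq) auto
    qed
  qed
  have "absolutely_continuous M Q"
    unfolding absolutely_continuous_def
  proof
    fix A assume A: "A \<in> null_sets M"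
    have "(LINT x|M. indicator A x * w x) = 0"
      using AE_not_in[OF A] by (intro integral_eq_zero_AE) (auto elim!: eventually_mono)
    then have "q A = 0" using q_nonneg[of A] q_le[of A] A by auto
    then show "A \<in> null_sets Q" using A Q[of A] by (auto simp: null_sets_def setsQ)
  qed
  then obtain f where f[measurable]: "f \<in> borel_measurable M" and fQ: "density M f = Q"
    using Radon_Nikodym[OF _ setsQ] by blast
  have f_int: "(\<integral>\<^sup>+x. f x * indicator A x \<partial>M) = ennreal (q A)" if "A \<in> sets M" for A
    using Q[OF that] emeasure_density[OF f that] fQ by simp
  have f_fin: "AE x in M. f x \<noteq> \<infinity>"
  proof (rule nn_integral_PInf_AE[OF f])
    have "integral\<^sup>N M f = (\<integral>\<^sup>+x. f x * indicator (space M) x \<partial>M)" by (intro nn_integral_cong) auto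
    then show "integral\<^sup>N M f \<noteq> \<infinity>" using f_int[OF sets.top] by simp
  qed
  define k where "k x = enn2real (f x) - w x" for x
  have fi: "integrable M (\<lambda>x. indicator A x * enn2real (f x))"
    and fe: "(LINT x|M. indicator A x * enn2real (f x)) = q A" if A: "A \<in> sets M" for A
  proof -
    have "(\<integral>\<^sup>+x. ennreal (indicator A x * enn2real (f x)) \<partial>M) = (\<integral>\<^sup>+x. f x * indicator A x \<partial>M)"
      using f_fin by (intro nn_integral_cong_AE) (auto elim!: eventually_mono simp: less_top indicator_def split: split_indicator)
    then have e: "(\<integral>\<^sup>+x. ennreal (indicator A x * enn2real (f x)) \<partial>M) = ennreal (q A)"
      using f_int[OF A] by simp
    show "integrable M (\<lambda>x. indicator A x * enn2real (f x))"
      by (rule integrableI_nonneg) (use A e in \<open>auto simp: indicator_def\<close>)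
    show "(LINT x|M. indicator A x * enn2real (f x)) = q A"
      using A q_nonneg[OF A] e by (intro integral_eq_nn_integral[THEN trans]) auto
  qed
  have "integrable M (\<lambda>x. indicator (space M) x * enn2real (f x)) = integrable M (\<lambda>x. enn2real (f x))"
    by (intro Bochner_Integration.integrable_cong) auto
  then have ki: "integrable M k" unfolding k_def using fi[OF sets.top] wi by simp
  have kA: "(LINT x|M. indicator A x * k x) = \<Phi> (\<lambda>x. indicator A x * w x)" if A: "A \<in> sets M" for A
    using fi[OF A] fe[OF A] wA[OF A] by (simp add: k_def right_diff_distrib q_def)
  have "AE x in M. 0 \<le> w x + k x"
  proof (rule density_nonneg)
    show "0 \<le> set_lebesgue_integral M A (\<lambda>x. w x + k x)" if A: "A \<in> sets M" for A
      using kA[OF A] q_nonneg[OF A] wA[OF A] integrable_mult_indicator[OF A ki]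
      by (simp add: set_lebesgue_integral_def distrib_left q_def)
  qed (use ki wi in auto)
  moreover have "AE x in M. 0 \<le> w x - k x"
  proof (rule density_nonneg)
    show "0 \<le> set_lebesgue_integral M A (\<lambda>x. w x - k x)" if A: "A \<in> sets M" for A
      using kA[OF A] q_le[OF A] wA[OF A] integrable_mult_indicator[OF A ki]
      by (simp add: set_lebesgue_integral_def right_diff_distrib q_def)
  qed (use ki wi in auto)
  ultimately have kw: "AE x in M. \<bar>k x\<bar> \<le> w x" by eventually_elim auto
  have km[measurable]: "k \<in> borel_measurable M" using ki by auto
  \<comment> \<open>The quotient lies between -1 and 1 almost everywhere; clipping it makes the
    bound hold at every point without changing it elsewhere.\<close>
  define \<zeta> where "\<zeta> x = max (-1) (min 1 (k x / w x))" for x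
  have zm[measurable]: "\<zeta> \<in> borel_measurable M" unfolding \<zeta>_def by measurable
  have zb: "\<bar>\<zeta> x\<bar> \<le> 1" for x by (auto simp: \<zeta>_def)
  have zk: "AE x in M. w x * \<zeta> x = k x"
    using kw AE_space
  proof eventually_elim
    case (elim x)
    then have "\<bar>k x / w x\<bar> \<le> 1" using wpos[of x] by (simp add: field_simps)
    then have "- 1 \<le> k x / w x" "k x / w x \<le> 1" unfolding abs_le_iff by linarith+
    then have "\<zeta> x = k x / w x" by (simp add: \<zeta>_def)
    then show ?case using wpos[of x] elim by simp
  qed
  have zi: "integrable M (\<lambda>x. f x * \<zeta> x)" if "integrable M f" for f :: "'a \<Rightarrow> real"
    using that zb by (intro Bochner_Integration.integrable_bound[OF that])
      (auto simp: abs_mult intro!: AE_I2 mult_right_le_one_le)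
  \<comment> \<open>Induction over functions integrable for the weighted measure: its base case
    consists of multiples of indicators, where the representation is \<open>kA\<close>.\<close>
  let ?N = "density M w"
  have P: "\<Phi> (\<lambda>x. w x * g x) = (LINT x|M. w x * g x * \<zeta> x)" if "integrable ?N g" for g :: "'a \<Rightarrow> real"
    using that
  proof induction
    case (base A c)
    have A[measurable]: "A \<in> sets M" using base by simp
    have ck: "(LINT x|M. indicator A x * k x) = (LINT x|M. indicator A x * (w x * \<zeta> x))"
    proof (rule integral_cong_AE)
      show "AE x in M. indicator A x * k x = indicator A x * (w x * \<zeta> x)" using zk by eventually_elim simp
    qed measurable
    have "\<Phi> (\<lambda>x. w x * (indicator A x *\<^sub>R c)) = c * \<Phi> (\<lambda>x. indicator A x * w x)"
      using scale[OF wA[OF A], of c] by (simp add: mult_ac)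
    also have "\<dots> = c * (LINT x|M. indicator A x * (w x * \<zeta> x))"
      unfolding kA[OF A, symmetric] ck ..
    also have "\<dots> = (LINT x|M. w x * (indicator A x *\<^sub>R c) * \<zeta> x)"
      by (subst integral_mult_right_zero[symmetric]) (simp add: mult_ac)
    finally show ?case .
  next
    case (add f g)
    have i: "integrable M (\<lambda>x. w x * f x)" "integrable M (\<lambda>x. w x * g x)"
      using add.hyps integrable_density[of f M w] integrable_density[of g M w] wnn by auto
    then show ?case using add.IH assms(1)[OF i] zi[OF i(1)] zi[OF i(2)] by (simp add: algebra_simps)
  next
    case (lim f s)
    have fm: "f \<in> borel_measurable M" "\<And>i. s i \<in> borel_measurable M"
      using borel_measurable_integrable[OF lim.hyps(4)] borel_measurable_integrable[OF lim.hyps(1)] by auto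
    have i: "integrable M (\<lambda>x. w x * f x)" "\<And>j. integrable M (\<lambda>x. w x * s j x)"
      using lim.hyps(1,4) integrable_density[of f M w] integrable_density[of "s _" M w] wnn fm by auto
    have u: "integrable M (\<lambda>x. 2 * \<bar>w x * f x\<bar>)" using i(1) by auto
    have l: "(\<lambda>j. w x * s j x) \<longlonglongrightarrow> w x * f x" if "x \<in> space M" for x
      using lim.hyps(2)[of x] that by (auto intro: tendsto_intros)
    have d: "\<bar>w x * s j x\<bar> \<le> 2 * \<bar>w x * f x\<bar>" if "x \<in> space M" for j x
      using mult_left_mono[OF lim.hyps(3)[of x j] wnn[of x]] that wnn[of x] by (simp add: abs_mult mult_ac)
    have "(\<lambda>j. \<Phi> (\<lambda>x. w x * s j x)) \<longlonglongrightarrow> \<Phi> (\<lambda>x. w x * f x)"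
      by (rule cont[OF i(2) i(1) u l d])
    moreover have "(\<lambda>j. LINT x|M. w x * s j x * \<zeta> x) \<longlonglongrightarrow> (LINT x|M. w x * f x * \<zeta> x)"
    proof (rule integral_dominated_convergence[OF _ _ u])
      show "AE x in M. (\<lambda>j. w x * s j x * \<zeta> x) \<longlonglongrightarrow> w x * f x * \<zeta> x"
        using l by (auto intro!: AE_I2 tendsto_mult_right)
      show "AE x in M. norm (w x * s j x * \<zeta> x) \<le> 2 * \<bar>w x * f x\<bar>" for j
      proof (rule AE_I2)
        fix x assume x: "x \<in> space M"
        have "norm (w x * s j x * \<zeta> x) \<le> \<bar>w x * s j x\<bar> * 1"
          unfolding real_norm_def abs_mult[of _ "\<zeta> x"] by (rule mult_left_mono[OF zb]) auto
        then show "norm (w x * s j x * \<zeta> x) \<le> 2 * \<bar>w x * f x\<bar>" using d[OF x, of j] by simp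
      qed
    qed (use i zi in auto)
    ultimately show ?case using lim.IH LIMSEQ_unique by auto
  qed
  show thesis
  proof (rule that[OF zm zb])
    fix g :: "'a \<Rightarrow> real" assume g: "integrable M g"
    define g' where "g' x = g x / w x" for x
    have gm: "g' \<in> borel_measurable M" using g unfolding g'_def by measurable
    have gg: "w x * g' x = g x" if "x \<in> space M" for x using wpos[OF that] by (simp add: g'_def)
    have i: "integrable M (\<lambda>x. w x * g' x)"
      using g by (rule Bochner_Integration.integrable_cong[OF refl, THEN iffD2, rotated]) (rule gg)
    \<comment> \<open>The two arguments agree on \<open>space M\<close> but may differ outside it;
      the bound applied to their difference shows that \<Phi> does not notice.\<close>
    have "\<Phi> g = \<Phi> (\<lambda>x. w x * g' x)"
    proof -
      have "integrable M (\<lambda>x. g x + (-1) * (w x * g' x))" using g i by auto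
      then have "\<bar>\<Phi> (\<lambda>x. g x + (-1) * (w x * g' x))\<bar> \<le> (LINT x|M. \<bar>g x + (-1) * (w x * g' x)\<bar>)"
        by (rule bound)
      also have "\<dots> = (LINT x|M. 0)" by (intro Bochner_Integration.integral_cong) (auto simp: gg)
      finally show ?thesis using add[OF g, of "\<lambda>x. (-1) * (w x * g' x)"] scale[OF i, of "-1"] i by simp
    qed
    also have "\<dots> = (LINT x|M. w x * g' x * \<zeta> x)"
      using integrable_density[of g' M w] wnn gm i by (intro P) auto
    also have "\<dots> = (LINT x|M. g x * \<zeta> x)" by (intro Bochner_Integration.integral_cong) (auto simp: gg)
    finally show "\<Phi> g = (LINT x|M. g x * \<zeta> x)" .
  qed
qed

text \<open>The library theorem \<open>inner_regular\<close> concerns finite Borel measures on the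
  whole space. Restricting \<open>M\<close> to \<open>A\<close> and pushing it forward by the
  identity produces such a measure.\<close>

lemma compact_subset_approx:
  fixes M :: "'a::{second_countable_topology, complete_space} measure"
  assumes M: "sets M = sets (restrict_space borel U)" and U: "open U"
    and A: "A \<in> sets M" "emeasure M A < \<infinity>" and e: "0 < (e::real)"
  obtains K where "compact K" "K \<subseteq> A" "emeasure M A \<le> emeasure M K + ennreal e"
proof -
  have sM: "B \<in> sets M \<longleftrightarrow> B \<in> sets borel \<and> B \<subseteq> U" for B by (simp add: M sets_restrict_open[OF U])
  have spM: "space M = U" using sets_eq_imp_space_eq[OF M] by (simp add: space_restrict_space)
  define N where "N = distr (density M (indicator A)) borel (\<lambda>x. x)"
  have meas: "(\<lambda>x. x) \<in> borel_measurable (density M (indicator A))"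
    using measurable_restrict_space1[OF measurable_ident, of borel U]
    by (subst measurable_cong_sets[OF _ refl, of _ "restrict_space borel U"]) (simp_all add: M id_def)
  have N: "emeasure N B = emeasure M (B \<inter> A)" if "B \<in> sets borel" for B
  proof -
    have BU: "B \<inter> U \<in> sets M" using that U by (auto simp: sM)
    have "emeasure N B = emeasure (density M (indicator A)) (B \<inter> U)"
      unfolding N_def by (subst emeasure_distr[OF meas that]) (auto simp: spM vimage_def Int_def)
    also have "\<dots> = emeasure M (A \<inter> (B \<inter> U))" using A(1) BU
      by (subst emeasure_density) (auto simp: indicator_inter_arith[symmetric])
    also have "A \<inter> (B \<inter> U) = B \<inter> A" using A(1) by (auto simp: sM)
    finally show ?thesis .
  qed
  have sN: "sets N = sets borel" by (simp add: N_def)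
  have "emeasure N (space N) \<noteq> \<infinity>"
    using N[of UNIV] A(2) by (simp add: sets_eq_imp_space_eq[OF sN])
  moreover have "A \<in> sets borel" using A(1) sM by auto
  ultimately have eq: "emeasure N A = (SUP K\<in>{K. K \<subseteq> A \<and> compact K}. emeasure N K)"
    by (rule inner_regular[OF sN])
  have "emeasure N A = emeasure M A" using N \<open>A \<in> sets borel\<close> by simp
  show thesis
  proof (cases "emeasure M A = 0")
    case True
    then show thesis using that[of "{}"] by simp
  next
    case False
    then have "emeasure M A - ennreal e < emeasure M A"
      using A(2) e by (intro ennreal_between) (auto simp: zero_less_iff_neq_zero)
    then obtain K where K: "K \<subseteq> A" "compact K" "emeasure M A - ennreal e < emeasure N K"
      unfolding \<open>emeasure N A = emeasure M A\<close>[symmetric] eq less_SUP_iff by auto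
    have "emeasure N K = emeasure M K"
      using N[of K] K by (auto simp: compact_imp_closed Int_absorb2)
    then have "emeasure M A \<le> emeasure M K + ennreal e"
      using K(3) by (metis ennreal_minus_le_iff add.commute less_imp_le ennreal_less_top top_neq_ennreal)
    then show thesis using that K by blast
  qed
qed

section \<open>Density of test fields and extension of the first variation to integrable
  fields\<close>

context radon_varifold
begin

lemma sigma_finite_var: "sigma_finite_measure \<beta>"
proof
  obtain C where C: "\<And>n::nat. compact (C n)" "\<And>n. C n \<subseteq> U" "\<Union>(range C) = U"
    using open_Union_compact_subsets[OF open_U] by metis
  show "\<exists>A. countable A \<and> A \<subseteq> sets \<beta> \<and> \<Union>A = space \<beta> \<and> (\<forall>a\<in>A. emeasure \<beta> a \<noteq> \<infinity>)"
    using C compact_sets_var[OF C(1,2)] radon_onD(3)[OF radon_on_var C(1,2)]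
    by (intro exI[of _ "range C"]) (auto simp: space_var less_top)
qed

lemma integrable_test: "g \<in> test_fields U \<Longrightarrow> integrable \<beta> g"
  by (rule integrable_norm_cancel[OF integrable_norm_test])
    (auto intro: borel_measurable_var smooth_imp_continuous_on test_fieldsD(1))

text \<open>For an indicator the approximation is a cutoff between a compact subset and an open
  superset of nearly the same measure; addition and limits follow the induction over integrable
  functions.\<close>

lemma test_fields_dense:
  fixes f :: "real^'n \<Rightarrow> real^'n"
  assumes "integrable \<beta> f"
  shows "\<forall>e>0. \<exists>g\<in>test_fields U. (LINT x|\<beta>. norm (f x - g x)) < e"
  using assms
proof induction
  case (base A c)
  show ?case
  proof (intro allI impI)
    fix e :: real assume e: "0 < e"
    \<comment> \<open>The measure of \<open>G - K\<close> is at most 2 d, so the error is at most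
      (norm c + 1) (2 d) = 2 e / 3. The summand 1 allows c = 0.\<close>
    define d where "d = e / (3 * (norm c + 1))"
    have c1: "norm c + 1 > 0" using norm_ge_zero[of c] by linarith
    then have d: "d > 0" using e by (simp add: d_def)
    obtain G where G: "open G" "A \<subseteq> G" "G \<subseteq> U" "emeasure \<beta> G \<le> emeasure \<beta> A + ennreal d"
      using var_outer_regular[OF base d] by metis
    obtain K where K: "compact K" "K \<subseteq> A" "emeasure \<beta> A \<le> emeasure \<beta> K + ennreal d"
      using compact_subset_approx[OF sets_var open_U base d] by metis
    obtain \<phi> where \<phi>: "smooth \<phi>" "\<And>x. 0 \<le> \<phi> x" "\<And>x. \<phi> x \<le> (1::real)"
      "\<And>x. x \<in> K \<Longrightarrow> \<phi> x = 1" "compact (closure {x. \<phi> x \<noteq> 0})" "closure {x. \<phi> x \<noteq> 0} \<subseteq> G"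
      by (rule smooth_Urysohn[OF K(1) G(1) order_trans[OF K(2) G(2)]]) blast
    have finG: "emeasure \<beta> G < \<infinity>" using G(4) base(2) by (auto simp: less_top[symmetric] top_unique)
    have sK: "K \<in> sets \<beta>" "G \<in> sets \<beta>" "G - K \<in> sets \<beta>"
      using K G base(1) by (auto simp: sets_var_iff compact_imp_closed)
    have "measure \<beta> G \<le> measure \<beta> K + 2 * d"
    proof -
      have "emeasure \<beta> G \<le> emeasure \<beta> K + ennreal d + ennreal d"
        using G(4) K(3) by (meson add_right_mono order_trans)
      moreover have "emeasure \<beta> K < \<infinity>"
        using emeasure_mono[OF order_trans[OF K(2) G(2)] sK(2)] finG by (rule le_less_trans)
      ultimately show ?thesis using finG d
        by (simp add: emeasure_eq_ennreal_measure less_top[symmetric] ennreal_plus[symmetric] ennreal_le_iff del: ennreal_plus)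
    qed
    then have m: "measure \<beta> (G - K) \<le> 2 * d"
      using measure_Diff[of \<beta> G K] finG sK K G by (auto simp: less_top)
    have "(\<lambda>x. \<phi> x *\<^sub>R c) \<in> test_fields U"
    proof (rule test_fieldsI[OF _ \<phi>(5)])
      show "smooth (\<lambda>x. \<phi> x *\<^sub>R c)" by (intro smooth_scaleR \<phi>(1) smooth_const)
      show "closure {x. \<phi> x \<noteq> 0} \<subseteq> U" using \<phi>(6) G(3) by simp
      show "\<phi> x *\<^sub>R c = 0" if "x \<notin> closure {x. \<phi> x \<noteq> 0}" for x
        using closure_support_outside[OF that] by simp
    qed
    moreover have "(LINT x|\<beta>. norm (indicator A x *\<^sub>R c - \<phi> x *\<^sub>R c)) < e"
    proof -
      have "(LINT x|\<beta>. norm (indicator A x *\<^sub>R c - \<phi> x *\<^sub>R c)) \<le> (LINT x|\<beta>. norm c * indicator (G - K) x)"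
      proof (rule integral_mono')
        show "integrable \<beta> (\<lambda>x. norm c * indicator (G - K) x)"
          using sK emeasure_mono[of "G - K" G \<beta>] finG by (intro integrable_mult_right integrable_real_indicator) (auto intro: le_less_trans)
        show "norm (indicator A x *\<^sub>R c - \<phi> x *\<^sub>R c) \<le> norm c * indicator (G - K) x" for x
        proof -
          have "\<bar>indicator A x - \<phi> x\<bar> \<le> indicator (G - K) x"
            using \<phi>(2,3,4)[of x] closure_support_outside[of x \<phi>] \<phi>(6) K(2) G(2) by (auto simp: indicator_def)
          then show ?thesis
            unfolding scaleR_left_diff_distrib[symmetric] norm_scaleR
            by (subst mult.commute) (rule mult_left_mono, auto)
        qed
      qed simp
      also have "\<dots> = norm c * measure \<beta> (G - K)" using sK by simp
      also have "\<dots> \<le> (norm c + 1) * (2 * d)" using m c1 by (intro mult_mono) auto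
      also have "\<dots> = 2 * e / 3"
      proof -
        have "k * (2 * (e / (3 * k))) = 2 * e / 3" if "k > 0" for k :: real using that by simp
        then show ?thesis using c1 by (simp only: d_def)
      qed
      also have "\<dots> < e" using e by simp
      finally show ?thesis .
    qed
    ultimately show "\<exists>g\<in>test_fields U. (LINT x|\<beta>. norm (indicator A x *\<^sub>R c - g x)) < e"
      by (intro bexI[of _ "\<lambda>x. \<phi> x *\<^sub>R c"])
  qed
next
  case (add f1 f2)
  show ?case
  proof (intro allI impI)
    fix e :: real assume "0 < e"
    then have e2: "0 < e / 2" by simp
    obtain g1 where "g1 \<in> test_fields U" "(LINT x|\<beta>. norm (f1 x - g1 x)) < e / 2"
      using add.IH(1)[rule_format, OF e2] by blast
    moreover obtain g2 where "g2 \<in> test_fields U" "(LINT x|\<beta>. norm (f2 x - g2 x)) < e / 2"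
      using add.IH(2)[rule_format, OF e2] by blast
    ultimately have g: "g1 \<in> test_fields U" "(LINT x|\<beta>. norm (f1 x - g1 x)) < e / 2"
       "g2 \<in> test_fields U" "(LINT x|\<beta>. norm (f2 x - g2 x)) < e / 2" by auto
    have i: "integrable \<beta> (\<lambda>x. norm (f1 x - g1 x))" "integrable \<beta> (\<lambda>x. norm (f2 x - g2 x))"
      using add.hyps integrable_test[OF g(1)] integrable_test[OF g(3)] by auto
    have "(LINT x|\<beta>. norm (f1 x + f2 x - (g1 x + g2 x))) \<le> (LINT x|\<beta>. norm (f1 x - g1 x) + norm (f2 x - g2 x))"
      using i by (intro integral_mono') (auto simp: add_diff_add norm_triangle_ineq)
    also have "\<dots> < e" using i g by simp
    finally show "\<exists>g\<in>test_fields U. (LINT x|\<beta>. norm (f1 x + f2 x - g x)) < e"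
      using test_fields_add[OF g(1,3)] by (intro bexI[of _ "\<lambda>x. g1 x + g2 x"]) auto
  qed
next
  case (lim f s)
  show ?case
  proof (intro allI impI)
    fix e :: real assume e: "0 < e"
    have "(\<lambda>i. LINT x|\<beta>. norm (f x - s i x)) \<longlonglongrightarrow> (LINT x|\<beta>. 0)"
    proof (rule integral_dominated_convergence[where w = "\<lambda>x. 3 * norm (f x)"])
      show "AE x in \<beta>. (\<lambda>i. norm (f x - s i x)) \<longlonglongrightarrow> 0"
      proof (rule AE_I2)
        fix x assume "x \<in> space \<beta>"
        then have "(\<lambda>i. norm (f x - s i x)) \<longlonglongrightarrow> norm (f x - f x)" by (intro tendsto_intros lim.hyps(2))
        then show "(\<lambda>i. norm (f x - s i x)) \<longlonglongrightarrow> 0" by simp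
      qed
      show "AE x in \<beta>. norm (norm (f x - s i x)) \<le> 3 * norm (f x)" for i
      proof (rule AE_I2)
        fix x assume "x \<in> space \<beta>"
        then show "norm (norm (f x - s i x)) \<le> 3 * norm (f x)"
          using lim.hyps(3)[of x i] norm_triangle_ineq4[of "f x" "s i x"] by simp
      qed
    qed (use lim.hyps(1,4) in auto)
    then have "(\<lambda>i. LINT x|\<beta>. norm (f x - s i x)) \<longlonglongrightarrow> 0" by simp
    then obtain i where i: "(LINT x|\<beta>. norm (f x - s i x)) < e / 2"
      using eventually_happens'[OF sequentially_bot order_tendstoD(2)[OF _ half_gt_zero[OF e]]] by blast
    obtain g where g: "g \<in> test_fields U" "(LINT x|\<beta>. norm (s i x - g x)) < e / 2"
      using lim.IH[of i, rule_format, OF half_gt_zero[OF e]] by blast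
    have ig: "integrable \<beta> (\<lambda>x. norm (f x - s i x))" "integrable \<beta> (\<lambda>x. norm (s i x - g x))"
      using lim.hyps(1,4) integrable_test[OF g(1)] by auto
    have "norm (f x - g x) \<le> norm (f x - s i x) + norm (s i x - g x)" for x
      using norm_triangle_ineq[of "f x - s i x" "s i x - g x"] by simp
    then have "(LINT x|\<beta>. norm (f x - g x)) \<le> (LINT x|\<beta>. norm (f x - s i x) + norm (s i x - g x))"
      using ig by (intro integral_mono') auto
    also have "\<dots> < e" using ig i g by simp
    finally show "\<exists>g\<in>test_fields U. (LINT x|\<beta>. norm (f x - g x)) < e" using g by blast
  qed
qed

lemma first_var_diff_le:
  assumes "g \<in> test_fields U" "h \<in> test_fields U"
  shows "first_var V g - first_var V h \<le> (LINT x|\<beta>. norm (g x - h x))"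
proof -
  have "first_var V (\<lambda>x. g x + (-1) *\<^sub>R h x) \<le> (LINT x|\<beta>. norm (g x + (-1) *\<^sub>R h x))"
    by (intro first_var_le test_fields_add test_fields_scale assms)
  then show ?thesis
    using first_var_add[OF assms(1) test_fields_scale[OF assms(2), of "-1"]] first_var_scale[OF assms(2), of "-1"]
    by simp
qed

text \<open>The McShane-Whitney formula for extending a 1-Lipschitz function, here from test fields
  to all integrable fields in the L^1 distance. By density it is the continuous extension, obtained
  without choosing approximating sequences; linearity is recovered by approximation.\<close>

definition ext_var :: "(real^'n \<Rightarrow> real^'n) \<Rightarrow> real" where
  "ext_var f = (SUP g\<in>test_fields U. first_var V g - (LINT x|\<beta>. norm (f x - g x)))"

lemma ext_var_close:
  assumes f: "integrable \<beta> f" and g: "g \<in> test_fields U"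
  shows "\<bar>ext_var f - first_var V g\<bar> \<le> (LINT x|\<beta>. norm (f x - g x))"
proof -
  have le: "first_var V h - (LINT x|\<beta>. norm (f x - h x)) \<le> first_var V g + (LINT x|\<beta>. norm (f x - g x))"
    if h: "h \<in> test_fields U" for h
  proof -
    have i: "integrable \<beta> (\<lambda>x. norm (f x - h x))" "integrable \<beta> (\<lambda>x. norm (f x - g x))"
      using f integrable_test[OF g] integrable_test[OF h] by auto
    have "norm (h x - g x) \<le> norm (f x - h x) + norm (f x - g x)" for x
    proof -
      have "h x - g x = (f x - g x) - (f x - h x)" by simp
      then show ?thesis using norm_triangle_ineq4[of "f x - g x" "f x - h x"] by simp
    qed
    then have "(LINT x|\<beta>. norm (h x - g x)) \<le> (LINT x|\<beta>. norm (f x - h x) + norm (f x - g x))"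
      using i by (intro integral_mono') auto
    then show ?thesis using first_var_diff_le[OF h g] i by simp
  qed
  have "ext_var f \<le> first_var V g + (LINT x|\<beta>. norm (f x - g x))"
    unfolding ext_var_def by (rule cSUP_least) (use g le in auto)
  moreover have "first_var V g - (LINT x|\<beta>. norm (f x - g x)) \<le> ext_var f"
    unfolding ext_var_def by (rule cSUP_upper[OF g]) (use le in \<open>auto intro!: bdd_aboveI2\<close>)
  ultimately show ?thesis by linarith
qed

lemma ext_var_test: "g \<in> test_fields U \<Longrightarrow> ext_var g = first_var V g"
  using ext_var_close[OF integrable_test, of g g] by simp

lemma ext_var_bound: "integrable \<beta> f \<Longrightarrow> \<bar>ext_var f\<bar> \<le> (LINT x|\<beta>. norm (f x))"
  using ext_var_close[OF _ test_fields_zero, of f] by (simp add: first_var_zero)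

lemma ext_var_add:
  assumes f: "integrable \<beta> f1" "integrable \<beta> f2"
  shows "ext_var (\<lambda>x. f1 x + f2 x) = ext_var f1 + ext_var f2"
proof -
  have "\<bar>ext_var (\<lambda>x. f1 x + f2 x) - (ext_var f1 + ext_var f2)\<bar> \<le> 0 + e" if e: "0 < e" for e
  proof -
    have e4: "0 < e / 4" using e by simp
    obtain g1 where "g1 \<in> test_fields U" "(LINT x|\<beta>. norm (f1 x - g1 x)) < e / 4"
      using test_fields_dense[OF f(1), rule_format, OF e4] by blast
    moreover obtain g2 where "g2 \<in> test_fields U" "(LINT x|\<beta>. norm (f2 x - g2 x)) < e / 4"
      using test_fields_dense[OF f(2), rule_format, OF e4] by blast
    ultimately have g: "g1 \<in> test_fields U" "(LINT x|\<beta>. norm (f1 x - g1 x)) < e / 4"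
       "g2 \<in> test_fields U" "(LINT x|\<beta>. norm (f2 x - g2 x)) < e / 4" by auto
    have i: "integrable \<beta> (\<lambda>x. norm (f1 x - g1 x))" "integrable \<beta> (\<lambda>x. norm (f2 x - g2 x))"
      using f integrable_test[OF g(1)] integrable_test[OF g(3)] by auto
    have "(LINT x|\<beta>. norm (f1 x + f2 x - (g1 x + g2 x))) \<le> (LINT x|\<beta>. norm (f1 x - g1 x) + norm (f2 x - g2 x))"
      using i by (intro integral_mono') (auto simp: add_diff_add norm_triangle_ineq)
    also have "\<dots> \<le> e / 2" using i g by simp
    finally have "\<bar>ext_var (\<lambda>x. f1 x + f2 x) - first_var V (\<lambda>x. g1 x + g2 x)\<bar> \<le> e / 2"
      using ext_var_close[OF _ test_fields_add[OF g(1,3)], of "\<lambda>x. f1 x + f2 x"] f by simp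
    then show ?thesis
      using ext_var_close[OF f(1) g(1)] ext_var_close[OF f(2) g(3)] g first_var_add[OF g(1,3)] by linarith
  qed
  then have "\<bar>ext_var (\<lambda>x. f1 x + f2 x) - (ext_var f1 + ext_var f2)\<bar> \<le> 0" by (rule field_le_epsilon)
  then show ?thesis by simp
qed

lemma ext_var_scale:
  assumes f: "integrable \<beta> f"
  shows "ext_var (\<lambda>x. c *\<^sub>R f x) = c * ext_var f"
proof -
  have "\<bar>ext_var (\<lambda>x. c *\<^sub>R f x) - c * ext_var f\<bar> \<le> 0 + e" if e: "0 < e" for e
  proof -
    define d where "d = e / (2 * (\<bar>c\<bar> + 1))"
    have c: "\<bar>c\<bar> + 1 > 0" by linarith
    have d: "0 < d" "2 * (\<bar>c\<bar> + 1) * d = e" using e c by (auto simp: d_def)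
    obtain g where g: "g \<in> test_fields U" "(LINT x|\<beta>. norm (f x - g x)) < d"
      using test_fields_dense[OF f, rule_format, OF d(1)] by blast
    have n: "norm (c *\<^sub>R f x - c *\<^sub>R g x) = \<bar>c\<bar> * norm (f x - g x)" for x
      by (metis norm_scaleR scaleR_diff_right)
    have "\<bar>ext_var (\<lambda>x. c *\<^sub>R f x) - first_var V (\<lambda>x. c *\<^sub>R g x)\<bar> \<le> (LINT x|\<beta>. norm (c *\<^sub>R f x - c *\<^sub>R g x))"
      using f by (intro ext_var_close test_fields_scale g) auto
    also have "\<dots> = \<bar>c\<bar> * (LINT x|\<beta>. norm (f x - g x))" unfolding n by simp
    also have "\<dots> \<le> \<bar>c\<bar> * d" using g by (intro mult_left_mono) auto
    finally have 1: "\<bar>ext_var (\<lambda>x. c *\<^sub>R f x) - c * first_var V g\<bar> \<le> \<bar>c\<bar> * d"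
      by (simp add: first_var_scale[OF g(1)])
    have "c * first_var V g - c * ext_var f = c * (first_var V g - ext_var f)"
      by (simp add: right_diff_distrib)
    then have "\<bar>c * first_var V g - c * ext_var f\<bar> = \<bar>c\<bar> * \<bar>ext_var f - first_var V g\<bar>"
      by (simp only: abs_mult abs_minus_commute[of "first_var V g"])
    also have "\<dots> \<le> \<bar>c\<bar> * d" using ext_var_close[OF f g(1)] g(2) by (intro mult_left_mono) auto
    finally have "\<bar>ext_var (\<lambda>x. c *\<^sub>R f x) - c * ext_var f\<bar> \<le> 2 * \<bar>c\<bar> * d" using 1 by linarith
    also have "\<dots> \<le> 2 * (\<bar>c\<bar> + 1) * d" using d(1) by (intro mult_right_mono) auto
    finally show ?thesis using d(2) by simp
  qed
  then have "\<bar>ext_var (\<lambda>x. c *\<^sub>R f x) - c * ext_var f\<bar> \<le> 0" by (rule field_le_epsilon)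
  then show ?thesis by simp
qed

lemma ext_var_sum:
  "finite I \<Longrightarrow> (\<And>i. i \<in> I \<Longrightarrow> integrable \<beta> (f i)) \<Longrightarrow> ext_var (\<lambda>x. \<Sum>i\<in>I. f i x) = (\<Sum>i\<in>I. ext_var (f i))"
proof (induction I rule: finite_induct)
  case empty
  then show ?case using ext_var_test[OF test_fields_zero] by (simp add: first_var_zero)
next
  case (insert i I)
  then show ?case using ext_var_add[of "f i" "\<lambda>x. \<Sum>i\<in>I. f i x"] by simp
qed

text \<open>Scalar duality is applied to each coordinate. The resulting bound by the dimension is
  crude and serves integrability; the exact length is determined in
  \<open>is_eta_eta\<close>.\<close>

lemma ext_var_representation:
  obtains \<eta> where "\<eta> \<in> borel_measurable \<beta>" "\<And>x. norm (\<eta> x) \<le> real (DIM(real^'n))"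
    "\<And>f. integrable \<beta> f \<Longrightarrow> ext_var f = (LINT x|\<beta>. f x \<bullet> \<eta> x)"
proof -
  interpret sigma_finite_measure \<beta> by (rule sigma_finite_var)
  have "\<exists>\<zeta>. \<zeta> \<in> borel_measurable \<beta> \<and> (\<forall>x. \<bar>\<zeta> x\<bar> \<le> 1) \<and>
    (\<forall>f. integrable \<beta> f \<longrightarrow> ext_var (\<lambda>x. f x *\<^sub>R b) = (LINT x|\<beta>. f x * \<zeta> x))" if b: "b \<in> Basis" for b :: "real^'n"
  proof -
    obtain \<zeta> where "\<zeta> \<in> borel_measurable \<beta>" "\<And>x. \<bar>\<zeta> x\<bar> \<le> 1"
      "\<And>f. integrable \<beta> f \<Longrightarrow> ext_var (\<lambda>x. f x *\<^sub>R b) = (LINT x|\<beta>. f x * \<zeta> x)"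
    proof (rule L1_dual[of "\<lambda>f. ext_var (\<lambda>x. f x *\<^sub>R b)"])
      show "ext_var (\<lambda>x. (f x + g x) *\<^sub>R b) = ext_var (\<lambda>x. f x *\<^sub>R b) + ext_var (\<lambda>x. g x *\<^sub>R b)"
        if "integrable \<beta> f" "integrable \<beta> g" for f g
        using ext_var_add[of "\<lambda>x. f x *\<^sub>R b" "\<lambda>x. g x *\<^sub>R b"] that by (simp add: scaleR_left_distrib)
      show "ext_var (\<lambda>x. (c * f x) *\<^sub>R b) = c * ext_var (\<lambda>x. f x *\<^sub>R b)" if "integrable \<beta> f" for c f
        using ext_var_scale[of "\<lambda>x. f x *\<^sub>R b" c] that by simp
      show "\<bar>ext_var (\<lambda>x. f x *\<^sub>R b)\<bar> \<le> (LINT x|\<beta>. \<bar>f x\<bar>)" if "integrable \<beta> f" for f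
        using ext_var_bound[of "\<lambda>x. f x *\<^sub>R b"] that b by simp
    qed blast
    then show ?thesis by blast
  qed
  then have "\<forall>b\<in>(Basis :: (real^'n) set). \<exists>\<zeta>. \<zeta> \<in> borel_measurable \<beta> \<and> (\<forall>x. \<bar>\<zeta> x\<bar> \<le> 1) \<and>
    (\<forall>f. integrable \<beta> f \<longrightarrow> ext_var (\<lambda>x. f x *\<^sub>R b) = (LINT x|\<beta>. f x * \<zeta> x))"
    by blast
  from bchoice[OF this] obtain \<zeta> where \<zeta>: "\<And>b. b \<in> Basis \<Longrightarrow> \<zeta> b \<in> borel_measurable \<beta>"
    "\<And>b x. b \<in> Basis \<Longrightarrow> \<bar>\<zeta> b x\<bar> \<le> 1"
    "\<And>b f. b \<in> Basis \<Longrightarrow> integrable \<beta> f \<Longrightarrow> ext_var (\<lambda>x. f x *\<^sub>R (b::real^'n)) = (LINT x|\<beta>. f x * \<zeta> b x)"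
    by blast
  define \<eta> where "\<eta> x = (\<Sum>b\<in>Basis. \<zeta> b x *\<^sub>R (b::real^'n))" for x
  show thesis
  proof
    show "\<eta> \<in> borel_measurable \<beta>" unfolding \<eta>_def using \<zeta>(1) by (intro borel_measurable_sum) auto
    show "norm (\<eta> x) \<le> real (DIM(real^'n))" for x
    proof -
      have "norm (\<eta> x) \<le> (\<Sum>b\<in>Basis. \<bar>\<zeta> b x\<bar>)" unfolding \<eta>_def
        by (rule norm_sum[THEN order_trans]) (auto intro!: sum_mono)
      also have "\<dots> \<le> (\<Sum>b\<in>(Basis::(real^'n) set). 1)" by (intro sum_mono \<zeta>(2))
      finally show ?thesis by simp
    qed
    show "ext_var f = (LINT x|\<beta>. f x \<bullet> \<eta> x)" if f: "integrable \<beta> f" for f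
    proof -
      have fb: "integrable \<beta> (\<lambda>x. f x \<bullet> b)" for b using f by auto
      have "ext_var f = ext_var (\<lambda>x. \<Sum>b\<in>Basis. (f x \<bullet> b) *\<^sub>R b)" by (simp add: euclidean_representation)
      also have "\<dots> = (\<Sum>b\<in>Basis. (LINT x|\<beta>. (f x \<bullet> b) * \<zeta> b x))"
        using fb \<zeta>(3) by (subst ext_var_sum) auto
      also have "\<dots> = (LINT x|\<beta>. (\<Sum>b\<in>Basis. (f x \<bullet> b) * \<zeta> b x))"
      proof (rule Bochner_Integration.integral_sum[symmetric])
        fix b :: "real^'n" assume b: "b \<in> Basis"
        have "\<bar>(f x \<bullet> b) * \<zeta> b x\<bar> \<le> \<bar>f x \<bullet> b\<bar> * 1" for x
          unfolding abs_mult by (rule mult_left_mono[OF \<zeta>(2)[OF b]]) auto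
        then show "integrable \<beta> (\<lambda>x. (f x \<bullet> b) * \<zeta> b x)"
          using fb[of b] \<zeta>(1)[OF b] by (intro Bochner_Integration.integrable_bound[OF fb[of b]]) auto
      qed
      also have "\<dots> = (LINT x|\<beta>. f x \<bullet> \<eta> x)"
        by (simp add: \<eta>_def inner_sum_right mult.commute)
      finally show ?thesis .
    qed
  qed
qed

text \<open>Existence of a unit field, without which the choice \<open>eta\<close> would carry no
  information. Integrals of the length of the representing field over sets of finite measure are
  shown to equal the measure of the set, so the length is 1 almost everywhere.\<close>

lemma is_eta_eta: "is_eta U V (eta U V)"
proof -
  interpret sigma_finite_measure \<beta> by (rule sigma_finite_var)
  obtain \<eta> where \<eta>[measurable]: "\<eta> \<in> borel_measurable \<beta>" and bd: "\<And>x. norm (\<eta> x) \<le> real (DIM(real^'n))"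
    and rep: "\<And>f. integrable \<beta> f \<Longrightarrow> ext_var f = (LINT x|\<beta>. f x \<bullet> \<eta> x)"
    using ext_var_representation by metis
  define D where "D = real (DIM(real^'n))"
  have D: "D > 0" by (simp add: D_def)
  note bd = bd[folded D_def]
  have ind: "integrable \<beta> (\<lambda>x. indicator A x *\<^sub>R f x)"
    if "A \<in> sets \<beta>" "emeasure \<beta> A < \<infinity>" "f \<in> borel_measurable \<beta>" "\<And>x. norm (f x) \<le> c" for A c and f :: "real^'n \<Rightarrow> 'c::{banach,second_countable_topology}"
    using that by (intro integrableI_bounded_set[of A _ _ c]) (auto simp: indicator_def)
  have sgn: "sgn v \<bullet> v = norm v" for v :: "real^'n"
    by (cases "v = 0") (simp_all add: sgn_div_norm dot_square_norm power2_eq_square)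
  \<comment> \<open>Test with the normalised field on \<open>A\<close>, which has length at most
    one.\<close>
  have le: "(LINT x|\<beta>. indicator A x * norm (\<eta> x)) \<le> measure \<beta> A" if A: "A \<in> sets \<beta>" "emeasure \<beta> A < \<infinity>" for A
  proof -
    have i: "integrable \<beta> (\<lambda>x. indicator A x *\<^sub>R sgn (\<eta> x))"
      by (rule ind[OF A, of _ 1]) (auto simp: norm_sgn)
    have "(LINT x|\<beta>. indicator A x * norm (\<eta> x)) = ext_var (\<lambda>x. indicator A x *\<^sub>R sgn (\<eta> x))"
      unfolding rep[OF i] by (intro Bochner_Integration.integral_cong) (auto simp: sgn)
    also have "\<dots> \<le> (LINT x|\<beta>. norm (indicator A x *\<^sub>R sgn (\<eta> x)))"
      using ext_var_bound[OF i] by simp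
    also have "\<dots> \<le> (LINT x|\<beta>. indicator A x)"
      using A by (intro integral_mono' integrable_real_indicator) (auto simp: norm_sgn split: split_indicator)
    finally show ?thesis using A by simp
  qed
  have ge_open: "measure \<beta> G \<le> (LINT x|\<beta>. indicator G x * norm (\<eta> x))"
    if G: "open G" "G \<subseteq> U" "emeasure \<beta> G < \<infinity>" for G
  proof -
    have GM: "G \<in> sets \<beta>" using G by (simp add: sets_var_iff)
    have iG: "integrable \<beta> (\<lambda>x. indicator G x * norm (\<eta> x))"
      using ind[OF GM G(3), of "\<lambda>x. norm (\<eta> x)" D] bd by auto
    have "open_var G \<le> ennreal (LINT x|\<beta>. indicator G x * norm (\<eta> x))"
      unfolding open_var_def
    proof (rule SUP_least, clarify, rule ennreal_leI)
      fix g assume g: "g \<in> test_fields G" "\<forall>x. norm (g x) \<le> 1"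
      have gU: "g \<in> test_fields U" using test_fields_mono[OF G(2)] g by auto
      have "first_var V g = (LINT x|\<beta>. g x \<bullet> \<eta> x)"
        using rep[OF integrable_test[OF gU]] ext_var_test[OF gU] by simp
      also have "\<dots> \<le> (LINT x|\<beta>. indicator G x * norm (\<eta> x))"
      proof (rule integral_mono'[OF iG])
        fix x
        show "g x \<bullet> \<eta> x \<le> indicator G x * norm (\<eta> x)"
        proof (cases "x \<in> G")
          case True
          have "g x \<bullet> \<eta> x \<le> norm (g x) * norm (\<eta> x)" by (rule norm_cauchy_schwarz)
          also have "\<dots> \<le> 1 * norm (\<eta> x)" using g(2) by (intro mult_right_mono) auto
          finally show ?thesis using True by simp
        next
          case False
          then have "g x = 0" using test_fieldsD(4)[OF g(1)] by blast
          then show ?thesis by simp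
        qed
      qed simp
      finally show "first_var V g \<le> (LINT x|\<beta>. indicator G x * norm (\<eta> x))" .
    qed
    moreover have "open_var G = ennreal (measure \<beta> G)"
      using emeasure_var_open[OF G(1,2)] emeasure_eq_ennreal_measure[of \<beta> G] G(3) by simp
    moreover have "0 \<le> (LINT x|\<beta>. indicator G x * norm (\<eta> x))"
      by (intro Bochner_Integration.integral_nonneg) simp
    ultimately show ?thesis by (simp only: ennreal_le_iff)
  qed
  \<comment> \<open>On open sets the lower bound comes from the supremum defining the variation.
    Outer regularity extends it to Borel sets, the length \<open>D\<close> bounding the loss on
    \<open>G - A\<close>.\<close>
  have ge: "measure \<beta> A \<le> (LINT x|\<beta>. indicator A x * norm (\<eta> x))" if A: "A \<in> sets \<beta>" "emeasure \<beta> A < \<infinity>" for A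
  proof (rule field_le_epsilon)
    fix e :: real assume e: "0 < e"
    then have "0 < e / D" using D by simp
    then obtain G where G: "open G" "A \<subseteq> G" "G \<subseteq> U" "emeasure \<beta> G \<le> emeasure \<beta> A + ennreal (e / D)"
      using var_outer_regular[OF A] by metis
    have GM: "G \<in> sets \<beta>" "G - A \<in> sets \<beta>" using G A by (auto simp: sets_var_iff)
    have fG: "emeasure \<beta> G < \<infinity>" using G(4) A(2) by (auto simp: less_top[symmetric] top_unique)
    have fD: "emeasure \<beta> (G - A) < \<infinity>" using emeasure_mono[of "G - A" G \<beta>] GM fG by (auto intro: le_less_trans)
    have "measure \<beta> G \<le> measure \<beta> A + e / D"
      using G(4) fG A(2) e D
      by (simp add: emeasure_eq_ennreal_measure less_top[symmetric] ennreal_plus[symmetric] ennreal_le_iff del: ennreal_plus)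
    then have m: "measure \<beta> (G - A) \<le> e / D"
      using measure_Diff[of \<beta> G A] fG GM A G(2) by (auto simp: less_top)
    have i: "integrable \<beta> (\<lambda>x. indicator A x * norm (\<eta> x))" "integrable \<beta> (\<lambda>x. indicator (G - A) x * norm (\<eta> x))"
      using ind[OF A, of "\<lambda>x. norm (\<eta> x)" D] ind[OF GM(2) fD, of "\<lambda>x. norm (\<eta> x)" D] bd by auto
    have "measure \<beta> A \<le> measure \<beta> G" using G(2) GM A fG by (intro measure_mono_fmeasurable) (auto simp: fmeasurable_def)
    also have "\<dots> \<le> (LINT x|\<beta>. indicator G x * norm (\<eta> x))" by (rule ge_open[OF G(1,3) fG])
    also have "\<dots> = (LINT x|\<beta>. indicator A x * norm (\<eta> x) + indicator (G - A) x * norm (\<eta> x))"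
      using G(2) by (intro Bochner_Integration.integral_cong) (auto simp: indicator_def)
    also have "\<dots> = (LINT x|\<beta>. indicator A x * norm (\<eta> x)) + (LINT x|\<beta>. indicator (G - A) x * norm (\<eta> x))"
      using i by simp
    also have "(LINT x|\<beta>. indicator (G - A) x * norm (\<eta> x)) \<le> (LINT x|\<beta>. D * indicator (G - A) x)"
      using fD GM bd D by (intro integral_mono' integrable_mult_right integrable_real_indicator) (auto simp: indicator_def)
    also have "\<dots> = D * measure \<beta> (G - A)" using GM by simp
    also have "\<dots> \<le> D * (e / D)" using m D by (intro mult_left_mono) auto
    also have "\<dots> = e" using D by simp
    finally show "measure \<beta> A \<le> (LINT x|\<beta>. indicator A x * norm (\<eta> x)) + e" by simp
  qed
  obtain C :: "nat \<Rightarrow> (real^'n) set" where C: "range C \<subseteq> sets \<beta>" "(\<Union>i. C i) = space \<beta>" "\<And>i. emeasure \<beta> (C i) \<noteq> \<infinity>"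
    using sigma_finite by metis
  have "AE x in \<beta>. indicator (C i) x * (norm (\<eta> x) - 1) = 0" for i
  proof (rule density_zero)
    have Ci: "C i \<in> sets \<beta>" "emeasure \<beta> (C i) < \<infinity>" using C by (auto simp: less_top)
    show "integrable \<beta> (\<lambda>x. indicator (C i) x * (norm (\<eta> x) - 1))"
      using ind[OF Ci, of "\<lambda>x. norm (\<eta> x) - 1" "D + 1"] bd D by (auto simp: abs_le_iff add_increasing2 add_increasing)
    fix A assume "A \<in> sets \<beta>"
    then have A: "A \<inter> C i \<in> sets \<beta>" "emeasure \<beta> (A \<inter> C i) < \<infinity>"
      using Ci emeasure_mono[of "A \<inter> C i" "C i" \<beta>] by (auto intro: le_less_trans)
    have "set_lebesgue_integral \<beta> A (\<lambda>x. indicator (C i) x * (norm (\<eta> x) - 1))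
      = (LINT x|\<beta>. indicator (A \<inter> C i) x * norm (\<eta> x) - indicator (A \<inter> C i) x)"
      unfolding set_lebesgue_integral_def by (intro Bochner_Integration.integral_cong) (auto simp: indicator_def)
    also have "\<dots> = (LINT x|\<beta>. indicator (A \<inter> C i) x * norm (\<eta> x)) - measure \<beta> (A \<inter> C i)"
      using A ind[OF A, of "\<lambda>x. norm (\<eta> x)" D] bd by (subst Bochner_Integration.integral_diff) auto
    also have "\<dots> = 0" using le[OF A] ge[OF A] by simp
    finally show "set_lebesgue_integral \<beta> A (\<lambda>x. indicator (C i) x * (norm (\<eta> x) - 1)) = 0" .
  qed
  then have "AE x in \<beta>. \<forall>i. indicator (C i) x * (norm (\<eta> x) - 1) = 0" by (subst AE_all_countable) blast
  then have unit: "AE x in \<beta>. norm (\<eta> x) = 1"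
    using AE_space
  proof eventually_elim
    case (elim x)
    then obtain i where "x \<in> C i" using C(2) by blast
    then show ?case using elim(1)[rule_format, of i] by simp
  qed
  \<comment> \<open>An arbitrary unit vector on the exceptional null set, since
    \<open>is_eta\<close> demands unit length at every point.\<close>
  define e where "e x = (if norm (\<eta> x) = 1 then \<eta> x else axis undefined 1)" for x
  have em: "e \<in> borel_measurable \<beta>" unfolding e_def by measurable
  have "is_eta U V e"
    unfolding is_eta_def
  proof (intro conjI ballI)
    show "e \<in> borel_measurable (completion \<beta>)" using em by (rule measurable_completion)
    show "norm (e z) = 1" for z by (simp add: e_def)
    fix g assume g: "g \<in> test_fields U"
    have gm[measurable]: "g \<in> borel_measurable \<beta>" using integrable_test[OF g] by auto
    have "first_var V g = (LINT x|\<beta>. g x \<bullet> \<eta> x)"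
      using rep[OF integrable_test[OF g]] ext_var_test[OF g] by simp
    also have "\<dots> = (LINT x|\<beta>. g x \<bullet> e x)"
      using unit em by (intro integral_cong_AE) (auto elim!: eventually_mono simp: e_def)
    also have "\<dots> = (LINT x|completion \<beta>. g x \<bullet> e x)"
      using em by (intro integral_completion[symmetric]) measurable
    finally show "first_var V g = (LINT x|completion \<beta>. g x \<bullet> e x)" .
  qed
  then show ?thesis unfolding eta_def by (rule someI[where P = "is_eta U V"])
qed

end

section \<open>Restricted varifolds and vanishing boundaries\<close>

lemma sets_add_measure: "sets (add_measure M N) = sets M"
  by (simp add: add_measure_def)

lemma emeasure_add_measure:
  assumes S: "sets N = sets M" and A: "A \<in> sets M"
  shows "emeasure (add_measure M N) A = emeasure M A + emeasure N A"
  unfolding add_measure_def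
proof (rule emeasure_measure_of_sigma[OF sets.sigma_algebra_axioms _ _ A])
  show "positive (sets M) (\<lambda>A. emeasure M A + emeasure N A)" by (simp add: positive_def)
  show "countably_additive (sets M) (\<lambda>A. emeasure M A + emeasure N A)"
  proof (rule countably_additiveI)
    fix A :: "nat \<Rightarrow> 'a set" assume A: "range A \<subseteq> sets M" "disjoint_family A"
    have "(\<Sum>i. emeasure M (A i) + emeasure N (A i)) = (\<Sum>i. emeasure M (A i)) + (\<Sum>i. emeasure N (A i))"
      by (intro suminf_add[symmetric]) auto
    then show "(\<Sum>i. emeasure M (A i) + emeasure N (A i)) = emeasure M (\<Union>i. A i) + emeasure N (\<Union>i. A i)"
      using A S by (simp add: suminf_emeasure)
  qed
qed

context open_varifold
begin

text \<open>Identifying the restriction with a density shows that its defining set function really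
  is a measure and gives access to the integration formulas for densities.\<close>

lemma restr_eq_density:
  assumes A: "A \<in> sets \<mu>"
  shows "restr_varifold m V A = density V (indicator (A \<times> Grass m))"
proof -
  have AG: "A \<times> Grass m \<in> sets V" by (rule cylinder_sets[OF A])
  let ?D = "density V (indicator (A \<times> Grass m))"
  have "restr_varifold m V A = measure_of (space ?D) (sets ?D) (emeasure ?D)"
    unfolding restr_varifold_def space_density sets_density
  proof (rule measure_of_eq[OF sets.space_closed])
    fix B assume "B \<in> sigma_sets (space V) (sets V)"
    then have B: "B \<in> sets V" by (simp add: sets.sigma_sets_eq)
    have "emeasure ?D B = emeasure V ((A \<times> Grass m) \<inter> B)"
      using B AG by (subst emeasure_density) (auto simp: indicator_inter_arith[symmetric])
    then show "emeasure (completion V) (B \<inter> A \<times> Grass m) = emeasure ?D B"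
      using B AG by (simp add: Int_commute)
  qed
  then show ?thesis by (simp only: measure_of_of_measure)
qed

lemma
  assumes A: "A \<in> sets \<mu>"
  shows sets_restr: "sets (restr_varifold m V A) = sets V"
    and emeasure_restr: "B \<in> sets V \<Longrightarrow> emeasure (restr_varifold m V A) B = emeasure V (B \<inter> A \<times> Grass m)"
  using cylinder_sets[OF A] restr_eq_density[OF A]
  by (auto simp: emeasure_density indicator_inter_arith[symmetric] Int_commute)

lemma open_varifold_restr:
  assumes A: "A \<in> sets \<mu>" shows "open_varifold U m (restr_varifold m V A)"
proof
  show "open U" by (rule open_U)
  show "varifold U m (restr_varifold m V A)"
    unfolding varifold_def radon_on_def
  proof (intro conjI allI impI)
    show "sets (restr_varifold m V A) = sets (restrict_space borel (U \<times> Grass m))"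
      by (simp add: sets_restr[OF A] sets_V)
    fix K :: "((real^'n) \<times> 'n subsp) set" assume K: "compact K \<and> K \<subseteq> U \<times> Grass m"
    then have KV: "K \<in> sets V"
      by (auto simp: sets_V sets_restrict_space compact_imp_closed intro!: image_eqI[of _ _ K])
    have "emeasure (restr_varifold m V A) K \<le> emeasure V K"
      unfolding emeasure_restr[OF A KV] using KV cylinder_sets[OF A] by (intro emeasure_mono) auto
    also have "\<dots> < \<infinity>" using radon_onD(3)[OF radon_V] K by auto
    finally show "emeasure (restr_varifold m V A) K < \<infinity>" .
  qed
qed

lemma emeasure_weight_restr:
  assumes A: "A \<in> sets \<mu>" and B: "B \<in> sets \<mu>"
  shows "emeasure (weight U (restr_varifold m V A)) B = emeasure \<mu> (B \<inter> A)"
proof -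
  interpret W: open_varifold U m "restr_varifold m V A" by (rule open_varifold_restr[OF A])
  have "emeasure (weight U (restr_varifold m V A)) B = emeasure V (B \<times> Grass m \<inter> A \<times> Grass m)"
    using B W.emeasure_weight[of B] emeasure_restr[OF A cylinder_sets[OF B]]
    by (simp add: sets_weight W.sets_weight)
  also have "B \<times> Grass m \<inter> A \<times> Grass m = (B \<inter> A) \<times> Grass m" by auto
  also have "emeasure V \<dots> = emeasure \<mu> (B \<inter> A)" using A B by (simp add: emeasure_weight)
  finally show ?thesis .
qed

lemma first_var_restr:
  assumes A: "A \<in> sets \<mu>" and g: "g \<in> test_fields U"
  shows "first_var (restr_varifold m V A) g = (LINT p|V. indicator (A \<times> Grass m) p * divg g p)"
proof -
  have "density V (indicator (A \<times> Grass m)) = density V (\<lambda>p. ennreal (indicator (A \<times> Grass m) p))"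
    by (simp add: ennreal_indicator)
  then show ?thesis
    unfolding first_var_divg restr_eq_density[OF A]
    using integrable_divg[OF g] cylinder_sets[OF A] by (simp add: integral_density)
qed

end

context radon_varifold
begin

abbreviation \<eta> where "\<eta> \<equiv> eta U V"

lemma eta_measurable: "\<eta> \<in> borel_measurable (completion \<beta>)"
  and norm_eta: "z \<in> U \<Longrightarrow> norm (\<eta> z) = 1"
  and first_var_eta: "g \<in> test_fields U \<Longrightarrow> first_var V g = (LINT z|completion \<beta>. g z \<bullet> \<eta> z)"
  using is_eta_eta by (auto simp: is_eta_def)

lemma test_measurable: "g \<in> test_fields U \<Longrightarrow> g \<in> borel_measurable \<beta>"
  by (rule borel_measurable_integrable[OF integrable_test])

lemma inner_eta_measurable: "g \<in> test_fields U \<Longrightarrow> (\<lambda>z. g z \<bullet> \<eta> z) \<in> borel_measurable (completion \<beta>)"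
  by (intro borel_measurable_inner measurable_completion test_measurable eta_measurable)

lemma integrable_inner_eta:
  assumes g: "g \<in> test_fields U" shows "integrable (completion \<beta>) (\<lambda>z. g z \<bullet> \<eta> z)"
proof (rule Bochner_Integration.integrable_bound)
  show "integrable (completion \<beta>) (\<lambda>z. norm (g z))"
    using integrable_norm_test[OF g] by (subst integrable_completion) auto
  show "AE z in completion \<beta>. norm (g z \<bullet> \<eta> z) \<le> norm (norm (g z))"
  proof (rule AE_I2)
    fix z assume "z \<in> space (completion \<beta>)"
    then show "norm (g z \<bullet> \<eta> z) \<le> norm (norm (g z))"
      using Cauchy_Schwarz_ineq2[of "g z" "\<eta> z"] norm_eta[of z] by (simp add: space_var)
  qed
qed (rule inner_eta_measurable[OF g])

lemma first_var_on_le: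
  assumes A: "A \<in> sets \<mu>" and g: "g \<in> test_fields U"
  shows "first_var_on U V A g \<le> (LINT z:A|\<beta>. norm (g z))"
proof -
  have AB: "A \<in> sets \<beta>" using A by (simp add: sets_var sets_weight)
  have i: "integrable \<beta> (\<lambda>z. indicator A z * norm (g z))"
    using integrable_mult_indicator[OF AB integrable_norm_test[OF g]] by simp
  have "first_var_on U V A g \<le> (LINT z|completion \<beta>. indicator A z * norm (g z))"
    unfolding first_var_on_def set_lebesgue_integral_def
  proof (rule integral_mono)
    show "integrable (completion \<beta>) (\<lambda>z. indicator A z *\<^sub>R (g z \<bullet> \<eta> z))"
      using AB by (intro integrable_mult_indicator integrable_inner_eta g) auto
    show "integrable (completion \<beta>) (\<lambda>z. indicator A z * norm (g z))"
      using i by (subst integrable_completion) auto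
    fix z assume "z \<in> space (completion \<beta>)"
    then have "g z \<bullet> \<eta> z \<le> norm (g z)"
      using norm_cauchy_schwarz[of "g z" "\<eta> z"] norm_eta[of z] by (simp add: space_var)
    then show "indicator A z *\<^sub>R (g z \<bullet> \<eta> z) \<le> indicator A z * norm (g z)"
      by (simp add: indicator_def)
  qed
  also have "\<dots> = (LINT z|\<beta>. indicator A z * norm (g z))"
    using i by (intro integral_completion) auto
  finally show ?thesis by (simp add: set_lebesgue_integral_def)
qed

text \<open>Null sets of \<open>add_measure \<mu> \<beta>\<close> are null for both measures, so a
  Borel subset of \<open>A\<close> of full measure has the same restricted varifold and the same
  restricted variation. Taking a subset of \<open>A\<close> ensures that a point missed by
  \<open>A\<close> is still missed.\<close>

lemma var_sets_representative:
  assumes "A \<in> var_sets U V"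
  obtains A' where "A' \<subseteq> A" "A' \<in> sets \<mu>" "restr_varifold m V A' = restr_varifold m V A"
    "\<And>g. g \<in> test_fields U \<Longrightarrow> first_var_on U V A' g = first_var_on U V A g"
proof -
  let ?M = "add_measure \<mu> \<beta>"
  have s: "sets ?M = sets \<mu>" "sets \<beta> = sets \<mu>" by (simp_all add: sets_add_measure sets_var sets_weight)
  obtain S N N' where A: "A = S \<union> N" "N \<subseteq> N'" "N' \<in> null_sets ?M" "S \<in> sets ?M"
    using assms unfolding var_sets_def by (rule sets_completionE)
  have N': "N' \<in> null_sets \<mu>" "N' \<in> null_sets \<beta>"
    using A(3) emeasure_add_measure[OF s(2), of N'] by (auto simp: null_sets_def s)
  have S: "S \<in> sets \<mu>" using A(4) s by simp
  have NV: "N' \<times> Grass m \<in> null_sets V"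
    using N'(1) emeasure_weight[of N'] cylinder_sets[of N'] by (auto simp: null_sets_def)
  have "N \<times> Grass m \<in> null_sets (completion V)"
    using NV A(2) unfolding null_sets_completion_iff2 by (intro bexI[of _ "N' \<times> Grass m"]) auto
  show thesis
  proof
    show "S \<subseteq> A" "S \<in> sets \<mu>" using A S by auto
    show "restr_varifold m V S = restr_varifold m V A"
      unfolding restr_varifold_def
    proof (rule measure_of_eq[OF sets.space_closed])
      fix B assume "B \<in> sigma_sets (space V) (sets V)"
      then have B: "B \<in> sets V" by (simp add: sets.sigma_sets_eq)
      have "B \<inter> N \<times> Grass m \<in> null_sets (completion V)"
        using \<open>N \<times> Grass m \<in> null_sets (completion V)\<close> by (rule null_sets_completion_subset[rotated]) auto
      then have "emeasure (completion V) (B \<inter> S \<times> Grass m \<union> B \<inter> N \<times> Grass m) = emeasure (completion V) (B \<inter> S \<times> Grass m)"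
        using B cylinder_sets[OF S] by (intro emeasure_Un_null_set) auto
      also have "B \<inter> S \<times> Grass m \<union> B \<inter> N \<times> Grass m = B \<inter> A \<times> Grass m" using A(1) by auto
      finally show "emeasure (completion V) (B \<inter> S \<times> Grass m) = emeasure (completion V) (B \<inter> A \<times> Grass m)" ..
    qed
    fix g assume g: "g \<in> test_fields U"
    have Sb: "S \<in> sets (completion \<beta>)" using S s by auto
    have "N \<in> sets (completion \<beta>)" using N'(2) A(2) by (rule null_sets_completion)
    then have Ab: "A \<in> sets (completion \<beta>)" using A(1) Sb by auto
    have "AE z in completion \<beta>. z \<notin> N'" using AE_completion[OF AE_not_in[OF N'(2)]] .
    then show "first_var_on U V S g = first_var_on U V A g"
      unfolding first_var_on_def set_lebesgue_integral_def
      using Sb Ab inner_eta_measurable[OF g] A(1,2)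
      by (intro integral_cong_AE borel_measurable_scaleR borel_measurable_indicator)
         (auto elim!: eventually_mono simp: indicator_def)
  qed
qed

theorem clopen_zero_boundary:
  assumes op: "openin (top_of_set (spt U \<mu>)) C" and cl: "closedin (top_of_set (spt U \<mu>)) C"
  shows "zero_boundary U m V C" "C \<in> sets \<mu>"
proof -
  let ?S = "spt U \<mu>"
  obtain F1 where F1: "closed F1" "C = ?S \<inter> F1" using cl by (auto simp: closedin_closed)
  obtain O1 where O1: "open O1" "C = ?S \<inter> O1" using op by (auto simp: openin_open)
  obtain F where F: "closed F" "?S = U \<inter> F" using spt_null(2) by (auto simp: closedin_closed)
  show C: "C \<in> sets \<mu>"
    using spt_null(4) O1 by (auto simp: sets_weight_iff)
  have CB: "C \<in> sets \<beta>" using C by (simp add: sets_var sets_weight)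
  show "zero_boundary U m V C"
    unfolding zero_boundary_def boundary_def
  proof
    fix g assume g: "g \<in> test_fields U"
    let ?K = "closure {x. g x \<noteq> 0}"
    note D = test_fieldsD[OF g]
    \<comment> \<open>The parts of the support of V inside and outside \<open>C\<close>, seen by
      \<open>g\<close>. Both are compact because \<open>C\<close> is clopen in the support. The
      cutoff is locally 1 near \<open>P\<close> and locally 0 near \<open>Q\<close>, so its
      derivative contributes nothing on the support; off the support neither \<open>V\<close> nor
      \<open>\<beta>\<close> has mass.\<close>
    define P where "P = C \<inter> ?K"
    define Q where "Q = (?S - C) \<inter> ?K"
    have "P = ?K \<inter> (F \<inter> F1)" using F F1 D(3) by (auto simp: P_def)
    then have P: "compact P" using D(2) F F1 by (auto intro!: compact_Int_closed)
    have "Q = ?K \<inter> (F - O1)" using F O1 D(3) by (auto simp: Q_def)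
    then have Q: "compact Q" using D(2) F O1 by (auto intro!: compact_Int_closed)
    have PQ: "P \<subseteq> - Q" by (auto simp: P_def Q_def)
    have oQ: "open (- Q)" using Q by (simp add: compact_imp_closed open_Compl)
    obtain \<phi> N where \<phi>: "smooth \<phi>" "open N" "P \<subseteq> N" "\<And>x. x \<in> N \<Longrightarrow> \<phi> x = (1::real)"
      "closure {x. \<phi> x \<noteq> 0} \<subseteq> - Q"
      by (rule smooth_Urysohn[OF P oQ PQ]) blast
    define f where "f = (\<lambda>x. \<phi> x *\<^sub>R g x)"
    have f: "f \<in> test_fields U" unfolding f_def by (rule test_fields_smooth_mult[OF g \<phi>(1)])
    have fK: "closure {x. f x \<noteq> 0} \<subseteq> ?K" "closure {x. f x \<noteq> 0} \<subseteq> closure {x. \<phi> x \<noteq> 0}"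
      by (auto simp: f_def intro!: closure_mono)
    have on_spt: "divg f p = indicator (C \<times> Grass m) p * divg g p" if p: "p \<in> U \<times> Grass m" "fst p \<in> ?S" for p
    proof -
      consider "fst p \<notin> ?K" | "fst p \<in> P" | "fst p \<in> Q" using p(2) by (auto simp: P_def Q_def)
      then show ?thesis
      proof cases
        case 1
        then have "fst p \<notin> closure {x. f x \<noteq> 0}" using fK by blast
        then show ?thesis using divg_outside[OF 1] divg_outside[of p f] by simp
      next
        case 2
        then have "divg f p = divg g p" using \<phi> by (intro divg_cong[of N]) (auto simp: f_def)
        then show ?thesis using 2 p by (auto simp: P_def indicator_def split: prod.splits)
      next
        case 3
        then have "fst p \<notin> closure {x. f x \<noteq> 0}" using fK \<phi>(5) by blast
        then show ?thesis using 3 divg_outside[of p f] by (auto simp: Q_def indicator_def)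
      qed
    qed
    have nV: "(U - ?S) \<times> Grass m \<in> null_sets V"
      using spt_null(1) emeasure_weight[of "U - ?S"] cylinder_sets[of "U - ?S"] by (auto simp: null_sets_def)
    have "AE p in V. divg f p = indicator (C \<times> Grass m) p * divg g p"
      using AE_not_in[OF nV] AE_space by eventually_elim (use on_spt in \<open>force simp: space_V\<close>)
    then have "first_var V f = (LINT p|V. indicator (C \<times> Grass m) p * divg g p)"
      unfolding first_var_divg
      using integrable_divg[OF f] integrable_divg[OF g] cylinder_sets[OF C]
      by (intro integral_cong_AE borel_measurable_times borel_measurable_indicator) auto
    then have 1: "first_var V f = first_var (restr_varifold m V C) g" by (simp add: first_var_restr[OF C g])
    have on_spt2: "f z \<bullet> \<eta> z = indicator C z *\<^sub>R (g z \<bullet> \<eta> z)" if z: "z \<in> ?S" for z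
    proof -
      consider "z \<notin> ?K" | "z \<in> P" | "z \<in> Q" using z by (auto simp: P_def Q_def)
      then show ?thesis
      proof cases
        case 1
        then have "g z = 0" by (rule closure_support_outside)
        then show ?thesis by (simp add: f_def)
      next
        case 2
        then show ?thesis using \<phi> by (auto simp: f_def P_def)
      next
        case 3
        then have "\<phi> z = 0" using \<phi>(5) by (intro closure_support_outside) auto
        then show ?thesis using 3 by (simp add: f_def Q_def)
      qed
    qed
    have "U - ?S \<in> null_sets \<beta>"
      using var_outside_spt spt_null(1) by (auto simp: null_sets_def sets_var sets_weight)
    then have "AE z in completion \<beta>. z \<notin> U - ?S" by (intro AE_completion AE_not_in)
    moreover have "AE z in completion \<beta>. z \<in> U" using AE_space[of "completion \<beta>"] by (simp add: space_var)
    ultimately have "AE z in completion \<beta>. f z \<bullet> \<eta> z = indicator C z *\<^sub>R (g z \<bullet> \<eta> z)"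
      by eventually_elim (use on_spt2 in auto)
    then have "first_var V f = first_var_on U V C g"
      unfolding first_var_eta[OF f] first_var_on_def set_lebesgue_integral_def
      using CB inner_eta_measurable[OF f] inner_eta_measurable[OF g]
      by (intro integral_cong_AE borel_measurable_scaleR borel_measurable_indicator) auto
    with 1 show "first_var_on U V C g - first_var (restr_varifold m V C) g = 0" by simp
  qed
qed

text \<open>Vanishing boundary says that the first variation of the restricted varifold is the
  restricted first variation, which is bounded because \<open>eta\<close> has length one. This
  inequality, for a Borel representative, is what the mass estimates need.\<close>

lemma zero_boundary_first_var:
  assumes "A \<in> var_sets U V" "zero_boundary U m V A" "z \<notin> A"
  obtains A' where "A' \<in> sets \<mu>" "z \<notin> A'" "restr_varifold m V A = restr_varifold m V A'"
    "\<And>g. g \<in> test_fields U \<Longrightarrow> first_var (restr_varifold m V A') g \<le> (LINT z:A'|\<beta>. norm (g z))"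
proof -
  obtain A' where A': "A' \<subseteq> A" "A' \<in> sets \<mu>" "restr_varifold m V A' = restr_varifold m V A"
    "\<And>g. g \<in> test_fields U \<Longrightarrow> first_var_on U V A' g = first_var_on U V A g"
    using var_sets_representative[OF assms(1)] by metis
  have "first_var (restr_varifold m V A') g \<le> (LINT z:A'|\<beta>. norm (g z))" if g: "g \<in> test_fields U" for g
    using assms(2) A'(3) A'(4)[OF g] first_var_on_le[OF A'(2) g] g
    by (auto simp: zero_boundary_def boundary_def)
  with that[of A'] A' assms(3) show thesis by auto
qed

lemma sets_weight_subset_var_sets: "sets \<mu> \<subseteq> var_sets U V"
  by (auto simp: var_sets_def sets_add_measure)

end

section \<open>Monotonicity and a lower bound on the mass\<close>

text \<open>Differentiation under the integral sign: the mean value theorem bounds all difference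
  quotients by the majorant \<open>w\<close>, and dominated convergence applies along each sequence
  of parameters, from the index on at which it stays between \<open>a\<close> and
  \<open>b\<close>.\<close>

lemma has_derivative_integral_parameter:
  fixes f f' :: "real \<Rightarrow> 'a \<Rightarrow> real"
  assumes t: "a < t" "t < b"
    and f: "\<And>s. a < s \<Longrightarrow> s < b \<Longrightarrow> integrable M (f s)"
    and D: "\<And>s y. a < s \<Longrightarrow> s < b \<Longrightarrow> ((\<lambda>s. f s y) has_real_derivative f' s y) (at s)"
    and w: "integrable M w" "\<And>s y. a < s \<Longrightarrow> s < b \<Longrightarrow> \<bar>f' s y\<bar> \<le> w y"
  shows "((\<lambda>s. LINT y|M. f s y) has_real_derivative (LINT y|M. f' t y)) (at t)"
proof -
  have "(\<lambda>i. ((LINT y|M. f (X i) y) - (LINT y|M. f t y)) / (X i - t)) \<longlonglongrightarrow> (LINT y|M. f' t y)"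
    if X: "\<And>i::nat. X i \<noteq> t" "X \<longlonglongrightarrow> t" for X
  proof -
    obtain n where n: "\<And>i. n \<le> i \<Longrightarrow> a < X i \<and> X i < b"
      using eventually_conj[OF order_tendstoD(1)[OF X(2) t(1)] order_tendstoD(2)[OF X(2) t(2)]]
      by (auto simp: eventually_sequentially)
    define Y where "Y i = X (i + n)" for i
    have Y: "a < Y i" "Y i < b" "Y i \<noteq> t" for i using n X(1) by (auto simp: Y_def)
    have Yl: "Y \<longlonglongrightarrow> t" unfolding Y_def using X(2) by (rule LIMSEQ_ignore_initial_segment)
    have quot: "\<bar>(f (Y i) y - f t y) / (Y i - t)\<bar> \<le> w y" for i y
    proof -
      have "\<exists>z. a < z \<and> z < b \<and> f (Y i) y - f t y = (Y i - t) * f' z y"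
      proof (cases "Y i < t")
        case True
        obtain z where "Y i < z" "z < t" "f t y - f (Y i) y = (t - Y i) * f' z y"
          using MVT2[OF True, of "\<lambda>s. f s y" "\<lambda>s. f' s y"] D Y t by (meson le_less_trans less_le_trans)
        then show ?thesis using Y[of i] t by (intro exI[of _ z]) (auto simp: algebra_simps)
      next
        case False
        then have lt: "t < Y i" using Y(3)[of i] by simp
        obtain z where "t < z" "z < Y i" "f (Y i) y - f t y = (Y i - t) * f' z y"
          using MVT2[OF lt, of "\<lambda>s. f s y" "\<lambda>s. f' s y"] D Y t by (meson le_less_trans less_le_trans)
        then show ?thesis using Y[of i] t by (intro exI[of _ z]) auto
      qed
      then show ?thesis using w(2) Y(3)[of i] by (auto simp: abs_mult)
    qed
    have Q: "(\<lambda>i. LINT y|M. (f (Y i) y - f t y) / (Y i - t)) \<longlonglongrightarrow> (LINT y|M. f' t y)"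
    proof (rule integral_dominated_convergence[OF _ _ w(1)])
      have l: "(\<lambda>i. (f (Y i) y - f t y) / (Y i - t)) \<longlonglongrightarrow> f' t y" for y
      proof -
        have "((\<lambda>s. (f s y - f t y) / (s - t)) \<longlongrightarrow> f' t y) (at t)"
          using D[OF t] by (simp add: has_field_derivative_iff)
        then show ?thesis
          using Y(3) Yl unfolding tendsto_at_iff_sequentially by (auto simp: comp_def)
      qed
      show m: "(\<lambda>y. (f (Y i) y - f t y) / (Y i - t)) \<in> borel_measurable M" for i
        using f Y t by (intro borel_measurable_divide borel_measurable_diff) auto
      show "f' t \<in> borel_measurable M" by (rule borel_measurable_LIMSEQ_real[OF l m])
      show "AE y in M. (\<lambda>i. (f (Y i) y - f t y) / (Y i - t)) \<longlonglongrightarrow> f' t y" using l by simp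
      show "AE y in M. norm ((f (Y i) y - f t y) / (Y i - t)) \<le> w y" for i using quot by simp
    qed
    have eq: "(LINT y|M. (f (Y i) y - f t y) / (Y i - t)) = ((LINT y|M. f (Y i) y) - (LINT y|M. f t y)) / (Y i - t)" for i
      using f Y t by simp
    from Q have "(\<lambda>i. ((LINT y|M. f (X (i + n)) y) - (LINT y|M. f t y)) / (X (i + n) - t)) \<longlonglongrightarrow> (LINT y|M. f' t y)"
      unfolding eq unfolding Y_def .
    then show ?thesis by (rule LIMSEQ_offset)
  qed
  then show ?thesis unfolding has_field_derivative_iff tendsto_at_iff_sequentially by (auto simp: comp_def)
qed

text \<open>The derivative of a radial field is v \<mapsto> (a \<bullet> v) b + c v; this evaluates
  its pairing with a projection matrix.\<close>

lemma trace_rank_one_plus_scalar: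
  fixes P :: "real^'n::finite^'n"
  shows "(\<Sum>i\<in>UNIV. \<Sum>k\<in>UNIV. ((a \<bullet> axis i 1) *\<^sub>R b + c *\<^sub>R axis i 1) $ k * P $ k $ i) = b \<bullet> (P *v a) + c * trace P"
proof -
  have "(\<Sum>i\<in>UNIV. \<Sum>k\<in>UNIV. ((a \<bullet> axis i 1) *\<^sub>R b + c *\<^sub>R axis i 1) $ k * P $ k $ i)
    = (\<Sum>i\<in>UNIV. \<Sum>k\<in>UNIV. b $ k * (P $ k $ i * a $ i)) + (\<Sum>i\<in>UNIV. \<Sum>k\<in>UNIV. c * (axis i 1 $ k * P $ k $ i))"
    by (simp add: inner_axis sum.distrib[symmetric] algebra_simps)
  also have "(\<Sum>i\<in>UNIV. \<Sum>k\<in>UNIV. b $ k * (P $ k $ i * a $ i)) = b \<bullet> (P *v a)"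
    by (subst sum.swap) (simp add: inner_vec_def matrix_vector_mult_def sum_distrib_left)
  also have "(\<Sum>i\<in>UNIV. \<Sum>k\<in>UNIV. c * (axis i 1 $ k * P $ k $ i)) = c * trace P"
    by (simp add: trace_def axis_def if_distrib[of "\<lambda>x. x * _"] sum_distrib_left[symmetric] cong: if_cong)
  finally show ?thesis .
qed

lemma measure_mono_radon:
  fixes M :: "'a::t2_space measure"
  assumes "radon_on U M" "compact K" "K \<subseteq> U" "A \<subseteq> K" "A \<in> sets M"
  shows "measure M A \<le> measure M K"
  using assms radon_onD(3)[OF assms(1-3)]
  by (intro measure_mono_fmeasurable)
     (auto simp: fmeasurable_def radon_onD(1)[OF assms(1)] sets_restrict_space compact_imp_closed intro!: image_eqI[of _ _ K])

lemma emeasure_le_countable_cover: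
  assumes C: "countable C" and A: "\<And>i. i \<in> C \<Longrightarrow> A i \<in> sets M" and B: "\<And>i. i \<in> C \<Longrightarrow> B i \<in> sets N"
    and disj: "disjoint_family_on B C" and le: "\<And>i. i \<in> C \<Longrightarrow> emeasure M (A i) \<le> c * emeasure N (B i)"
  shows "emeasure M (\<Union>i\<in>C. A i) \<le> c * emeasure N (\<Union>i\<in>C. B i)"
proof -
  let ?e = "to_nat_on C"
  let ?I = "?e ` C"
  let ?d = "from_nat_into C"
  have d: "?d (?e i) = i" if "i \<in> C" for i using C that by simp
  define A' where "A' n = (if n \<in> ?I then A (?d n) else {})" for n
  define B' where "B' n = (if n \<in> ?I then B (?d n) else {})" for n
  have A': "range A' \<subseteq> sets M" "(\<Union>n. A' n) = (\<Union>i\<in>C. A i)" using A d by (auto simp: A'_def)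
  have B': "range B' \<subseteq> sets N" "(\<Union>n. B' n) = (\<Union>i\<in>C. B i)" using B d by (auto simp: B'_def)
  have "disjoint_family B'" unfolding disjoint_family_on_def
  proof (intro ballI impI)
    fix k n :: nat assume "k \<noteq> n"
    then show "B' k \<inter> B' n = {}"
      using disj d by (auto simp: B'_def disjoint_family_on_def) (metis disjoint_iff)
  qed
  then have S: "(\<Sum>n. emeasure N (B' n)) = emeasure N (\<Union>i\<in>C. B i)" using B' by (simp add: suminf_emeasure)
  have "emeasure M (\<Union>i\<in>C. A i) \<le> (\<Sum>n. emeasure M (A' n))"
    using emeasure_subadditive_countably[OF A'(1)] A'(2) by simp
  also have "\<dots> \<le> (\<Sum>n. c * emeasure N (B' n))"
    using le d by (intro suminf_le) (auto simp: A'_def B'_def)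
  also have "\<dots> = c * emeasure N (\<Union>i\<in>C. B i)" by (simp add: S)
  finally show ?thesis .
qed

section \<open>Radial cutoffs and the monotonicity identity\<close>

text \<open>The radial profile \<open>y \<mapsto> \<psi>(\<bar>y - x\<bar>\<^sup>2 / t\<^sup>2)\<close> with \<open>\<psi>(s) = exp (-1 / (1 - s))\<close> for \<open>s < 1\<close>.\<close>

definition bump :: "'a::real_inner \<Rightarrow> real \<Rightarrow> 'a \<Rightarrow> real" where
  "bump x t y = flat 0 (1 - ((y - x) \<bullet> (y - x)) * inverse (t\<^sup>2))"

lemma smooth_bump: "smooth (bump x t)"
  unfolding bump_def by (intro smooth_flat smooth_diff smooth_mult smooth_inner smooth_const smooth_ident)

lemma bump_outside:
  assumes "0 < t" "y \<notin> ball x t" shows "1 - ((y - x) \<bullet> (y - x)) * inverse (t\<^sup>2) \<le> 0"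
proof -
  have "t\<^sup>2 \<le> (norm (y - x))\<^sup>2" using assms by (auto simp: dist_norm norm_minus_commute)
  then show ?thesis using assms by (simp add: power2_norm_eq_inner[symmetric] field_simps)
qed

lemma flat_0_le: "flat 0 u \<le> 1"
  by (simp add: flat_def)

lemma flat_2_le: "flat 2 u \<le> 2"
proof (cases "u > 0")
  case True
  then have "(1 / u)\<^sup>2 \<le> 2 * exp (1 / u)"
    using exp_lower_Taylor_quadratic[of "1 / u"] by (simp add: add_nonneg_nonneg) (use divide_pos_pos[of 1 u] in linarith)
  then show ?thesis using True by (simp add: flat_def exp_minus field_simps)
qed (simp add: flat_def)

text \<open>At half the radius the argument of \<open>flat 0\<close> is at least 3/4, so the value
  is at least exp(-4/3) and thus at least exp(-2); the constant 1/9 then comes from e \<le>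
  3.\<close>

lemma bump_inner:
  assumes "0 < t" "y \<in> cball x (t / 2)" shows "1 / 9 \<le> bump x t y"
proof -
  have "(norm (y - x))\<^sup>2 \<le> (t / 2)\<^sup>2"
    using assms by (intro power_mono) (auto simp: dist_norm norm_minus_commute)
  then have "((y - x) \<bullet> (y - x)) * inverse (t\<^sup>2) \<le> 1 / 4"
    using assms by (simp add: power2_norm_eq_inner[symmetric] field_simps power2_eq_square)
  then have u: "3 / 4 \<le> 1 - ((y - x) \<bullet> (y - x)) * inverse (t\<^sup>2)" (is "_ \<le> ?u") by simp
  have "exp (2::real) = exp 1 * exp 1" by (simp flip: exp_add)
  also have "\<dots> \<le> 3 * 3" by (intro mult_mono exp_le) auto
  finally have "(1::real) / 9 \<le> exp (- 2)" by (simp add: exp_minus field_simps)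
  also have "\<dots> \<le> exp (- (1 / ?u))" using u by (simp add: field_simps)
  finally show ?thesis using u by (simp add: bump_def flat_def)
qed

text \<open>With s = \<open>\<bar>y - x\<bar>\<^sup>2 / t\<^sup>2\<close> this is m \<psi>(s) + 2 s
  \<psi>'(s). The same expression arises from differentiating the scaled profile in t
  (\<open>DERIV_bump\<close>) and as a lower bound for the divergence of the radial field along an
  m-plane (\<open>divg_bump\<close>); this coincidence is the monotonicity identity.\<close>

definition bump_rate :: "nat \<Rightarrow> 'a::real_inner \<Rightarrow> real \<Rightarrow> 'a \<Rightarrow> real" where
  "bump_rate m x t y = (let s = ((y - x) \<bullet> (y - x)) * inverse (t\<^sup>2) in m * flat 0 (1 - s) - 2 * s * flat 2 (1 - s))"

lemma DERIV_flat_0: "(flat 0 has_real_derivative flat 2 u) (at u)"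
  using DERIV_flat[of 0 u] by (simp add: numeral_2_eq_2)

lemma DERIV_bump:
  assumes t: "0 < t"
  shows "((\<lambda>t. bump x t y * inverse (t ^ m)) has_real_derivative - bump_rate m x t y * inverse (t ^ Suc m)) (at t)"
proof -
  define w where "w = (y - x) \<bullet> (y - x)"
  have i: "((\<lambda>t. inverse (t ^ k)) has_real_derivative - (real k * inverse (t ^ Suc k))) (at t)" for k
    using t by (auto intro!: derivative_eq_intros simp: field_simps) (cases k; simp add: field_simps)
  have s: "((\<lambda>t. 1 - w * inverse (t\<^sup>2)) has_real_derivative 2 * w * inverse (t ^ 3)) (at t)"
    by (rule DERIV_cong[OF DERIV_diff[OF DERIV_const DERIV_cmult[OF i[of 2], of w]]]) (simp add: eval_nat_numeral)
  have "((\<lambda>t. flat 0 (1 - w * inverse (t\<^sup>2))) has_real_derivative flat 2 (1 - w * inverse (t\<^sup>2)) * (2 * w * inverse (t ^ 3))) (at t)"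
    by (rule DERIV_chain2[OF DERIV_flat_0 s])
  note d = DERIV_mult[OF this i[of m]]
  show ?thesis unfolding bump_def w_def[symmetric]
    by (rule DERIV_cong[OF d])
       (use t in \<open>simp add: bump_rate_def Let_def w_def[symmetric] field_simps power2_eq_square power3_eq_cube\<close>)
qed

lemma bump_rate_bound:
  assumes "0 < t" shows "\<bar>bump_rate m x t y\<bar> \<le> (real m + 4) * indicator (cball x t) y"
proof (cases "y \<in> ball x t")
  case True
  define s where "s = ((y - x) \<bullet> (y - x)) * inverse (t\<^sup>2)"
  have "(norm (y - x))\<^sup>2 \<le> t\<^sup>2" using True assms by (intro power_mono) (auto simp: dist_norm norm_minus_commute)
  then have s: "0 \<le> s" "s \<le> 1" using assms by (auto simp: s_def power2_norm_eq_inner[symmetric] field_simps)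
  have "2 * s * flat 2 (1 - s) \<le> 2 * 1 * 2" using s flat_2_le flat_nonneg by (intro mult_mono) auto
  moreover have "0 \<le> 2 * s * flat 2 (1 - s)" using s flat_nonneg by auto
  moreover have "real m * flat 0 (1 - s) \<le> real m * 1" by (intro mult_left_mono flat_0_le) auto
  moreover have "0 \<le> real m * flat 0 (1 - s)" using flat_nonneg by auto
  ultimately have "\<bar>real m * flat 0 (1 - s) - 2 * s * flat 2 (1 - s)\<bar> \<le> real m + 4" by linarith
  then show ?thesis using True by (simp add: bump_rate_def s_def Let_def)
next
  case False
  then show ?thesis using bump_outside[OF assms False] by (simp add: bump_rate_def flat_nonpos indicator_def)
qed

text \<open>The trace of the projection is m, and the profile decreases in the distance, so
  replacing the projection of y - x by y - x itself can only lower the value. The loss is the normal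
  term of the classical monotonicity formula.\<close>

lemma divg_bump:
  fixes x :: "real^'n::finite"
  assumes "snd p \<in> Grass m" "0 < t"
  shows "bump_rate m x t (fst p) \<le> divg (\<lambda>y. bump x t y *\<^sub>R (y - x)) p"
proof -
  obtain y S where p: "p = (y, S)" by (cases p)
  define c where "c = inverse (t\<^sup>2)"
  define u where "u = 1 - ((y - x) \<bullet> (y - x)) * c"
  have c: "0 < c" using assms by (simp add: c_def)
  have d: "((\<lambda>y. (y - x) \<bullet> (y - x)) has_derivative (\<lambda>v. 2 * ((y - x) \<bullet> v))) (at y)"
    by (auto intro!: derivative_eq_intros simp: inner_commute)
  have q: "((\<lambda>y. 1 - ((y - x) \<bullet> (y - x)) * c) has_derivative (\<lambda>v. - (2 * ((y - x) \<bullet> v)) * c)) (at y)"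
    using has_derivative_diff[OF has_derivative_const has_derivative_mult_left[OF d, of c], of 1] by simp
  have "(bump x t has_derivative (\<lambda>v. (- (2 * ((y - x) \<bullet> v)) * c) * flat 2 u)) (at y)"
    using has_derivative_in_compose[OF q DERIV_flat_0[of u, unfolded has_field_derivative_def, THEN has_derivative_at_withinI, unfolded u_def]]
    by (simp add: bump_def[abs_def] c_def u_def mult.commute)
  then have "((\<lambda>y. bump x t y *\<^sub>R (y - x)) has_derivative
      (\<lambda>v. ((- 2 * c * flat 2 u) *\<^sub>R (y - x) \<bullet> v) *\<^sub>R (y - x) + bump x t y *\<^sub>R v)) (at y)"
    by (auto intro!: derivative_eq_intros simp: algebra_simps)
  then have "divg (\<lambda>y. bump x t y *\<^sub>R (y - x)) p
     = (y - x) \<bullet> (proj_matrix S *v ((- 2 * c * flat 2 u) *\<^sub>R (y - x))) + bump x t y * trace (proj_matrix S)"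
    unfolding divg_eq_sum p fst_conv snd_conv by (subst frechet_derivative_eqI) (assumption, rule trace_rank_one_plus_scalar)
  also have "\<dots> = m * bump x t y - 2 * c * flat 2 u * ((y - x) \<bullet> (proj_matrix S *v (y - x)))"
    using assms(1) unfolding matrix_vector_mult_scaleR by (simp add: p trace_proj_matrix Grass_def)
  also have "\<dots> \<ge> m * bump x t y - 2 * c * flat 2 u * ((y - x) \<bullet> (y - x))"
    using c flat_nonneg[of 2 u] by (intro diff_left_mono mult_left_mono inner_proj_matrix_le) auto
  finally show ?thesis by (simp add: p bump_rate_def bump_def u_def c_def mult_ac Let_def)
qed

text \<open>A lower bound on the upper density: arbitrarily small good radii suffice, which is all
  that the covering argument yields and all that \<open>good_scale\<close> consumes.\<close>

definition thick :: "nat \<Rightarrow> 'a::metric_space measure \<Rightarrow> real \<Rightarrow> 'a \<Rightarrow> bool" where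
  "thick m M \<kappa> x \<longleftrightarrow> (\<forall>e>0. \<exists>t. 0 < t \<and> t < e \<and> \<kappa> * t ^ m \<le> measure M (cball x t))"

text \<open>Here \<open>V\<close> plays the role of a restriction to a set A and
  \<open>\<nu>\<close> that of the total variation restricted to A. The second assumption is
  tailored to radial fields on a ball, whose length is at most the radius.\<close>

locale mass_bound = open_varifold U m V
  for U :: "(real^'n::finite) set" and m :: nat and V :: "'n varif" +
  fixes \<nu> :: "(real^'n) measure"
  assumes radon_nu: "radon_on U \<nu>"
    and first_var_nu: "\<And>x r g. cball x r \<subseteq> U \<Longrightarrow> 0 < r \<Longrightarrow> g \<in> test_fields U \<Longrightarrow>
      (\<And>y. norm (g y) \<le> r * indicator (cball x r) y) \<Longrightarrow> first_var V g \<le> r * measure \<nu> (cball x r)"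
begin

section \<open>Mass ratios, good scales and decay of mass\<close>

lemma cball_sets: "cball x r \<subseteq> U \<Longrightarrow> cball x r \<in> sets \<mu>" "cball x r \<subseteq> U \<Longrightarrow> cball x r \<in> sets \<nu>"
  by (auto simp: sets_weight_iff radon_onD(1)[OF radon_nu] sets_U_iff)

lemma cball_mono:
  assumes "cball x r \<subseteq> cball y s" "cball y s \<subseteq> U"
  shows "measure \<mu> (cball x r) \<le> measure \<mu> (cball y s)" "measure \<nu> (cball x r) \<le> measure \<nu> (cball y s)"
  using measure_mono_radon[OF radon_weight _ assms(2,1)] measure_mono_radon[OF radon_nu _ assms(2,1)]
    cball_sets[of x r] assms by auto

text \<open>The mass ratio of a ball with the indicator replaced by the smooth profile, which makes
  it differentiable in the radius; \<open>ratio_bounds\<close> compares it with the balls of radius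
  t/2 and t.\<close>

definition ratio :: "real^'n \<Rightarrow> real \<Rightarrow> real" where
  "ratio x t = (LINT y|\<mu>. bump x t y * inverse (t ^ m))"

lemma integrable_ball:
  fixes f :: "real^'n \<Rightarrow> real"
  assumes "cball x t \<subseteq> U" "f \<in> borel_measurable \<mu>" "\<And>y. \<bar>f y\<bar> \<le> c * indicator (cball x t) y"
  shows "integrable \<mu> f"
proof (rule integrableI_bounded_set[OF cball_sets(1)[OF assms(1)] assms(2)])
  show "emeasure \<mu> (cball x t) < \<infinity>" using radon_onD(3)[OF radon_weight] assms(1) by simp
  show "AE y\<in>cball x t in \<mu>. norm (f y) \<le> c"
  proof (intro AE_I2 impI)
    fix y assume "y \<in> cball x t" then show "norm (f y) \<le> c" using assms(3)[of y] by simp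
  qed
  show "AE y in \<mu>. y \<notin> cball x t \<longrightarrow> f y = 0"
  proof (intro AE_I2 impI)
    fix y assume "y \<notin> cball x t" then show "f y = 0" using assms(3)[of y] by simp
  qed
qed

lemma measurable_weight_continuous: "continuous_on UNIV f \<Longrightarrow> f \<in> borel_measurable \<mu>"
  using borel_measurable_continuous_on_restrict[OF continuous_on_subset[of UNIV f U]] measurable_cong_sets[OF sets_weight refl] by auto

lemma bump_bound: "0 < t \<Longrightarrow> \<bar>bump x t y\<bar> \<le> 1 * indicator (cball x t) y"
  using bump_outside[of t y x] flat_0_le flat_nonneg[of 0]
  by (cases "y \<in> ball x t") (auto simp: bump_def flat_nonpos indicator_def)

lemma integrable_bump: "0 < t \<Longrightarrow> cball x t \<subseteq> U \<Longrightarrow> integrable \<mu> (bump x t)"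
  by (rule integrable_ball[OF _ measurable_weight_continuous[OF smooth_imp_continuous_on[OF smooth_bump]] bump_bound])

lemma ratio_bounds:
  assumes "0 < t" "cball x t \<subseteq> U"
  shows "measure \<mu> (cball x (t / 2)) / 9 \<le> t ^ m * ratio x t" "t ^ m * ratio x t \<le> measure \<mu> (cball x t)"
proof -
  have sub: "cball x (t / 2) \<subseteq> cball x t" using assms by auto
  have e: "t ^ m * ratio x t = (LINT y|\<mu>. bump x t y)" using assms by (simp add: ratio_def)
  have fin: "emeasure \<mu> (cball x t) < \<infinity>" "emeasure \<mu> (cball x (t / 2)) < \<infinity>"
    using radon_onD(3)[OF radon_weight] assms sub by auto
  have i: "integrable \<mu> (\<lambda>y. 1 / 9 * indicator (cball x (t / 2)) y :: real)" "integrable \<mu> (indicator (cball x t) :: _ \<Rightarrow> real)"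
    using fin cball_sets(1)[OF assms(2)] cball_sets(1)[OF order_trans[OF sub assms(2)]] by auto
  have "(LINT y|\<mu>. 1 / 9 * indicator (cball x (t / 2)) y) \<le> (LINT y|\<mu>. bump x t y)"
  proof (rule integral_mono[OF i(1) integrable_bump[OF assms]])
    show "1 / 9 * indicator (cball x (t / 2)) y \<le> bump x t y" for y
      using bump_inner[OF assms(1), of y x] flat_nonneg by (auto simp: indicator_def bump_def)
  qed
  then show "measure \<mu> (cball x (t / 2)) / 9 \<le> t ^ m * ratio x t"
    using e cball_sets(1)[OF order_trans[OF sub assms(2)]] by simp
  have "(LINT y|\<mu>. bump x t y) \<le> (LINT y|\<mu>. indicator (cball x t) y)"
    by (intro integral_mono integrable_bump[OF assms] i) (use abs_le_D1[OF bump_bound[OF assms(1)]] in simp)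
  then show "t ^ m * ratio x t \<le> measure \<mu> (cball x t)" using e cball_sets(1)[OF assms(2)] by simp
qed

lemma DERIV_ratio:
  assumes t: "0 < t" "t < R" and R: "cball x R \<subseteq> U"
  obtains d where "(ratio x has_real_derivative d) (at t)" "- d \<le> measure \<nu> (cball x t) * inverse (t ^ m)"
proof -
  \<comment> \<open>Gives a majorant of the parameter derivative valid for all radii between t/2 and
    \<open>R\<close>, as differentiation under the integral requires.\<close>
  define c where "c = (real m + 4) * inverse ((t / 2) ^ Suc m)"
  have sub: "cball x s \<subseteq> U" if "s < R" for s using R that by (meson less_imp_le order_trans subset_cball)
  have i: "integrable \<mu> (\<lambda>y. c * indicator (cball x R) y)"
    using cball_sets(1)[OF R] radon_onD(3)[OF radon_weight _ R] by auto
  have b: "\<bar>- bump_rate m x s y * inverse (s ^ Suc m)\<bar> \<le> c * indicator (cball x R) y" if s: "t / 2 < s" "s < R" for s y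
  proof -
    have "\<bar>- bump_rate m x s y * inverse (s ^ Suc m)\<bar> = \<bar>bump_rate m x s y\<bar> * inverse (s ^ Suc m)"
      using s t by (simp add: abs_mult)
    also have "\<dots> \<le> ((real m + 4) * indicator (cball x R) y) * inverse ((t / 2) ^ Suc m)"
    proof (intro mult_mono)
      have "\<bar>bump_rate m x s y\<bar> \<le> (real m + 4) * indicator (cball x s) y" using s t by (intro bump_rate_bound) auto
      also have "\<dots> \<le> (real m + 4) * indicator (cball x R) y" using s by (intro mult_left_mono) (auto simp: indicator_def)
      finally show "\<bar>bump_rate m x s y\<bar> \<le> (real m + 4) * indicator (cball x R) y" .
      show "inverse (s ^ Suc m) \<le> inverse ((t / 2) ^ Suc m)" using s t by (intro le_imp_inverse_le power_mono) auto
    qed (use s t in auto)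
    finally show ?thesis by (simp only: c_def mult.assoc mult.commute mult.left_commute)
  qed
  have D: "((\<lambda>t. LINT y|\<mu>. bump x t y * inverse (t ^ m)) has_real_derivative (LINT y|\<mu>. - bump_rate m x t y * inverse (t ^ Suc m))) (at t)"
  proof (rule has_derivative_integral_parameter[where a = "t / 2" and b = R, OF _ _ _ _ i b])
    show "integrable \<mu> (\<lambda>y. bump x s y * inverse (s ^ m))" if "t / 2 < s" "s < R" for s
      using integrable_bump[of s x] sub[of s] that t by auto
    show "((\<lambda>t. bump x t y * inverse (t ^ m)) has_real_derivative - bump_rate m x s y * inverse (s ^ Suc m)) (at s)"
      if "t / 2 < s" for s y using that t by (intro DERIV_bump) simp
  qed (use t in auto)
  \<comment> \<open>Testing the first variation with this radial field bounds the integral of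
    \<open>bump_rate\<close>, which is the derivative of the ratio up to a negative factor.\<close>
  let ?g = "\<lambda>y. bump x t y *\<^sub>R (y - x)"
  have g: "?g \<in> test_fields U"
  proof (rule test_fieldsI[OF _ compact_cball sub[OF t(2)]])
    show "smooth ?g" by (intro smooth_scaleR smooth_bump smooth_diff smooth_ident smooth_const)
    show "?g y = 0" if "y \<notin> cball x t" for y
      using bump_bound[OF t(1), of x y] that by simp
  qed
  have "norm (?g y) \<le> t * indicator (cball x t) y" for y
  proof -
    have "norm (?g y) \<le> (1 * indicator (cball x t) y) * norm (y - x)"
      unfolding norm_scaleR using bump_bound[OF t(1), of x y] by (intro mult_right_mono) auto
    also have "\<dots> \<le> t * indicator (cball x t) y" by (auto simp: indicator_def dist_norm norm_minus_commute)
    finally show ?thesis .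
  qed
  then have fv: "first_var V ?g \<le> t * measure \<nu> (cball x t)"
    by (rule first_var_nu[OF sub[OF t(2)] t(1) g])
  have rm: "bump_rate m x t \<in> borel_measurable \<mu>"
  proof (rule measurable_weight_continuous)
    have "continuous_on UNIV (flat k)" for k
      by (meson DERIV_flat DERIV_isCont continuous_at_imp_continuous_on)
    then have "continuous_on UNIV (\<lambda>y. flat k (1 - (y - x) \<bullet> (y - x) * inverse (t\<^sup>2)))" for k
      by (rule continuous_on_compose2) (auto intro!: continuous_intros)
    then show "continuous_on UNIV (bump_rate m x t)"
      unfolding bump_rate_def[abs_def] Let_def by (intro continuous_intros)
  qed
  have ir: "integrable \<mu> (bump_rate m x t)"
    by (rule integrable_ball[OF sub[OF t(2)] rm bump_rate_bound[OF t(1)]])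
  have "(LINT y|\<mu>. bump_rate m x t y) = (LINT p|V. bump_rate m x t (fst p))"
    unfolding weight_def by (rule integral_distr[OF measurable_fst_V])
      (rule rm[unfolded measurable_cong_sets[OF sets_weight refl]])
  also have "\<dots> \<le> first_var V ?g"
    unfolding first_var_divg
  proof (rule integral_mono[OF _ integrable_divg[OF g]])
    show "integrable V (\<lambda>p. bump_rate m x t (fst p))"
      using ir unfolding weight_def by (rule integrable_distr[OF measurable_fst_V])
    show "bump_rate m x t (fst p) \<le> divg ?g p" if "p \<in> space V" for p
      using that t by (intro divg_bump) (auto simp: space_V)
  qed
  finally have "(LINT y|\<mu>. bump_rate m x t y) \<le> t * measure \<nu> (cball x t)" using fv by linarith
  then have "(LINT y|\<mu>. bump_rate m x t y) * inverse (t ^ Suc m) \<le> t * measure \<nu> (cball x t) * inverse (t ^ Suc m)"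
    using t by (intro mult_right_mono) auto
  also have "\<dots> = measure \<nu> (cball x t) * inverse (t ^ m)" using t by (simp add: field_simps)
  finally show thesis using that[OF D[folded ratio_def]] ir t by simp
qed

lemma ratio_decay:
  assumes "0 < \<sigma>" "\<sigma> \<le> \<rho>" "\<rho> < R" "cball x R \<subseteq> U"
    and L: "\<And>t. \<sigma> \<le> t \<Longrightarrow> t \<le> \<rho> \<Longrightarrow> measure \<nu> (cball x t) \<le> L * t ^ m"
  shows "ratio x \<sigma> \<le> ratio x \<rho> + L * (\<rho> - \<sigma>)"
proof (cases "\<sigma> = \<rho>")
  case False
  then have lt: "\<sigma> < \<rho>" using assms by simp
  have "\<exists>d. (ratio x has_real_derivative d) (at t) \<and> - d \<le> measure \<nu> (cball x t) * inverse (t ^ m)" if "\<sigma> \<le> t" "t \<le> \<rho>" for t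
    using DERIV_ratio[of t R x] that assms by (metis le_less_trans less_le_trans)
  then obtain d where d: "\<And>t. \<sigma> \<le> t \<Longrightarrow> t \<le> \<rho> \<Longrightarrow> (ratio x has_real_derivative d t) (at t)"
    "\<And>t. \<sigma> \<le> t \<Longrightarrow> t \<le> \<rho> \<Longrightarrow> - d t \<le> measure \<nu> (cball x t) * inverse (t ^ m)" by metis
  obtain z where z: "\<sigma> < z" "z < \<rho>" "ratio x \<rho> - ratio x \<sigma> = (\<rho> - \<sigma>) * d z"
    using MVT2[OF lt d(1)] by blast
  have "- d z \<le> measure \<nu> (cball x z) * inverse (z ^ m)" using z by (intro d) auto
  also have "\<dots> \<le> L * z ^ m * inverse (z ^ m)" using L[of z] z assms(1) by (intro mult_right_mono) auto
  also have "\<dots> = L" using z assms(1) by simp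
  finally have "(\<rho> - \<sigma>) * (- d z) \<le> (\<rho> - \<sigma>) * L" using lt by (intro mult_left_mono) auto
  then show ?thesis using z(3) by (simp add: mult.commute)
qed simp

text \<open>If no scale were good, \<open>\<nu>\<close> would be dominated by \<open>\<mu>\<close>
  at all radii up to \<rho>, so the ratio could grow only slightly towards small radii. It would
  then stay comparable to M / \<open>\<rho> ^ m\<close>, contradicting the density bound. The
  enlargement 5 is that of the Vitali lemma.\<close>

lemma good_scale:
  assumes \<rho>: "0 < \<rho>" "cball x (6 * \<rho>) \<subseteq> U" and M: "measure \<mu> (cball x (5 * \<rho>)) \<le> M"
    and dens: "\<And>e. 0 < e \<Longrightarrow> \<exists>t. 0 < t \<and> t < e \<and> \<kappa> * t ^ m \<le> measure \<mu> (cball x t)"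
    and small: "27 * 2 ^ m * M < \<kappa> * \<rho> ^ m"
  obtains t where "0 < t" "t \<le> \<rho>" "measure \<mu> (cball x (5 * t)) \<le> 18 * 10 ^ m * \<rho> * measure \<nu> (cball x t)"
proof (rule ccontr)
  note scale = that
  assume "\<not> thesis"
  then have neg: "18 * 10 ^ m * \<rho> * measure \<nu> (cball x t) < measure \<mu> (cball x (5 * t))" if "0 < t" "t \<le> \<rho>" for t
    using scale[OF that] by linarith
  have sub: "cball x s \<subseteq> U" if "s \<le> 6 * \<rho>" for s using \<rho>(2) that by (meson order_trans subset_cball)
  have mono: "measure \<mu> (cball x s) \<le> M" if "s \<le> 5 * \<rho>" for s
    using cball_mono(1)[of x s x "5 * \<rho>"] that sub[of "5 * \<rho>"] M \<rho>(1) by (auto simp: subset_cball)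
  have M0: "0 \<le> M" using M measure_nonneg order_trans by blast
  define Q where "Q = M * inverse (\<rho> ^ m)"
  have Q0: "0 \<le> Q" using M0 \<rho> by (simp add: Q_def)
  obtain t0 where t0: "0 < t0" "t0 < \<rho> / 4" "\<kappa> * t0 ^ m \<le> measure \<mu> (cball x t0)" using dens[of "\<rho> / 4"] \<rho> by auto
  \<comment> \<open>Twice \<open>t0\<close>, because \<open>ratio_bounds\<close> compares with the
    ball of half the radius.\<close>
  define \<sigma> where "\<sigma> = 2 * t0"
  have \<sigma>: "0 < \<sigma>" "\<sigma> < \<rho>" using t0 by (auto simp: \<sigma>_def)
  have "continuous_on {\<sigma>..\<rho>} (ratio x)"
  proof (rule continuous_at_imp_continuous_on, rule ballI)
    fix t assume "t \<in> {\<sigma>..\<rho>}"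
    then obtain d where "(ratio x has_real_derivative d) (at t)"
      using DERIV_ratio[of t "6 * \<rho>" x] \<sigma> \<rho> by auto
    then show "isCont (ratio x) t" by (rule DERIV_isCont)
  qed
  \<comment> \<open>The radius of maximal ratio; the decay estimate is run from here up to \<rho>,
    so that the maximum \<open>S\<close> reappears on the right-hand side and can be
    absorbed.\<close>
  then obtain \<tau> where \<tau>: "\<sigma> \<le> \<tau>" "\<tau> \<le> \<rho>" "\<And>t. \<sigma> \<le> t \<Longrightarrow> t \<le> \<rho> \<Longrightarrow> ratio x t \<le> ratio x \<tau>"
    using continuous_attains_sup[of "{\<sigma>..\<rho>}" "ratio x"] \<sigma> by auto
  define S where "S = ratio x \<tau>"
  have S0: "0 \<le> S" unfolding S_def ratio_def using \<sigma> \<tau>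
    by (intro Bochner_Integration.integral_nonneg) (auto simp: bump_def flat_nonneg)
  \<comment> \<open>The 18 = 2 * 9 of the assumption makes L \<rho> equal to S/2 + Q/18. Radii with
    10 t \<le> \<rho> are handled by the ratio at 10 t, twice the enlarged radius 5 t, the others by
    the total mass through \<open>Q\<close>.\<close>
  define L where "L = (9 * S + Q) * inverse (18 * \<rho>)"
  have "measure \<nu> (cball x t) \<le> L * t ^ m" if t: "\<tau> \<le> t" "t \<le> \<rho>" for t
  proof -
    have t_pos: "0 < t" using t \<tau> \<sigma> by linarith
    have "measure \<mu> (cball x (5 * t)) \<le> 10 ^ m * t ^ m * (9 * S + Q)"
    proof (cases "10 * t \<le> \<rho>")
      case True
      have "measure \<mu> (cball x (5 * t)) \<le> 9 * ((10 * t) ^ m * ratio x (10 * t))"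
        using ratio_bounds(1)[of "10 * t" x] sub[of "10 * t"] True t_pos \<rho> by simp
      also have "\<dots> \<le> 9 * ((10 * t) ^ m * S)"
        using \<tau>(3)[of "10 * t"] True t_pos t \<tau> by (intro mult_left_mono) (auto simp: S_def)
      also have "\<dots> \<le> 10 ^ m * t ^ m * (9 * S + Q)" using Q0 t_pos by (simp add: power_mult_distrib algebra_simps)
      finally show ?thesis .
    next
      case False
      have "measure \<mu> (cball x (5 * t)) \<le> M * 1" using mono[of "5 * t"] t by simp
      also have "\<dots> \<le> M * ((10 * t) ^ m * inverse (\<rho> ^ m))"
      proof (rule mult_left_mono[OF _ M0])
        have "\<rho> ^ m \<le> (10 * t) ^ m" using False \<rho> by (intro power_mono) auto
        then show "1 \<le> (10 * t) ^ m * inverse (\<rho> ^ m)" using \<rho> by (simp add: field_simps)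
      qed
      also have "\<dots> = 10 ^ m * t ^ m * Q" by (simp add: Q_def power_mult_distrib)
      also have "\<dots> \<le> 10 ^ m * t ^ m * (9 * S + Q)" using S0 t_pos by (intro mult_left_mono) auto
      finally show ?thesis .
    qed
    with neg[OF t_pos t(2)] have "18 * 10 ^ m * \<rho> * measure \<nu> (cball x t) \<le> 10 ^ m * t ^ m * (9 * S + Q)"
      by linarith
    then have "10 ^ m * (18 * \<rho> * measure \<nu> (cball x t)) \<le> 10 ^ m * (t ^ m * (9 * S + Q))"
      by (simp only: mult_ac)
    then have "18 * \<rho> * measure \<nu> (cball x t) \<le> t ^ m * (9 * S + Q)" by simp
    then show ?thesis using \<rho> by (simp add: L_def field_simps)
  qed
  then have "S \<le> ratio x \<rho> + L * (\<rho> - \<tau>)" unfolding S_def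
    using \<tau> \<sigma> \<rho> by (intro ratio_decay[of _ _ "6 * \<rho>"]) auto
  moreover have "L * (\<rho> - \<tau>) \<le> L * \<rho>"
    using S0 Q0 \<rho> \<tau> \<sigma> by (intro mult_left_mono) (auto simp: L_def)
  moreover have "L * \<rho> = (9 * S + Q) / 18" using \<rho> by (simp add: L_def)
  moreover have "ratio x \<rho> \<le> Q"
  proof -
    have "\<rho> ^ m * ratio x \<rho> \<le> M" using ratio_bounds(2)[of \<rho> x] sub[of \<rho>] mono[of \<rho>] \<rho> by auto
    then show ?thesis using \<rho> by (simp add: Q_def field_simps)
  qed
  moreover have "s \<le> 3 * q" if "s \<le> r + a" "a \<le> b" "b = (9 * s + q) / 18" "r \<le> q" "0 \<le> q" for s q r a b :: real
    using that by simp
  ultimately have S3: "S \<le> 3 * Q" using Q0 by blast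
  have half: "\<sigma> / 2 = t0" by (simp add: \<sigma>_def)
  have "cball x \<sigma> \<subseteq> U" using sub[of \<sigma>] \<sigma> by simp
  from ratio_bounds(1)[OF \<sigma>(1) this] t0(3) have "\<kappa> * t0 ^ m \<le> 9 * (\<sigma> ^ m * ratio x \<sigma>)"
    unfolding half by linarith
  also have "\<dots> \<le> 9 * (\<sigma> ^ m * (3 * Q))"
    using \<tau>(3)[of \<sigma>] S3 \<sigma> by (intro mult_left_mono) (auto simp: S_def)
  also have "\<dots> = 27 * 2 ^ m * t0 ^ m * Q" by (simp add: \<sigma>_def power_mult_distrib)
  finally have "\<kappa> * t0 ^ m \<le> (27 * 2 ^ m * Q) * t0 ^ m" by (simp add: mult_ac)
  then have "\<kappa> \<le> 27 * 2 ^ m * Q" using t0 by simp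
  then have "\<kappa> * \<rho> ^ m \<le> 27 * 2 ^ m * Q * \<rho> ^ m" using \<rho> by (intro mult_right_mono) auto
  also have "\<dots> = 27 * 2 ^ m * M" using \<rho> by (simp add: Q_def)
  finally show False using small by simp
qed

text \<open>Almost every point of the smaller ball has a good scale, and the gap of 6 \<rho> keeps
  all balls involved inside \<open>cball z r\<close>. Vitali's lemma selects disjoint balls to whose
  \<open>\<nu>\<close> measure the mass of the enlarged balls is charged.\<close>

lemma mass_decay:
  assumes r: "cball z r \<subseteq> U" and \<rho>: "0 < \<rho>" "6 * \<rho> \<le> r - r'"
    and small: "27 * 2 ^ m * measure \<mu> (cball z r) < \<kappa> * \<rho> ^ m"
    and dens: "AE x in \<mu>. x \<in> cball z r \<longrightarrow> thick m \<mu> \<kappa> x"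
  shows "measure \<mu> (cball z r') \<le> 18 * 10 ^ m * \<rho> * measure \<nu> (cball z r)"
proof -
  obtain N where N: "N \<in> null_sets \<mu>" "\<And>x. x \<in> U - N \<Longrightarrow> x \<in> cball z r \<Longrightarrow> thick m \<mu> \<kappa> x"
    using dens unfolding eventually_ae_filter by (auto simp: space_weight)
  define T where "T = cball z r' - N"
  have r': "cball z r' \<subseteq> cball z r" using \<rho> by auto
  have sub: "cball x s \<subseteq> cball z r" if "x \<in> T" "s \<le> 6 * \<rho>" for x s
  proof
    fix y assume "y \<in> cball x s"
    then show "y \<in> cball z r" using dist_triangle[of z y x] that \<rho> by (simp add: T_def)
  qed
  have "\<exists>t. 0 < t \<and> t \<le> \<rho> \<and> measure \<mu> (cball x (5 * t)) \<le> 18 * 10 ^ m * \<rho> * measure \<nu> (cball x t)" if x: "x \<in> T" for x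
  proof -
    have s6: "cball x (6 * \<rho>) \<subseteq> U" and s5: "cball x (5 * \<rho>) \<subseteq> cball z r"
      using sub[OF x] r \<rho> by (auto intro: order_trans)
    have "x \<in> cball z r" "x \<notin> N" using x r' by (auto simp: T_def)
    then have "thick m \<mu> \<kappa> x" using N(2)[of x] r by blast
    then have "\<exists>t. 0 < t \<and> t < e \<and> \<kappa> * t ^ m \<le> measure \<mu> (cball x t)" if "0 < e" for e
      using that by (simp add: thick_def)
    then show ?thesis
      using good_scale[OF \<rho>(1) s6 cball_mono(1)[OF s5 r] _ small] by blast
  qed
  then obtain t where t: "\<And>x. x \<in> T \<Longrightarrow> 0 < t x \<and> t x \<le> \<rho>"
    "\<And>x. x \<in> T \<Longrightarrow> measure \<mu> (cball x (5 * t x)) \<le> 18 * 10 ^ m * \<rho> * measure \<nu> (cball x (t x))" by metis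
  have cover: "T \<subseteq> (\<Union>i\<in>T. cball i (t i))"
  proof
    fix x assume "x \<in> T"
    then show "x \<in> (\<Union>i\<in>T. cball i (t i))" using t(1)[of x] by (intro UN_I[of x]) auto
  qed
  obtain C where C: "countable C" "C \<subseteq> T" "pairwise (\<lambda>i j. disjnt (cball i (t i)) (cball j (t j))) C"
    "T \<subseteq> (\<Union>i\<in>C. cball i (5 * t i))"
    by (rule Vitali_covering_lemma_cballs[where a = "\<lambda>x. x" and r = t, OF cover t(1)]) blast
  have t5: "5 * t x \<le> 6 * \<rho>" "t x \<le> 6 * \<rho>" if "x \<in> T" for x using t(1)[OF that] \<rho> by auto
  have c1: "cball i (t i) \<subseteq> cball z r" and c5: "cball i (5 * t i) \<subseteq> U" if "i \<in> C" for i
    using that C(2) t5[of i] sub[of i "t i"] sub[of i "5 * t i"] r by auto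
  have fin: "emeasure M (cball x s) = ennreal (measure M (cball x s))" if "cball x s \<subseteq> U" "radon_on U M" for M x s
    using radon_onD(3)[OF that(2) _ that(1)] by (intro emeasure_eq_ennreal_measure) (auto simp: less_top)
  let ?c = "18 * 10 ^ m * \<rho>"
  have c: "0 \<le> ?c" using \<rho> by simp
  have le: "emeasure \<mu> (cball x (5 * t x)) \<le> ennreal ?c * emeasure \<nu> (cball x (t x))" if "x \<in> C" for x
  proof -
    have x: "x \<in> T" using that C by auto
    have "emeasure \<mu> (cball x (5 * t x)) \<le> ennreal (?c * measure \<nu> (cball x (t x)))"
      using fin[OF order_trans[OF sub[OF x t5(1)[OF x]] r] radon_weight] t(2)[OF x] by (simp add: ennreal_leI)
    also have "\<dots> = ennreal ?c * emeasure \<nu> (cball x (t x))"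
      using fin[OF order_trans[OF sub[OF x t5(2)[OF x]] r] radon_nu] c by (simp add: ennreal_mult)
    finally show ?thesis .
  qed
  have "emeasure \<mu> (cball z r') = emeasure \<mu> T"
    unfolding T_def using N(1) cball_sets(1)[OF order_trans[OF r' r]] by (rule emeasure_Diff_null_set[symmetric])
  also have "\<dots> \<le> emeasure \<mu> (\<Union>i\<in>C. cball i (5 * t i))"
  proof (rule emeasure_mono[OF C(4)])
    show "(\<Union>i\<in>C. cball i (5 * t i)) \<in> sets \<mu>"
      by (intro sets.countable_UN'' C(1) cball_sets(1) c5)
  qed
  also have "\<dots> \<le> ennreal ?c * emeasure \<nu> (\<Union>i\<in>C. cball i (t i))"
  proof (rule emeasure_le_countable_cover[OF C(1) _ _ _ le])
    show "disjoint_family_on (\<lambda>i. cball i (t i)) C"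
      using C(3) by (auto simp: disjoint_family_on_def pairwise_def disjnt_def)
    show "cball i (5 * t i) \<in> sets \<mu>" "cball i (t i) \<in> sets \<nu>" if "i \<in> C" for i
      by (intro cball_sets c5 that order_trans[OF c1[OF that] r])+
  qed
  also have "\<dots> \<le> ennreal ?c * emeasure \<nu> (cball z r)"
    using c1 by (intro mult_left_mono emeasure_mono cball_sets(2)[OF r] UN_least) auto
  also have "\<dots> = ennreal (?c * measure \<nu> (cball z r))" using fin[OF r radon_nu] c by (simp add: ennreal_mult)
  finally have "ennreal (measure \<mu> (cball z r')) \<le> ennreal (?c * measure \<nu> (cball z r))"
    using fin[OF order_trans[OF r' r] radon_weight] by simp
  then show ?thesis using c by (simp add: ennreal_le_iff)
qed

theorem small_mass_vanishes:
  assumes R: "0 < R" "cball z R \<subseteq> U" and m: "1 \<le> m" and \<kappa>: "0 < \<kappa>"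
    and dens: "AE x in \<mu>. x \<in> cball z R \<longrightarrow> thick m \<mu> \<kappa> x"
    and small: "\<And>r \<rho>. 0 < r \<Longrightarrow> r \<le> R \<Longrightarrow> 0 < \<rho> \<Longrightarrow> \<kappa> * \<rho> ^ m = 54 * 2 ^ m * measure \<mu> (cball z r) \<Longrightarrow>
      18 * 10 ^ m * \<rho> * measure \<nu> (cball z r) \<le> measure \<mu> (cball z r) * (1 / 2) ^ m"
    and mass: "54 * 48 ^ m * measure \<mu> (cball z R) \<le> \<kappa> * R ^ m"
  shows "measure \<mu> (cball z (R / 2)) = 0"
proof -
  \<comment> \<open>Radii starting at \<open>R\<close> and decreasing to R/2, the k-th gap being R
    (1/2)^k / 4.\<close>
  define r where "r k = R / 2 * (1 + (1 / 2) ^ k)" for k :: nat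
  have p: "0 < (1 / 2 :: real) ^ k" "(1 / 2 :: real) ^ k \<le> 1" for k by (auto simp: power_le_one)
  have r: "0 < r k" "r k \<le> R" "R / 2 \<le> r k" for k
    using R p[of k] mult_left_mono[of "1 + (1 / 2) ^ k" 2 "R / 2"] mult_left_mono[of 1 "1 + (1 / 2) ^ k" "R / 2"]
    by (auto simp: r_def intro!: mult_pos_pos add_pos_pos)
  have rU: "cball z (r k) \<subseteq> U" for k using R(2) r(2) by (meson order_trans subset_cball)
  have decay: "54 * 48 ^ m * measure \<mu> (cball z (r k)) \<le> \<kappa> * R ^ m * ((1 / 2) ^ m) ^ k" for k
  proof (induction k)
    case 0
    then show ?case using mass by (simp add: r_def)
  next
    case (Suc k)
    let ?M = "measure \<mu> (cball z (r k))"
    have rS: "r (Suc k) \<le> r k" using R by (simp add: r_def)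
    have "measure \<mu> (cball z (r (Suc k))) \<le> ?M * (1 / 2) ^ m"
    proof (cases "?M = 0")
      case True
      then show ?thesis
        using cball_mono(1)[of z "r (Suc k)" z "r k"] rU[of k] rS by (simp add: subset_cball)
    next
      case False
      then have M: "0 < ?M" by (simp add: zero_less_measure_iff)
      \<comment> \<open>Twice the threshold 27 * 2^m of \<open>mass_decay\<close>, whose hypothesis
        is a strict inequality.\<close>
      define \<rho> where "\<rho> = root m (54 * 2 ^ m * ?M / \<kappa>)"
      have \<rho>: "0 < \<rho>" "\<kappa> * \<rho> ^ m = 54 * 2 ^ m * ?M"
        using M \<kappa> m by (auto simp: \<rho>_def real_root_pow_pos2)
      \<comment> \<open>Since 48 = 24 * 2, the induction hypothesis says that 24 \<rho> is at most R
        (1/2)^k, four times the gap; this leaves the room of 6 \<rho>.\<close>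
      have p48: "(48::real) ^ m = 24 ^ m * 2 ^ m" by (simp flip: power_mult_distrib)
      have pk: "((1 / 2 :: real) ^ m) ^ k = ((1 / 2) ^ k) ^ m"
        by (simp only: power_mult[symmetric] mult.commute[of m k])
      have "\<kappa> * (24 * \<rho>) ^ m = 24 ^ m * (\<kappa> * \<rho> ^ m)" by (simp only: power_mult_distrib mult_ac)
      also have "\<dots> = 54 * 48 ^ m * ?M" by (simp only: \<rho>(2) p48 mult_ac)
      also have "\<dots> \<le> \<kappa> * R ^ m * ((1 / 2) ^ m) ^ k" by (rule Suc.IH)
      also have "\<dots> = \<kappa> * (R * (1 / 2) ^ k) ^ m" by (simp only: pk power_mult_distrib mult_ac)
      finally have "(24 * \<rho>) ^ m \<le> (R * (1 / 2) ^ k) ^ m" using \<kappa> mult_le_cancel_left_pos by blast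
      then have "24 * \<rho> \<le> R * (1 / 2) ^ k"
        by (rule power_mono_iff[THEN iffD1, rotated 3]) (use m R \<rho>(1) in auto)
      moreover have "r k - r (Suc k) = R * (1 / 2) ^ k / 4" by (simp add: r_def algebra_simps)
      ultimately have gap: "6 * \<rho> \<le> r k - r (Suc k)" by linarith
      have "measure \<mu> (cball z (r (Suc k))) \<le> 18 * 10 ^ m * \<rho> * measure \<nu> (cball z (r k))"
      proof (rule mass_decay[OF rU \<rho>(1) gap])
        show "27 * 2 ^ m * ?M < \<kappa> * \<rho> ^ m" unfolding \<rho>(2) using M by simp
        show "AE x in \<mu>. x \<in> cball z (r k) \<longrightarrow> thick m \<mu> \<kappa> x"
          using dens by (rule eventually_mono) (use r(2)[of k] in auto)
      qed
      also have "\<dots> \<le> ?M * (1 / 2) ^ m" by (rule small[OF r(1,2) \<rho>])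
      finally show ?thesis .
    qed
    then have "54 * 48 ^ m * measure \<mu> (cball z (r (Suc k))) \<le> (54 * 48 ^ m * ?M) * (1 / 2) ^ m" by simp
    also have "\<dots> \<le> (\<kappa> * R ^ m * ((1 / 2) ^ m) ^ k) * (1 / 2) ^ m" by (intro mult_right_mono Suc.IH) auto
    finally show ?case by (simp add: mult_ac)
  qed
  have "(\<lambda>k. \<kappa> * R ^ m * ((1 / 2) ^ m) ^ k) \<longlonglongrightarrow> \<kappa> * R ^ m * 0"
    using m by (intro tendsto_mult_left LIMSEQ_power_zero) (auto simp: power_less_one_iff)
  moreover have "54 * 48 ^ m * measure \<mu> (cball z (R / 2)) \<le> \<kappa> * R ^ m * ((1 / 2) ^ m) ^ k" for k
  proof -
    have "measure \<mu> (cball z (R / 2)) \<le> measure \<mu> (cball z (r k))"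
      by (intro cball_mono(1) subset_cball r rU)
    then have "54 * 48 ^ m * measure \<mu> (cball z (R / 2)) \<le> 54 * 48 ^ m * measure \<mu> (cball z (r k))"
      by (intro mult_left_mono) auto
    then show ?thesis using decay[of k] by linarith
  qed
  ultimately have "54 * 48 ^ m * measure \<mu> (cball z (R / 2)) \<le> \<kappa> * R ^ m * 0"
    by (intro LIMSEQ_le_const) auto
  then have "54 * 48 ^ m * measure \<mu> (cball z (R / 2)) \<le> 0" by simp
  show ?thesis
  proof (rule ccontr)
    assume "measure \<mu> (cball z (R / 2)) \<noteq> 0"
    then have "0 < measure \<mu> (cball z (R / 2))" by (simp add: zero_less_measure_iff)
    then have "0 < 54 * 48 ^ m * measure \<mu> (cball z (R / 2))" by (intro mult_pos_pos) auto
    with \<open>54 * 48 ^ m * measure \<mu> (cball z (R / 2)) \<le> 0\<close> show False by simp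
  qed
qed

end

text \<open>Outer regularity from inner regularity: take a neighbourhood \<open>G\<close> of
  \<open>K\<close> of finite measure and remove a compact set that nearly exhausts
  \<open>G - E\<close>.\<close>

lemma radon_outer_approx:
  fixes M :: "'a::euclidean_space measure"
  assumes M: "radon_on U M" and U: "open U" and K: "compact K" "K \<subseteq> U"
    and E: "E \<in> sets M" "E \<subseteq> K" and e: "0 < (e::real)"
  obtains W where "open W" "E \<subseteq> W" "W \<subseteq> U" "emeasure M W \<le> emeasure M E + ennreal e"
proof -
  have sM: "B \<in> sets M \<longleftrightarrow> B \<in> sets borel \<and> B \<subseteq> U" for B
    by (simp add: radon_onD(1)[OF M] sets_restrict_open[OF U])
  obtain \<phi> G where \<phi>: "open G" "K \<subseteq> G" "\<And>x. x \<in> G \<Longrightarrow> \<phi> x = (1::real)"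
    "compact (closure {x. \<phi> x \<noteq> 0})" "closure {x. \<phi> x \<noteq> 0} \<subseteq> U"
    by (rule smooth_Urysohn[OF K(1) U K(2)]) blast
  have GK: "G \<subseteq> closure {x. \<phi> x \<noteq> 0}" using \<phi>(3) closure_subset[of "{x. \<phi> x \<noteq> 0}"] by fastforce
  have GU: "G \<subseteq> U" using GK \<phi>(5) by blast
  have cl: "closure {x. \<phi> x \<noteq> 0} \<in> sets M" using \<phi>(5) by (simp add: sM)
  have fin: "emeasure M G < \<infinity>"
    using emeasure_mono[OF GK cl] radon_onD(3)[OF M \<phi>(4,5)] by (rule le_less_trans)
  have GM: "G \<in> sets M" "G - E \<in> sets M" using \<phi>(1) GU E(1) by (auto simp: sM)
  have finD: "emeasure M (G - E) < \<infinity>" using emeasure_mono[of "G - E" G M] GM fin by (auto intro: le_less_trans)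
  obtain C where C: "compact C" "C \<subseteq> G - E" "emeasure M (G - E) \<le> emeasure M C + ennreal e"
    using compact_subset_approx[OF radon_onD(1)[OF M] U GM(2) finD e] by metis
  have CM: "C \<in> sets M" using C GU by (auto simp: sM compact_imp_closed)
  have finC: "emeasure M C \<noteq> \<infinity>" using emeasure_mono[OF C(2) GM(2)] finD by (auto simp: less_top[symmetric] top_unique)
  show thesis
  proof
    show "open (G - C)" using \<phi>(1) C(1) by (simp add: compact_imp_closed open_Diff)
    show "E \<subseteq> G - C" using E(2) \<phi>(2) C(2) by blast
    show "G - C \<subseteq> U" using GU by blast
    have "G - C = E \<union> (G - E - C)" using E(2) \<phi>(2) C(2) by blast
    then have "emeasure M (G - C) \<le> emeasure M E + emeasure M (G - E - C)"
      using emeasure_subadditive[OF E(1), of "G - E - C"] GM CM by auto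
    also have "emeasure M (G - E - C) = emeasure M (G - E) - emeasure M C"
      by (rule emeasure_Diff[OF finC GM(2) CM C(2)])
    also have "\<dots> \<le> ennreal e"
      using C(3) finC by (simp add: ennreal_minus_le_iff)
    finally show "emeasure M (G - C) \<le> emeasure M E + ennreal e" by (simp add: add_left_mono)
  qed
qed

text \<open>A Vitali covering argument replaces the Lebesgue density theorem, at the price of the factor \<open>4 * 5\<^sup>m\<close>.\<close>

lemma AE_thick_subset:
  fixes M :: "'a::euclidean_space measure"
  assumes M: "radon_on U M" and U: "open U"
    and dens: "AE z in M. \<exists>\<theta>. has_density U m M z \<theta> \<and> \<theta> \<ge> 1" and A: "A \<in> sets M"
  defines "\<kappa> \<equiv> unit_ball_vol (real m) / (4 * 5 ^ m)"
  shows "AE x in M. x \<in> A \<longrightarrow> (\<forall>e>0. \<exists>t. 0 < t \<and> t < e \<and> \<kappa> * t ^ m \<le> measure M (A \<inter> cball x t))"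
proof -
  define a where "a = unit_ball_vol (real m)"
  have a: "0 < a" by (simp add: a_def unit_ball_vol_pos)
  have sM: "B \<in> sets M \<longleftrightarrow> B \<in> sets borel \<and> B \<subseteq> U" for B
    by (simp add: radon_onD(1)[OF M] sets_restrict_open[OF U])
  obtain C where C: "\<And>n::nat. compact (C n)" "\<And>n. C n \<subseteq> U" "\<Union>(range C) = U"
    using open_Union_compact_subsets[OF U] by metis
  \<comment> \<open>The bad points, sorted by a compact set containing them and a radius below which
    the density of \<open>A\<close> is too small while the full measure has ratio at least
    \<open>a / 2\<close>.\<close>
  define N where "N j k = {x \<in> A \<inter> C j. cball x (1 / real (Suc k)) \<subseteq> U \<and>
      (\<forall>t. 0 < t \<and> t < 1 / real (Suc k) \<longrightarrow> measure M (A \<inter> cball x t) < \<kappa> * t ^ m \<and> a / 2 * t ^ m \<le> measure M (cball x t))}" for j k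
  have "outer_measure_of M (N j k) = 0" for j k
  proof -
    let ?N = "N j k"
    have CM: "C j \<in> sets M" "A \<inter> C j \<in> sets M" using C(1,2) A by (auto simp: sM compact_imp_closed)
    \<comment> \<open>Measurability of the bad set is not established; a measurable hull carries its
      outer measure, and intersecting with \<open>C j\<close> makes the hull finite and open to
      outer approximation.\<close>
    have "?N \<subseteq> space M" using C(2) by (auto simp: N_def radon_onD(2)[OF M])
    then obtain E0 where E0: "E0 \<in> sets M" "?N \<subseteq> E0" "outer_measure_of M ?N = emeasure M E0"
      using outer_measure_of_attain[of ?N M] by auto
    define E where "E = E0 \<inter> C j"
    have E: "E \<in> sets M" "?N \<subseteq> E" "E \<subseteq> C j" using E0 CM by (auto simp: E_def N_def)
    have oE: "outer_measure_of M ?N = emeasure M E"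
    proof (rule antisym)
      show "outer_measure_of M ?N \<le> emeasure M E" using outer_measure_of_mono[OF E(2), of M] E(1) by simp
      show "emeasure M E \<le> outer_measure_of M ?N" unfolding E0(3) using E0(1) by (intro emeasure_mono) (auto simp: E_def)
    qed
    have finE: "emeasure M E < \<infinity>"
      using emeasure_mono[OF E(3) CM(1)] radon_onD(3)[OF M C(1,2)] by (rule le_less_trans)
    \<comment> \<open>Inside an open set of almost the same measure, the enlarged balls cover the
      bad set while carrying at most half the mass of the disjoint balls. Letting \<open>e\<close>
      tend to 0 forces measure zero.\<close>
    have half: "emeasure M E \<le> ennreal (1 / 2) * (emeasure M E + ennreal e)" if e: "0 < e" for e
    proof -
      obtain W where W: "open W" "E \<subseteq> W" "W \<subseteq> U" "emeasure M W \<le> emeasure M E + ennreal e"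
        using radon_outer_approx[OF M U C(1,2) E(1,3) e] by metis
      have "\<exists>r. 0 < r \<and> 5 * r < 1 / real (Suc k) \<and> cball x r \<subseteq> W" if "x \<in> ?N" for x
      proof -
        have "x \<in> W" using that E(2) W(2) by blast
        then obtain s where s: "0 < s" "cball x s \<subseteq> W" using W(1) open_contains_cball by blast
        have "cball x (min s (1 / (6 * real (Suc k)))) \<subseteq> W" using s(2) by auto
        moreover have "5 * min s (1 / (6 * real (Suc k))) < 1 / real (Suc k)"
        proof -
          have "5 * min s (1 / (6 * real (Suc k))) \<le> 5 * (1 / (6 * real (Suc k)))"
            by (intro mult_left_mono min.cobounded2) simp
          also have "\<dots> < 1 / real (Suc k)" by (simp add: field_simps)
          finally show ?thesis .
        qed
        ultimately show ?thesis using s(1) by (intro exI[of _ "min s (1 / (6 * real (Suc k)))"]) auto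
      qed
      then obtain r where r: "\<And>x. x \<in> ?N \<Longrightarrow> 0 < r x" "\<And>x. x \<in> ?N \<Longrightarrow> 5 * r x < 1 / real (Suc k)"
        "\<And>x. x \<in> ?N \<Longrightarrow> cball x (r x) \<subseteq> W" by metis
      have cover: "?N \<subseteq> (\<Union>x\<in>?N. cball x (r x))"
      proof
        fix x assume "x \<in> ?N"
        then show "x \<in> (\<Union>x\<in>?N. cball x (r x))" using r(1)[of x] by (intro UN_I[of x]) auto
      qed
      have rb: "0 < r x \<and> r x \<le> 1 / real (Suc k)" if "x \<in> ?N" for x using r(1,2)[OF that] by linarith
      obtain D where D: "countable D" "D \<subseteq> ?N"
        "pairwise (\<lambda>i j. disjnt (cball i (r i)) (cball j (r j))) D" "?N \<subseteq> (\<Union>i\<in>D. cball i (5 * r i))"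
        by (rule Vitali_covering_lemma_cballs[where a = "\<lambda>x. x" and r = r, OF cover rb]) blast
      have DU: "cball x (5 * r x) \<subseteq> U" if "x \<in> D" for x
      proof -
        have "cball x (1 / real (Suc k)) \<subseteq> U" using that D(2) by (auto simp: N_def)
        moreover have "cball x (5 * r x) \<subseteq> cball x (1 / real (Suc k))"
          using r(2)[of x] that D(2) by (intro subset_cball) auto
        ultimately show ?thesis by blast
      qed
      have DW: "cball x (r x) \<subseteq> W" if "x \<in> D" for x using r(3)[of x] that D(2) by blast
      have sets5: "A \<inter> cball x (5 * r x) \<in> sets M" if "x \<in> D" for x
        using DU[OF that] A by (auto simp: sM)
      have sets1: "cball x (r x) \<in> sets M" if "x \<in> D" for x
        using DW[OF that] W(3) by (auto simp: sM)
      have "emeasure M (A \<inter> cball x (5 * r x)) \<le> ennreal (1 / 2) * emeasure M (cball x (r x))" if x: "x \<in> D" for x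
      proof -
        have xN: "x \<in> ?N" using x D(2) by blast
        have b: "\<And>t. 0 < t \<Longrightarrow> t < 1 / real (Suc k) \<Longrightarrow> measure M (A \<inter> cball x t) < \<kappa> * t ^ m \<and> a / 2 * t ^ m \<le> measure M (cball x t)"
          using xN by (auto simp: N_def)
        \<comment> \<open>The denominator of \<kappa> is read off here: 5^m pays for the enlarged
          radius, one factor 1/2 for the lower bound \<open>a / 2\<close>, the other one is the
          gain.\<close>
        have "measure M (A \<inter> cball x (5 * r x)) \<le> \<kappa> * (5 * r x) ^ m" using b[of "5 * r x"] r(1,2)[OF xN] by simp
        also have "\<dots> = 1 / 2 * (a / 2 * r x ^ m)" by (simp add: \<kappa>_def a_def power_mult_distrib)
        also have "\<dots> \<le> 1 / 2 * measure M (cball x (r x))" using b[of "r x"] r(1,2)[OF xN] by simp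
        finally have le: "measure M (A \<inter> cball x (5 * r x)) \<le> 1 / 2 * measure M (cball x (r x))" .
        have "emeasure M (cball x (5 * r x)) < \<infinity>" by (rule radon_onD(3)[OF M compact_cball DU[OF x]])
        moreover have "cball x (5 * r x) \<in> sets M" using DU[OF x] by (auto simp: sM)
        ultimately have f5: "emeasure M (A \<inter> cball x (5 * r x)) < \<infinity>"
          using emeasure_mono[of "A \<inter> cball x (5 * r x)" "cball x (5 * r x)" M] by (auto intro: le_less_trans)
        have f1: "emeasure M (cball x (r x)) < \<infinity>"
          using DW[OF x] W(3) by (intro radon_onD(3)[OF M compact_cball]) auto
        have "emeasure M (A \<inter> cball x (5 * r x)) = ennreal (measure M (A \<inter> cball x (5 * r x)))"
          using f5 by (intro emeasure_eq_ennreal_measure) auto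
        also have "\<dots> \<le> ennreal (1 / 2 * measure M (cball x (r x)))" by (rule ennreal_leI[OF le])
        also have "\<dots> = ennreal (1 / 2) * ennreal (measure M (cball x (r x)))" by (rule ennreal_mult) auto
        also have "ennreal (measure M (cball x (r x))) = emeasure M (cball x (r x))"
          using f1 by (intro emeasure_eq_ennreal_measure[symmetric]) auto
        finally show ?thesis .
      qed
      then have cov: "emeasure M (\<Union>x\<in>D. A \<inter> cball x (5 * r x)) \<le> ennreal (1 / 2) * emeasure M (\<Union>x\<in>D. cball x (r x))"
        using D(3) by (intro emeasure_le_countable_cover[OF D(1) sets5 sets1])
          (auto simp: disjoint_family_on_def pairwise_def disjnt_def)
      have "emeasure M E \<le> emeasure M (\<Union>x\<in>D. A \<inter> cball x (5 * r x))"
      proof -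
        have m5: "(\<Union>x\<in>D. A \<inter> cball x (5 * r x)) \<in> sets M" by (intro sets.countable_UN'' D(1) sets5)
        have "?N \<subseteq> (\<Union>x\<in>D. A \<inter> cball x (5 * r x))"
        proof
          fix y assume y: "y \<in> ?N"
          then have "y \<in> A" by (simp add: N_def)
          moreover from y D(4) obtain i where "i \<in> D" "y \<in> cball i (5 * r i)" by blast
          ultimately show "y \<in> (\<Union>x\<in>D. A \<inter> cball x (5 * r x))" by blast
        qed
        then have "outer_measure_of M ?N \<le> outer_measure_of M (\<Union>x\<in>D. A \<inter> cball x (5 * r x))" by (rule outer_measure_of_mono)
        then show ?thesis by (simp only: oE outer_measure_of_eq[OF m5])
      qed
      also note cov
      also have "emeasure M (\<Union>x\<in>D. cball x (r x)) \<le> emeasure M W"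
        using W(1,3) DW by (intro emeasure_mono UN_least) (auto simp: sM)
      also note W(4)
      finally show ?thesis by (simp add: mult_left_mono)
    qed
    have eqE: "emeasure M E = ennreal (measure M E)" using finE by (intro emeasure_eq_ennreal_measure) auto
    have h: "measure M E \<le> 1 / 2 * (measure M E + e)" if "0 < e" for e
    proof -
      have "ennreal (1 / 2) * (ennreal (measure M E) + ennreal e) = ennreal (1 / 2 * (measure M E + e))"
        unfolding ennreal_plus[OF measure_nonneg less_imp_le[OF that], symmetric]
        by (rule ennreal_mult[symmetric]) (use that in simp_all)
      then have "ennreal (measure M E) \<le> ennreal (1 / 2 * (measure M E + e))"
        using half[OF that] eqE by simp
      then show ?thesis using that by (subst (asm) ennreal_le_iff) (auto simp: add_nonneg_nonneg)
    qed
    have "measure M E \<le> 0 + e" if "0 < e" for e using h[OF that] by simp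
    then have "measure M E \<le> 0" by (rule field_le_epsilon)
    then show ?thesis unfolding oE eqE by (simp add: ennreal_neg)
  qed
  then have "\<exists>E\<in>null_sets M. N j k \<subseteq> E" for j k
  proof -
    have "N j k \<subseteq> space M" using C(2) by (auto simp: N_def radon_onD(2)[OF M])
    then obtain E0 where "E0 \<in> sets M" "N j k \<subseteq> E0" "outer_measure_of M (N j k) = emeasure M E0"
      using outer_measure_of_attain[of "N j k" M] by auto
    then show ?thesis using \<open>\<And>k j. outer_measure_of M (N j k) = 0\<close>[of j k] by (intro bexI[of _ E0]) (auto simp: null_sets_def)
  qed
  then have "AE x in M. x \<notin> N j k" for j k
  proof -
    obtain E where E: "E \<in> null_sets M" "N j k \<subseteq> E" using \<open>\<And>k j. \<exists>E\<in>null_sets M. N j k \<subseteq> E\<close> by blast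
    from AE_not_in[OF E(1)] show ?thesis by eventually_elim (use E(2) in blast)
  qed
  then have "AE x in M. \<forall>j k. x \<notin> N j k" by (simp add: AE_all_countable)
  with dens AE_space[of M] show ?thesis
  proof eventually_elim
    case (elim x)
    show ?case
    proof (intro impI allI, rule ccontr)
      fix e :: real assume xA: "x \<in> A" and e: "0 < e"
        and no: "\<not> (\<exists>t. 0 < t \<and> t < e \<and> \<kappa> * t ^ m \<le> measure M (A \<inter> cball x t))"
      have xU: "x \<in> U" using elim(2) by (simp add: radon_onD(2)[OF M])
      then obtain j where j: "x \<in> C j" using C(3) by blast
      obtain s where s: "0 < s" "cball x s \<subseteq> U" using xU U open_contains_cball by blast
      obtain \<theta> where \<theta>: "has_density U m M x \<theta>" "\<theta> \<ge> 1" using elim(1) by blast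
      \<comment> \<open>Density at least one as a limit gives ratios above 1/2 at all small
        radii.\<close>
      have "ennreal (1 / 2) < ennreal 1" by (subst ennreal_less_iff) auto
      then have "ennreal (1 / 2) < \<theta>" using \<theta>(2) by (simp only: ennreal_1 less_le_trans)
      from order_tendstoD(1)[OF \<theta>(1)[unfolded has_density_def] this]
      obtain d where d: "0 < d" "\<And>t. 0 < t \<Longrightarrow> t < d \<Longrightarrow> ennreal (1 / 2) < emeasure M (cball x t \<inter> U) / ennreal (a * t ^ m)"
        unfolding eventually_at_right_field a_def by auto
      obtain k where k: "1 / real (Suc k) < min e (min s d)"
        using reals_Archimedean[of "min e (min s d)"] e s(1) d(1) by (auto simp: inverse_eq_divide)
      have "x \<in> N j k"
        unfolding N_def
      proof (intro CollectI conjI allI impI IntI xA j)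
        show "cball x (1 / real (Suc k)) \<subseteq> U" using k s(2) by (intro order_trans[OF subset_cball s(2)]) simp
        fix t assume t: "0 < t \<and> t < 1 / real (Suc k)"
        have te: "t < e" "t < s" "t < d" using t k by linarith+
        show "measure M (A \<inter> cball x t) < \<kappa> * t ^ m" using no t te(1) not_le by blast
        have tU: "cball x t \<subseteq> U" using te(2) by (intro order_trans[OF subset_cball s(2)]) simp
        have at: "0 < a * t ^ m" using a t by simp
        have "emeasure M (cball x t) = ennreal (measure M (cball x t))"
          using radon_onD(3)[OF M compact_cball tU] by (intro emeasure_eq_ennreal_measure) auto
        then have "ennreal (1 / 2) < ennreal (measure M (cball x t)) / ennreal (a * t ^ m)"
          using d(2)[of t] t te(3) tU by (simp add: Int_absorb2)
        also have "\<dots> = ennreal (measure M (cball x t) / (a * t ^ m))" using at by (intro divide_ennreal) auto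
        finally have "1 / 2 < measure M (cball x t) / (a * t ^ m)" by (subst (asm) ennreal_less_iff) auto
        then have "1 / 2 * (a * t ^ m) < measure M (cball x t)" using at by (simp only: less_divide_eq if_True)
        then show "a / 2 * t ^ m \<le> measure M (cball x t)" by simp
      qed
      then show False using elim(3) by blast
    qed
  qed
qed

text \<open>Punctured closed balls decrease to the empty set, so their measures tend to 0 even if
  the centre is an atom.\<close>

lemma shrinking_punctured_ball:
  fixes M :: "'a::euclidean_space measure"
  assumes M: "radon_on U M" and U: "open U" "z \<in> U" and d: "0 < d" and R0: "0 < R0"
  obtains R where "0 < R" "R < R0" "cball z R \<subseteq> U" "measure M (cball z R - {z}) < d"
proof -
  obtain s where s: "0 < s" "cball z s \<subseteq> U" using U open_contains_cball by blast
  define t where "t = min s (R0 / 2)"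
  have t: "0 < t" "t < R0" "cball z t \<subseteq> U" using s R0 by (auto simp: t_def)
  define B where "B i = cball z (t / real (Suc i)) - {z}" for i
  have sub: "cball z (t / real (Suc i)) \<subseteq> cball z t" for i
    using t(1) by (intro subset_cball) (simp add: field_simps)
  have BM: "B i \<in> sets M" for i
    using sub[of i] t(3) by (auto simp: B_def radon_onD(1)[OF M] sets_restrict_open[OF U(1)])
  have fin: "emeasure M (B i) \<noteq> \<infinity>" for i
  proof -
    have "emeasure M (B i) \<le> emeasure M (cball z t)"
      using sub[of i] t(3) by (intro emeasure_mono) (auto simp: B_def radon_onD(1)[OF M] sets_restrict_open[OF U(1)])
    also have "\<dots> < \<infinity>" using t(3) by (intro radon_onD(3)[OF M]) auto
    finally show ?thesis by simp
  qed
  have "decseq B"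
    unfolding decseq_Suc_iff B_def using t(1)
    by (intro allI Diff_mono subset_cball) (auto simp: field_simps)
  then have "(\<lambda>i. measure M (B i)) \<longlonglongrightarrow> measure M (\<Inter>i. B i)"
    using BM fin by (intro Lim_measure_decseq) auto
  moreover have "(\<Inter>i. B i) = {}"
  proof (rule ccontr)
    assume "(\<Inter>i. B i) \<noteq> {}"
    then obtain y where y: "\<And>i. y \<in> B i" by blast
    have "y \<noteq> z" using y[of 0] by (simp add: B_def)
    then have "0 < dist z y / t" using t(1) by simp
    then obtain i where "inverse (real (Suc i)) < dist z y / t" using reals_Archimedean by blast
    then have "t / real (Suc i) < dist z y" using t(1) by (simp add: field_simps)
    then show False using y[of i] by (simp add: B_def)
  qed
  ultimately have "(\<lambda>i. measure M (B i)) \<longlonglongrightarrow> 0" by simp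
  then obtain i where i: "measure M (B i) < d"
    using eventually_happens'[OF sequentially_bot order_tendstoD(2)[OF _ d]] by blast
  show thesis
  proof
    show "0 < t / real (Suc i)" "cball z (t / real (Suc i)) \<subseteq> U" using t sub[of i] by auto
    show "t / real (Suc i) < R0"
      using t by (intro le_less_trans[OF _ t(2)]) (simp add: field_simps)
    show "measure M (cball z (t / real (Suc i)) - {z}) < d" using i by (simp add: B_def)
  qed
qed

text \<open>Either x is at most e, or x^(m-1) exceeds e^(m-1) and the second summand alone is
  enough.\<close>

lemma young_ineq:
  assumes "0 < e" "0 \<le> (x::real)" "1 \<le> m"
  shows "x \<le> e + x ^ m / e ^ (m - 1)"
proof (cases "x \<le> e")
  case True
  then show ?thesis using assms by (simp add: add_increasing2)
next
  case False
  have "x * e ^ (m - 1) \<le> x * x ^ (m - 1)" using False assms by (intro mult_left_mono power_mono) auto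
  also have "\<dots> = x ^ m" using assms(3) by (cases m) auto
  finally have "x \<le> x ^ m / e ^ (m - 1)" using assms(1) by (simp add: field_simps)
  then show ?thesis using assms by simp
qed

locale regular_varifold = radon_varifold U m V
  for U :: "(real^'n::finite) set" and m :: nat and V :: "'n varif" +
  assumes m_pos: "1 \<le> m"
    and density_ge_1: "AE z in weight U V. \<exists>\<theta>. has_density U m (weight U V) z \<theta> \<and> \<theta> \<ge> 1"
    and mean_curvature: "m > 1 \<Longrightarrow>
           (\<forall>K. compact K \<and> K \<subseteq> U \<longrightarrow>
              set_integrable (completion (weight U V)) K (\<lambda>z. norm (mean_curv U V z) ^ m)) \<and>
           (\<forall>g\<in>test_fields U. first_var V g =
              - (LINT z|completion (weight U V). g z \<bullet> mean_curv U V z))"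
begin

section \<open>Smallness of the variation near a point\<close>

lemma sets_eq: "sets \<mu> = sets \<beta>"
  by (simp add: sets_weight sets_var)

text \<open>The total variation is at most the integral of the length of h, first on open sets by
  testing, then on Borel sets by outer regularity. Young's inequality trades this for the integral
  of the m-th power, at the cost of a multiple of the mass.\<close>

lemma curvature_density:
  assumes m: "1 < m" and z: "z \<in> U"
  obtains s k where "0 < s" "cball z s \<subseteq> U" "integrable \<mu> k" "\<And>x. 0 \<le> k x"
    "\<And>D e \<rho>. D \<in> sets \<mu> \<Longrightarrow> D \<subseteq> cball z (s / 2) \<Longrightarrow> 0 < e \<Longrightarrow> 0 < \<rho> \<Longrightarrow>
       \<rho> * measure \<beta> D \<le> e * measure \<mu> D + \<rho> ^ m / e ^ (m - 1) * (LINT x:D|\<mu>. k x)"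
proof -
  let ?h = "mean_curv U V"
  obtain s where s: "0 < s" "cball z s \<subseteq> U" using z open_U open_contains_cball by blast
  let ?K = "cball z s"
  have KM: "?K \<in> sets \<mu>" using s by (simp add: sets_weight_iff)
  have finK: "emeasure \<mu> ?K < \<infinity>" using s by (intro radon_onD(3)[OF radon_weight]) auto
  have "set_integrable (completion \<mu>) ?K (\<lambda>x. norm (?h x) ^ m)" using mean_curvature[OF m] s by auto
  then have i0: "integrable (completion \<mu>) (\<lambda>x. indicator ?K x * norm (?h x) ^ m)"
    by (simp add: set_integrable_def)
  \<comment> \<open>The curvature is measurable only for the completion. \<open>k\<close> becomes a
    nonnegative Borel function almost everywhere equal to the m-th power of its length on the ball
    and to 0 elsewhere.\<close>
  obtain k0 where k0: "k0 \<in> borel_measurable \<mu>" "AE x in \<mu>. indicator ?K x * norm (?h x) ^ m = k0 x"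
    using completion_ex_borel_measurable_real[OF borel_measurable_integrable[OF i0]] by blast
  define k where "k x = \<bar>k0 x\<bar>" for x
  have km[measurable]: "k \<in> borel_measurable \<mu>" using k0(1) unfolding k_def by measurable
  have kh: "AE x in \<mu>. indicator ?K x * norm (?h x) ^ m = k x"
    using k0(2)
  proof eventually_elim
    case (elim x)
    have "0 \<le> indicator ?K x * norm (?h x) ^ m" by simp
    then show ?case using elim by (simp add: k_def)
  qed
  have ki: "integrable \<mu> k"
  proof -
    have "integrable (completion \<mu>) k"
      by (rule integrable_cong_AE_imp[OF i0 measurable_completion[OF km]])
         (use AE_completion[OF kh] in \<open>eventually_elim, simp\<close>)
    then show ?thesis using integrable_completion[OF km] by simp
  qed
  define l where "l x = root m (k x)" for x
  have lm[measurable]: "l \<in> borel_measurable \<mu>" unfolding l_def by measurable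
  have l_pow: "l x ^ m = k x" "0 \<le> l x" for x using m by (auto simp: l_def k_def real_root_ge_zero)
  have l_h: "AE x in \<mu>. x \<in> ?K \<longrightarrow> norm (?h x) = l x"
    using kh
  proof eventually_elim
    case (elim x)
    show ?case
    proof
      assume "x \<in> ?K"
      then have "k x = norm (?h x) ^ m" using elim by simp
      then show "norm (?h x) = l x" using m by (simp add: l_def real_root_power_cancel)
    qed
  qed
  have lK: "integrable \<mu> (\<lambda>x. indicator ?K x * l x)"
  proof (rule Bochner_Integration.integrable_bound)
    show "integrable \<mu> (\<lambda>x. indicator ?K x + k x)" using ki finK KM by auto
    show "AE x in \<mu>. norm (indicator ?K x * l x) \<le> norm (indicator ?K x + k x)"
    proof (rule AE_I2)
      fix x
      have "l x \<le> 1 + k x" using young_ineq[of 1 "l x" m] l_pow[of x] m by simp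
      then show "norm (indicator ?K x * l x) \<le> norm (indicator ?K x + k x)"
        using l_pow(2)[of x] by (auto simp: indicator_def k_def)
    qed
  qed (use KM in measurable)
  have le_open: "emeasure \<beta> G \<le> ennreal (LINT x:G|\<mu>. l x)" if G: "open G" "G \<subseteq> ?K" for G
  proof -
    have GU: "G \<subseteq> U" using G s by blast
    have GM: "G \<in> sets \<mu>" using G GU by (simp add: sets_weight_iff)
    have lG: "integrable \<mu> (\<lambda>x. indicator G x * l x)"
    proof -
      have "(\<lambda>x. indicator G x *\<^sub>R (indicator ?K x * l x)) = (\<lambda>x. indicator G x * l x)"
        using G(2) by (intro ext) (auto simp: indicator_def)
      with integrable_mult_indicator[OF GM lK] show ?thesis by (simp only:)
    qed
    have nn: "0 \<le> (LINT x|\<mu>. indicator G x * l x)" using l_pow(2) by (intro Bochner_Integration.integral_nonneg) auto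
    have "open_var G \<le> ennreal (LINT x|\<mu>. indicator G x * l x)"
      unfolding open_var_def
    proof (rule SUP_least, clarify, rule ennreal_leI)
      fix g assume g: "g \<in> test_fields G" "\<forall>x. norm (g x) \<le> 1"
      have gU: "g \<in> test_fields U" using g(1) test_fields_mono[OF GU] by blast
      have fv: "first_var V g = - (LINT x|completion \<mu>. g x \<bullet> ?h x)" using mean_curvature[OF m] gU by blast
      \<comment> \<open>In the nonintegrable case the Bochner integral has the default value 0, and
        the bound is trivial.\<close>
      show "first_var V g \<le> (LINT x|\<mu>. indicator G x * l x)"
      proof (cases "integrable (completion \<mu>) (\<lambda>x. g x \<bullet> ?h x)")
        case True
        have "- (LINT x|completion \<mu>. g x \<bullet> ?h x) = (LINT x|completion \<mu>. - (g x \<bullet> ?h x))" by simp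
        also have "\<dots> \<le> (LINT x|completion \<mu>. indicator G x * l x)"
        proof (rule integral_mono_AE)
          show "integrable (completion \<mu>) (\<lambda>x. - (g x \<bullet> ?h x))" using True by simp
          show "integrable (completion \<mu>) (\<lambda>x. indicator G x * l x)" using lG by (subst integrable_completion) auto
          show "AE x in completion \<mu>. - (g x \<bullet> ?h x) \<le> indicator G x * l x"
            using AE_completion[OF l_h]
          proof eventually_elim
            case (elim x)
            show ?case
            proof (cases "x \<in> G")
              case True
              have "- (g x \<bullet> ?h x) \<le> norm (g x) * norm (?h x)"
                using Cauchy_Schwarz_ineq2[of "g x" "?h x"] by linarith
              also have "\<dots> \<le> 1 * norm (?h x)" using g(2) by (intro mult_right_mono) auto
              finally show ?thesis using True elim G(2) by auto
            next
              case False
              then have "g x = 0" using test_fieldsD(4)[OF g(1)] by blast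
              then show ?thesis using False by simp
            qed
          qed
        qed
        also have "\<dots> = (LINT x|\<mu>. indicator G x * l x)" using lG by (intro integral_completion) auto
        finally show ?thesis by (simp add: fv)
      next
        case False
        then show ?thesis using nn by (simp add: fv not_integrable_integral_eq)
      qed
    qed
    then show ?thesis using emeasure_var_open[OF G(1) GU] by (simp add: set_lebesgue_integral_def)
  qed
  \<comment> \<open>The length of h on the ball as a measure; it is Radon, so Borel sets can be
    approximated by open ones with respect to it.\<close>
  let ?L = "density \<mu> (\<lambda>x. ennreal (indicator ?K x * l x))"
  have eL: "emeasure ?L D = ennreal (LINT x:D \<inter> ?K|\<mu>. l x)" if D: "D \<in> sets \<mu>" for D
  proof -
    have iD: "integrable \<mu> (\<lambda>x. indicator D x * (indicator ?K x * l x))" using integrable_mult_indicator[OF D lK] by simp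
    have "emeasure ?L D = (\<integral>\<^sup>+x. ennreal (indicator ?K x * l x) * indicator D x \<partial>\<mu>)"
      by (rule emeasure_density[OF _ D]) (use borel_measurable_integrable[OF lK] in measurable)
    also have "\<dots> = (\<integral>\<^sup>+x. ennreal (indicator D x * (indicator ?K x * l x)) \<partial>\<mu>)"
      by (intro nn_integral_cong) (auto simp: indicator_def)
    also have "\<dots> = ennreal (LINT x|\<mu>. indicator D x * (indicator ?K x * l x))"
      using l_pow(2) by (intro nn_integral_eq_integral iD) auto
    also have "(LINT x|\<mu>. indicator D x * (indicator ?K x * l x)) = (LINT x:D \<inter> ?K|\<mu>. l x)"
      by (simp add: set_lebesgue_integral_def indicator_inter_arith mult.assoc)
    finally show ?thesis .
  qed
  have rL: "radon_on U ?L"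
    unfolding radon_on_def
  proof (intro conjI allI impI)
    show "sets ?L = sets (restrict_space borel U)" by (simp add: sets_weight)
    fix K assume "compact K \<and> K \<subseteq> U"
    then have "K \<in> sets \<mu>" by (auto simp: sets_weight_iff compact_imp_closed)
    then show "emeasure ?L K < \<infinity>" by (simp add: eL)
  qed
  have le: "measure \<beta> D \<le> (LINT x:D|\<mu>. l x)" if D: "D \<in> sets \<mu>" "D \<subseteq> cball z (s / 2)" for D
  proof (rule field_le_epsilon)
    fix e :: real assume e: "0 < e"
    \<comment> \<open>The half radius leaves room: intersecting the approximating open set with
      \<open>ball z s\<close> keeps it a superset of \<open>D\<close> and places it where
      \<open>le_open\<close> applies.\<close>
    have sub: "cball z (s / 2) \<subseteq> ball z s" using s by auto
    have DL: "D \<in> sets ?L" using D by simp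
    obtain W where W: "open W" "D \<subseteq> W" "W \<subseteq> U" "emeasure ?L W \<le> emeasure ?L D + ennreal e"
      by (rule radon_outer_approx[OF rL open_U compact_cball _ DL D(2) e]) (use sub s in auto)
    define G where "G = W \<inter> ball z s"
    have G: "open G" "G \<subseteq> ?K" "D \<subseteq> G" using W D(2) sub by (auto simp: G_def)
    have GW: "G \<in> sets \<mu>" "W \<in> sets \<mu>" using W G s by (auto simp: sets_weight_iff)
    have nn: "0 \<le> (LINT x:B|\<mu>. l x)" for B unfolding set_lebesgue_integral_def using l_pow(2)
      by (intro Bochner_Integration.integral_nonneg) auto
    have "emeasure \<beta> D \<le> emeasure \<beta> G" using G s by (intro emeasure_mono) (auto simp: sets_var_iff)
    also have "\<dots> \<le> ennreal (LINT x:G \<inter> ?K|\<mu>. l x)" using le_open[OF G(1,2)] G(2) by (simp add: Int_absorb2)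
    also have "\<dots> = emeasure ?L G" by (rule eL[OF GW(1), symmetric])
    also have "\<dots> \<le> emeasure ?L W" using GW by (intro emeasure_mono) (auto simp: G_def)
    also note W(4)
    also have "emeasure ?L D = ennreal (LINT x:D|\<mu>. l x)"
      using eL[OF D(1)] G by (simp add: Int_absorb2)
    also have "ennreal (LINT x:D|\<mu>. l x) + ennreal e = ennreal ((LINT x:D|\<mu>. l x) + e)"
      using nn e by simp
    finally have "emeasure \<beta> D \<le> ennreal ((LINT x:D|\<mu>. l x) + e)" .
    then have "ennreal (measure \<beta> D) \<le> ennreal ((LINT x:D|\<mu>. l x) + e)"
      by (metis emeasure_eq_ennreal_measure ennreal_neq_top top.extremum_uniqueI)
    then show "measure \<beta> D \<le> (LINT x:D|\<mu>. l x) + e" using nn[of D] e by (subst (asm) ennreal_le_iff) auto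
  qed
  show thesis
  proof (rule that[OF s ki])
    show "0 \<le> k x" for x by (simp add: k_def)
    fix D e \<rho> assume D: "D \<in> sets \<mu>" "D \<subseteq> cball z (s / 2)" and e: "0 < (e::real)" and \<rho>: "0 < (\<rho>::real)"
    have DK: "D \<subseteq> ?K" using D(2) s(1) by (intro order_trans[OF D(2)] subset_cball) auto
    have finD: "emeasure \<mu> D < \<infinity>" using emeasure_mono[OF DK KM] finK by (rule le_less_trans)
    have iD: "integrable \<mu> (\<lambda>x. indicator D x * l x)"
    proof -
      have "(\<lambda>x. indicator D x *\<^sub>R (indicator ?K x * l x)) = (\<lambda>x. indicator D x * l x)"
        using DK by (intro ext) (auto simp: indicator_def)
      with integrable_mult_indicator[OF D(1) lK] show ?thesis by (simp only:)
    qed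
    have kD: "integrable \<mu> (\<lambda>x. indicator D x * k x)" using integrable_mult_indicator[OF D(1) ki] by simp
    have "\<rho> * measure \<beta> D \<le> \<rho> * (LINT x|\<mu>. indicator D x * l x)"
      using le[OF D] \<rho> by (intro mult_left_mono) (auto simp: set_lebesgue_integral_def)
    also have "\<dots> = (LINT x|\<mu>. \<rho> * (indicator D x * l x))" by simp
    also have "\<dots> \<le> (LINT x|\<mu>. e * indicator D x + \<rho> ^ m / e ^ (m - 1) * (indicator D x * k x))"
    proof (rule integral_mono)
      show "integrable \<mu> (\<lambda>x. \<rho> * (indicator D x * l x))" using iD by (rule integrable_mult_right)
      show "integrable \<mu> (\<lambda>x. e * indicator D x + \<rho> ^ m / e ^ (m - 1) * (indicator D x * k x))"
        using kD D(1) finD by (intro Bochner_Integration.integrable_add integrable_mult_right integrable_real_indicator) auto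
      fix x
      have "\<rho> * l x \<le> e + (\<rho> * l x) ^ m / e ^ (m - 1)"
        using young_ineq[of e "\<rho> * l x" m] e \<rho> l_pow(2)[of x] m by simp
      also have "(\<rho> * l x) ^ m = \<rho> ^ m * k x" by (simp add: power_mult_distrib l_pow(1))
      finally show "\<rho> * (indicator D x * l x) \<le> e * indicator D x + \<rho> ^ m / e ^ (m - 1) * (indicator D x * k x)"
        by (simp add: indicator_def)
    qed
    also have "\<dots> = e * measure \<mu> D + \<rho> ^ m / e ^ (m - 1) * (LINT x|\<mu>. indicator D x * k x)"
      using kD D(1) finD by (subst Bochner_Integration.integral_add) auto
    finally show "\<rho> * measure \<beta> D \<le> e * measure \<mu> D + \<rho> ^ m / e ^ (m - 1) * (LINT x:D|\<mu>. k x)"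
      by (simp add: set_lebesgue_integral_def)
  qed
qed

text \<open>The radius is fixed before the set \<open>A\<close>. As \<open>A\<close> misses
  \<open>z\<close>, only the punctured ball matters, and there the variation (for m = 1) or the
  integral of \<open>k\<close> (for m > 1) is small.\<close>

lemma small_variation:
  assumes z: "z \<in> U" and c: "0 < c" and b: "0 < b"
  obtains R where "0 < R" "cball z R \<subseteq> U"
    "\<And>A r \<rho>. A \<in> sets \<mu> \<Longrightarrow> z \<notin> A \<Longrightarrow> 0 < r \<Longrightarrow> r \<le> R \<Longrightarrow> 0 < \<rho> \<Longrightarrow>
      \<rho> ^ m = b * measure \<mu> (cball z r \<inter> A) \<Longrightarrow> \<rho> * measure \<beta> (cball z r \<inter> A) \<le> c * measure \<mu> (cball z r \<inter> A)"
proof (cases "m = 1")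
  case True
  \<comment> \<open>For m = 1 the number \<rho> is b times the mass, so a variation below c/b is
    enough.\<close>
  have "0 < c / b" using c b by simp
  then obtain R where R: "0 < R" "cball z R \<subseteq> U" "measure \<beta> (cball z R - {z}) < c / b"
    using shrinking_punctured_ball[OF radon_on_var open_U z, of "c / b" 1] by auto
  show thesis
  proof (rule that[OF R(1,2)])
    fix A r \<rho> assume A: "A \<in> sets \<mu>" "z \<notin> A" and r: "0 < r" "r \<le> R" and \<rho>: "0 < (\<rho>::real)"
      and eq: "\<rho> ^ m = b * measure \<mu> (cball z r \<inter> A)"
    have sub: "cball z r \<inter> A \<subseteq> cball z R - {z}" using A(2) r by auto
    have RB: "cball z R \<in> sets \<beta>" "cball z R - {z} \<in> sets \<beta>" using R(2) by (auto simp: sets_var_iff)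
    have "emeasure \<beta> (cball z R - {z}) < \<infinity>"
      using emeasure_mono[of "cball z R - {z}" "cball z R" \<beta>] RB radon_onD(3)[OF radon_on_var compact_cball R(2)]
      by (auto intro: le_less_trans)
    then have "measure \<beta> (cball z r \<inter> A) \<le> measure \<beta> (cball z R - {z})"
      using sub A(1) RB r R(2) by (intro measure_mono_fmeasurable) (auto simp: fmeasurable_def sets_var_iff sets_weight_iff)
    then have "measure \<beta> (cball z r \<inter> A) \<le> c / b" using R(3) by simp
    then have "\<rho> * measure \<beta> (cball z r \<inter> A) \<le> \<rho> * (c / b)" using \<rho> by (intro mult_left_mono) auto
    also have "\<dots> = c * measure \<mu> (cball z r \<inter> A)" using eq b True by simp
    finally show "\<rho> * measure \<beta> (cball z r \<inter> A) \<le> c * measure \<mu> (cball z r \<inter> A)" .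
  qed
next
  case False
  then have m: "1 < m" using m_pos by simp
  obtain s k where s: "0 < s" "cball z s \<subseteq> U" and k: "integrable \<mu> k" "\<And>x. 0 \<le> k x"
    and bound: "\<And>D e \<rho>. D \<in> sets \<mu> \<Longrightarrow> D \<subseteq> cball z (s / 2) \<Longrightarrow> 0 < e \<Longrightarrow> 0 < \<rho> \<Longrightarrow>
       \<rho> * measure \<beta> D \<le> e * measure \<mu> D + \<rho> ^ m / e ^ (m - 1) * (LINT x:D|\<mu>. k x)"
    using curvature_density[OF m z] by metis
  \<comment> \<open>One half of \<open>c\<close> pays for the mass term of Young's inequality. The
    bound \<open>d\<close> is chosen so that, with \<open>\<rho> ^ m\<close> equal to b times the
    mass, the other term is at most \<open>e\<close> times the mass as well.\<close>
  define e where "e = c / 2"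
  have e: "0 < e" using c by (simp add: e_def)
  define d where "d = e * e ^ (m - 1) / b"
  have d: "0 < d" using e b by (simp add: d_def)
  let ?N = "density \<mu> (\<lambda>x. ennreal (k x))"
  have km[measurable]: "k \<in> borel_measurable \<mu>" using k(1) by auto
  have eN: "emeasure ?N D = ennreal (LINT x:D|\<mu>. k x)" if D: "D \<in> sets \<mu>" for D
  proof -
    have iD: "integrable \<mu> (\<lambda>x. indicator D x * k x)" using integrable_mult_indicator[OF D k(1)] by simp
    have "emeasure ?N D = (\<integral>\<^sup>+x. ennreal (indicator D x * k x) \<partial>\<mu>)"
      using D by (subst emeasure_density) (auto intro!: nn_integral_cong simp: indicator_def)
    also have "\<dots> = ennreal (LINT x|\<mu>. indicator D x * k x)"
      using k(2) by (intro nn_integral_eq_integral iD) auto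
    finally show ?thesis by (simp add: set_lebesgue_integral_def)
  qed
  have rN: "radon_on U ?N"
    unfolding radon_on_def
  proof (intro conjI allI impI)
    show "sets ?N = sets (restrict_space borel U)" by (simp add: sets_weight)
    fix K assume "compact K \<and> K \<subseteq> U"
    then have "K \<in> sets \<mu>" by (auto simp: sets_weight_iff compact_imp_closed)
    then show "emeasure ?N K < \<infinity>" by (simp add: eN)
  qed
  obtain R where R: "0 < R" "R < s / 2" "cball z R \<subseteq> U" "measure ?N (cball z R - {z}) < d"
    using shrinking_punctured_ball[OF rN open_U z d, of "s / 2"] s(1) by auto
  show thesis
  proof (rule that[OF R(1,3)])
    fix A r \<rho> assume A: "A \<in> sets \<mu>" "z \<notin> A" and r: "0 < r" "r \<le> R" and \<rho>: "0 < (\<rho>::real)"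
      and eq: "\<rho> ^ m = b * measure \<mu> (cball z r \<inter> A)"
    let ?D = "cball z r \<inter> A"
    have D: "?D \<in> sets \<mu>" using A(1) by (auto simp: sets_weight_iff)
    have RM: "cball z R - {z} \<in> sets \<mu>" using R(3) by (auto simp: sets_weight_iff)
    have nn: "0 \<le> (LINT x:B|\<mu>. k x)" for B unfolding set_lebesgue_integral_def using k(2)
      by (intro Bochner_Integration.integral_nonneg) auto
    have "measure ?N ?D \<le> measure ?N (cball z R - {z})"
      using A(2) r D RM eN[OF RM] by (intro measure_mono_fmeasurable) (auto simp: fmeasurable_def)
    then have I: "(LINT x:?D|\<mu>. k x) \<le> d"
      using R(4) eN[OF D] nn[of ?D] by (simp add: measure_def)
    have "\<rho> * measure \<beta> ?D \<le> e * measure \<mu> ?D + \<rho> ^ m / e ^ (m - 1) * (LINT x:?D|\<mu>. k x)"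
      using r R(2) by (intro bound D e \<rho>) auto
    also have "\<dots> \<le> e * measure \<mu> ?D + \<rho> ^ m / e ^ (m - 1) * d"
      using I e \<rho> by (intro add_left_mono mult_left_mono) auto
    also have "\<rho> ^ m / e ^ (m - 1) * d = e * measure \<mu> ?D" using e b by (simp add: eq d_def)
    finally show "\<rho> * measure \<beta> ?D \<le> c * measure \<mu> ?D" by (simp add: e_def)
  qed
qed

text \<open>The set \<open>A\<close> must avoid \<open>z\<close> since for \<open>m = 1\<close> the first variation may have an atom at \<open>z\<close>.\<close>

theorem local_mass_bound:
  assumes z: "z \<in> U"
  obtains R \<epsilon> where "0 < R" "cball z R \<subseteq> U" "0 < \<epsilon>"
    "\<And>A. A \<in> sets \<mu> \<Longrightarrow> z \<notin> A \<Longrightarrow>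
      (\<And>g. g \<in> test_fields U \<Longrightarrow> first_var (restr_varifold m V A) g \<le> (LINT x:A|\<beta>. norm (g x))) \<Longrightarrow>
      measure \<mu> (cball z R \<inter> A) < \<epsilon> \<Longrightarrow> measure \<mu> (cball z (R / 2) \<inter> A) = 0"
proof -
  define \<kappa> where "\<kappa> = unit_ball_vol (real m) / (4 * 5 ^ m)"
  have \<kappa>: "0 < \<kappa>" by (simp add: \<kappa>_def unit_ball_vol_pos)
  \<comment> \<open>The constants \<open>c\<close>, \<open>b\<close> and \<open>\<epsilon>\<close>
    are the hypotheses \<open>small\<close> and \<open>mass\<close> of
    \<open>small_mass_vanishes\<close> solved for the variation, for \<open>\<rho> ^ m\<close> and
    for the mass.\<close>
  define c where "c = (1 / 2) ^ m / (18 * 10 ^ m :: real)"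
  define b where "b = 54 * 2 ^ m / \<kappa>"
  have c: "0 < c" and b: "0 < b" using \<kappa> by (auto simp: c_def b_def)
  obtain R where R: "0 < R" "cball z R \<subseteq> U"
    and small: "\<And>A r \<rho>. A \<in> sets \<mu> \<Longrightarrow> z \<notin> A \<Longrightarrow> 0 < r \<Longrightarrow> r \<le> R \<Longrightarrow> 0 < \<rho> \<Longrightarrow>
      \<rho> ^ m = b * measure \<mu> (cball z r \<inter> A) \<Longrightarrow> \<rho> * measure \<beta> (cball z r \<inter> A) \<le> c * measure \<mu> (cball z r \<inter> A)"
    using small_variation[OF z c b] by metis
  define \<epsilon> where "\<epsilon> = \<kappa> * R ^ m / (54 * 48 ^ m)"
  show thesis
  proof (rule that[OF R])
    show "0 < \<epsilon>" using \<kappa> R by (simp add: \<epsilon>_def)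
    fix A assume A: "A \<in> sets \<mu>" "z \<notin> A"
      and fv: "\<And>g. g \<in> test_fields U \<Longrightarrow> first_var (restr_varifold m V A) g \<le> (LINT x:A|\<beta>. norm (g x))"
      and mass: "measure \<mu> (cball z R \<inter> A) < \<epsilon>"
    let ?W = "restr_varifold m V A"
    let ?\<nu> = "density \<beta> (indicator A)"
    have AB: "A \<in> sets \<beta>" using A(1) sets_eq by simp
    have e\<nu>: "emeasure ?\<nu> D = emeasure \<beta> (D \<inter> A)" if "D \<in> sets \<beta>" for D
      using that AB by (subst emeasure_density) (auto simp: indicator_inter_arith[symmetric] Int_commute)
    have m\<nu>: "measure ?\<nu> D = measure \<beta> (D \<inter> A)" if "D \<in> sets \<beta>" for D
      using e\<nu>[OF that] by (simp add: measure_def)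
    interpret W: open_varifold U m ?W by (rule open_varifold_restr[OF A(1)])
    have mW: "measure W.\<mu> D = measure \<mu> (D \<inter> A)" if "D \<in> sets \<mu>" for D
      using emeasure_weight_restr[OF A(1) that] by (simp add: measure_def)
    interpret W: mass_bound U m ?W ?\<nu>
    proof
      show "radon_on U ?\<nu>"
        unfolding radon_on_def
      proof (intro conjI allI impI)
        show "sets ?\<nu> = sets (restrict_space borel U)" by (simp add: sets_var)
        fix K assume K: "compact K \<and> K \<subseteq> U"
        then have KB: "K \<in> sets \<beta>" by (intro compact_sets_var) auto
        have "emeasure ?\<nu> K \<le> emeasure \<beta> K" unfolding e\<nu>[OF KB] using KB by (intro emeasure_mono) auto
        also have "\<dots> < \<infinity>" using K by (intro radon_onD(3)[OF radon_on_var]) auto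
        finally show "emeasure ?\<nu> K < \<infinity>" .
      qed
      fix x r g assume B: "cball x r \<subseteq> U" "0 < r" and g: "g \<in> test_fields U" "\<And>y. norm (g y) \<le> r * indicator (cball x r) y"
      have BB: "cball x r \<in> sets \<beta>" "cball x r \<inter> A \<in> sets \<beta>" using B AB by (auto simp: sets_var_iff)
      have fin: "emeasure \<beta> (cball x r \<inter> A) < \<infinity>"
        using emeasure_mono[of "cball x r \<inter> A" "cball x r" \<beta>] BB radon_onD(3)[OF radon_on_var compact_cball B(1)]
        by (auto intro: le_less_trans)
      have "first_var ?W g \<le> (LINT y|\<beta>. indicator A y * norm (g y))" using fv[OF g(1)] by (simp add: set_lebesgue_integral_def)
      also have "\<dots> \<le> (LINT y|\<beta>. r * indicator (cball x r \<inter> A) y)"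
      proof (rule integral_mono')
        show "integrable \<beta> (\<lambda>y. r * indicator (cball x r \<inter> A) y)" using BB fin by auto
        show "indicator A y * norm (g y) \<le> r * indicator (cball x r \<inter> A) y" for y
          using g(2)[of y] by (auto simp: indicator_def)
        show "0 \<le> r * indicator (cball x r \<inter> A) y" for y using B(2) by simp
      qed
      also have "\<dots> = r * measure ?\<nu> (cball x r)" using BB m\<nu> by simp
      finally show "first_var ?W g \<le> r * measure ?\<nu> (cball x r)" .
    qed
    have thick: "AE x in W.\<mu>. x \<in> cball z R \<longrightarrow> thick m W.\<mu> \<kappa> x"
    proof -
      have "AE x in \<mu>. x \<in> A \<longrightarrow> (\<forall>e>0. \<exists>t. 0 < t \<and> t < e \<and> \<kappa> * t ^ m \<le> measure \<mu> (A \<inter> cball x t))"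
        unfolding \<kappa>_def by (rule AE_thick_subset[OF radon_weight open_U density_ge_1 A(1)])
      then obtain N where N: "N \<in> null_sets \<mu>"
        "{x \<in> space \<mu>. \<not> (x \<in> A \<longrightarrow> (\<forall>e>0. \<exists>t. 0 < t \<and> t < e \<and> \<kappa> * t ^ m \<le> measure \<mu> (A \<inter> cball x t)))} \<subseteq> N"
        unfolding eventually_ae_filter by blast
      have N2: "\<exists>t. 0 < t \<and> t < e \<and> \<kappa> * t ^ m \<le> measure \<mu> (A \<inter> cball x t)" if "x \<in> U" "x \<in> A" "x \<notin> N" "0 < e" for x e
        using N(2) that by (auto simp: space_weight)
      \<comment> \<open>The weight of the restriction lives on \<open>A\<close>, so the complement
        of \<open>A\<close> may be discarded together with \<open>N\<close>.\<close>
      have "N \<union> (U - A) \<in> null_sets W.\<mu>"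
      proof -
        have s: "N \<union> (U - A) \<in> sets \<mu>" "N \<in> sets \<mu>" using N(1) A(1) open_U by (auto simp: sets_weight_iff null_sets_def)
        have "emeasure W.\<mu> (N \<union> (U - A)) = emeasure \<mu> ((N \<union> (U - A)) \<inter> A)" by (rule emeasure_weight_restr[OF A(1) s(1)])
        also have "\<dots> \<le> emeasure \<mu> N" using s by (intro emeasure_mono) auto
        also have "\<dots> = 0" using N(1) by auto
        finally show ?thesis using s by (auto simp: null_sets_def W.sets_weight sets_weight)
      qed
      then show ?thesis
      proof (rule AE_I'[of "N \<union> (U - A)"], intro subsetI)
        fix x assume x: "x \<in> {x \<in> space W.\<mu>. \<not> (x \<in> cball z R \<longrightarrow> thick m W.\<mu> \<kappa> x)}"
        show "x \<in> N \<union> (U - A)"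
        proof (rule ccontr)
          assume n: "x \<notin> N \<union> (U - A)"
          then have xU: "x \<in> U" "x \<in> A" "x \<notin> N" using x by (auto simp: W.space_weight)
          obtain s where s: "0 < s" "cball x s \<subseteq> U" using xU(1) open_U open_contains_cball by blast
          have "thick m W.\<mu> \<kappa> x"
            unfolding thick_def
          proof (intro allI impI)
            fix e :: real assume "0 < e"
            then have "0 < min e s" using s by simp
            then obtain t where t: "0 < t" "t < min e s" "\<kappa> * t ^ m \<le> measure \<mu> (A \<inter> cball x t)"
              using N2[OF xU] by blast
            have "cball x t \<subseteq> U" using t(2) by (intro order_trans[OF subset_cball s(2)]) simp
            then have "measure W.\<mu> (cball x t) = measure \<mu> (A \<inter> cball x t)"
              by (subst mW) (auto simp: sets_weight_iff Int_commute)
            then show "\<exists>t. 0 < t \<and> t < e \<and> \<kappa> * t ^ m \<le> measure W.\<mu> (cball x t)" using t by (intro exI[of _ t]) auto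
          qed
          then show False using x by simp
        qed
      qed
    qed
    have cs: "cball z r \<in> sets \<mu>" if "r \<le> R" for r
      using order_trans[OF subset_cball[OF that] R(2)] by (simp add: sets_weight_iff)
    have "measure W.\<mu> (cball z (R / 2)) = 0"
    proof (rule W.small_mass_vanishes[OF R m_pos \<kappa> thick])
      show "54 * 48 ^ m * measure W.\<mu> (cball z R) \<le> \<kappa> * R ^ m"
        using mass mW[OF cs[OF order_refl]] by (simp add: \<epsilon>_def field_simps)
      fix r \<rho> :: real assume r: "0 < r" "r \<le> R" and \<rho>: "0 < \<rho>"
        and eq: "\<kappa> * \<rho> ^ m = 54 * 2 ^ m * measure W.\<mu> (cball z r)"
      have csb: "cball z r \<in> sets \<beta>" using cs[OF r(2)] sets_eq by simp
      have "\<rho> ^ m = b * measure \<mu> (cball z r \<inter> A)"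
        using eq mW[OF cs[OF r(2)]] \<kappa> by (simp add: b_def field_simps)
      from small[OF A r \<rho> this]
      have "18 * 10 ^ m * (\<rho> * measure \<beta> (cball z r \<inter> A)) \<le> 18 * 10 ^ m * (c * measure \<mu> (cball z r \<inter> A))"
        by (rule mult_left_mono) simp
      also have "\<dots> = (1 / 2) ^ m * measure \<mu> (cball z r \<inter> A)" by (simp add: c_def)
      finally show "18 * 10 ^ m * \<rho> * measure ?\<nu> (cball z r) \<le> measure W.\<mu> (cball z r) * (1 / 2) ^ m"
        using mW[OF cs[OF r(2)]] m\<nu>[OF csb] by (simp add: mult_ac)
    qed
    then show "measure \<mu> (cball z (R / 2) \<inter> A) = 0" using mW[OF cs, of "R / 2"] R by simp
  qed
qed

end

section \<open>Connected components of the support\<close>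

definition clopen_in :: "'a::topological_space set \<Rightarrow> 'a set \<Rightarrow> bool" where
  "clopen_in S E \<longleftrightarrow> openin (top_of_set S) E \<and> closedin (top_of_set S) E"

lemma clopen_in_Int: "clopen_in S E \<Longrightarrow> clopen_in S T \<Longrightarrow> clopen_in S (E \<inter> T)"
  and clopen_in_diff: "clopen_in S E \<Longrightarrow> clopen_in S T \<Longrightarrow> clopen_in S (E - T)"
  and clopen_in_self: "clopen_in S S"
  by (auto simp: clopen_in_def openin_diff closedin_diff)

lemma clopen_in_Union: "finite F \<Longrightarrow> (\<And>E. E \<in> F \<Longrightarrow> clopen_in S E) \<Longrightarrow> clopen_in S (\<Union>F)"
  by (auto simp: clopen_in_def intro!: closedin_Union)

text \<open>The quasi-component of z. It is used in place of the component because it is described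
  by clopen sets, to which \<open>clopen_zero_boundary\<close> applies.\<close>

definition quasi_comp :: "'a::topological_space set \<Rightarrow> 'a \<Rightarrow> 'a set" where
  "quasi_comp S z = \<Inter>{E. clopen_in S E \<and> z \<in> E}"

lemma quasi_comp_mem: "z \<in> quasi_comp S z"
  by (simp add: quasi_comp_def)

lemma quasi_comp_subset: "clopen_in S E \<Longrightarrow> z \<in> E \<Longrightarrow> quasi_comp S z \<subseteq> E"
  by (auto simp: quasi_comp_def)

lemma quasi_comp_antimono:
  assumes w: "w \<in> quasi_comp S z" shows "quasi_comp S w \<subseteq> quasi_comp S z"
  using w by (auto simp: quasi_comp_def)

text \<open>In a disjoint clopen family of maximal size meeting \<open>W\<close>, the member at \<open>z\<close> cannot be split within \<open>W\<close>.\<close>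

lemma quasi_comp_nhd:
  fixes S :: "'a::topological_space set"
  assumes z: "z \<in> S" "z \<in> W" "open W"
    and bound: "\<And>F. finite F \<Longrightarrow> disjoint F \<Longrightarrow> (\<And>E. E \<in> F \<Longrightarrow> clopen_in S E \<and> E \<inter> W \<noteq> {}) \<Longrightarrow> card F \<le> N"
  obtains T where "open T" "z \<in> T" "S \<inter> T \<subseteq> quasi_comp S z"
proof -
  define P where "P F \<longleftrightarrow> finite F \<and> disjoint F \<and> (\<forall>E\<in>F. clopen_in S E \<and> E \<inter> W \<noteq> {})" for F
  have "P {}" by (simp add: P_def)
  moreover have "\<forall>F. P F \<longrightarrow> card F < Suc N" unfolding P_def less_Suc_eq_le using bound by blast
  ultimately have "\<exists>F. P F \<and> (\<forall>F'. P F' \<longrightarrow> card F' \<le> card F)" by (rule ex_has_greatest_nat)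
  then obtain F where "P F" and max: "\<And>F'. P F' \<Longrightarrow> card F' \<le> card F" by blast
  then have F: "finite F" "disjoint F" "\<And>E. E \<in> F \<Longrightarrow> clopen_in S E \<and> E \<inter> W \<noteq> {}" by (auto simp: P_def)
  have "z \<in> \<Union>F"
  proof (rule ccontr)
    assume n: "z \<notin> \<Union>F"
    \<comment> \<open>If z were left out, the rest of \<open>S\<close> would be a further clopen set
      meeting \<open>W\<close>, against maximality.\<close>
    let ?E = "S - \<Union>F"
    have E: "clopen_in S ?E" "?E \<inter> W \<noteq> {}"
      using n z F(3) by (auto intro!: clopen_in_diff clopen_in_self clopen_in_Union F(1))
    have "?E \<notin> F" using n z by blast
    moreover have "disjoint (insert ?E F)" using F(2) by (auto simp: disjoint_def)
    then have "P (insert ?E F)" unfolding P_def using F(1,3) E by blast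
    ultimately show False using max[of "insert ?E F"] F(1) by simp
  qed
  then obtain E0 where E0: "E0 \<in> F" "z \<in> E0" by blast
  have "openin (top_of_set S) E0" using F(3)[OF E0(1)] by (simp add: clopen_in_def)
  then obtain T0 where T0: "open T0" "E0 = S \<inter> T0" unfolding openin_open by blast
  show thesis
  proof
    show "open (T0 \<inter> W)" "z \<in> T0 \<inter> W" using T0 E0 z by auto
    show "S \<inter> (T0 \<inter> W) \<subseteq> quasi_comp S z"
      unfolding quasi_comp_def
    proof (intro subsetI InterI, clarify, rule ccontr)
      fix w E assume w: "w \<in> S" "w \<in> T0" "w \<in> W" and E: "clopen_in S E" "z \<in> E" "w \<notin> E"
      \<comment> \<open>Splitting \<open>E0\<close> along \<open>E\<close> gives one more member;
        both halves meet \<open>W\<close>, the first in z and the second in w.\<close>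
      let ?F = "insert (E0 \<inter> E) (insert (E0 - E) (F - {E0}))"
      have cl: "clopen_in S (E0 \<inter> E)" "clopen_in S (E0 - E)"
        using F(3)[OF E0(1)] E(1) by (auto intro: clopen_in_Int clopen_in_diff)
      have w0: "w \<in> E0 - E" "z \<in> E0 \<inter> E" using w E E0 T0 by auto
      have dis: "X \<inter> Y = {}" if "X \<in> F" "Y \<in> F" "X \<noteq> Y" for X Y using F(2) that by (auto simp: disjoint_def)
      have new: "E0 \<inter> E \<notin> F - {E0}" "E0 - E \<notin> F - {E0}" "E0 \<inter> E \<noteq> E0 - E"
        using dis[OF E0(1)] w0 by blast+
      have "disjoint ?F"
        unfolding disjoint_def using dis dis[OF E0(1)] by blast
      moreover have "card ?F = Suc (card F)"
      proof -
        have "card (insert A (insert B F1)) = Suc (Suc (card F1))"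
          if "A \<notin> F1" "B \<notin> F1" "A \<noteq> B" "finite F1" for A B :: "'a set" and F1 using that by simp
        from this[OF new] have "card ?F = Suc (Suc (card (F - {E0})))" using F(1) by blast
        then show ?thesis unfolding card_Suc_Diff1[OF F(1) E0(1)] .
      qed
      moreover have "(E0 \<inter> E) \<inter> W \<noteq> {}" "(E0 - E) \<inter> W \<noteq> {}" using w0 w z by blast+
      ultimately have "P ?F" unfolding P_def using F(1,3) cl by blast
      then show False using max[of ?F] \<open>card ?F = Suc (card F)\<close> by simp
    qed
  qed
qed

text \<open>Quasi-components are always closed; openness makes them clopen. A clopen subset of a
  clopen quasi-component is clopen in \<open>S\<close>, so it or its complement contains z and is
  the whole: quasi-components are connected and thus lie inside components.\<close>

lemma openin_components_of_bounded:
  fixes S :: "'a::metric_space set"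
  assumes bound: "\<And>z. z \<in> S \<Longrightarrow> \<exists>W N. open W \<and> z \<in> W \<and>
      (\<forall>F. finite F \<longrightarrow> disjoint F \<longrightarrow> (\<forall>E\<in>F. clopen_in S E \<and> E \<inter> W \<noteq> {}) \<longrightarrow> card F \<le> (N::nat))"
    and C: "C \<in> components S"
  shows "openin (top_of_set S) C"
proof -
  have nhd: "\<exists>T. open T \<and> z \<in> T \<and> S \<inter> T \<subseteq> quasi_comp S z" if zS: "z \<in> S" for z
  proof -
    obtain W N where W: "open W" "z \<in> W"
      "\<forall>F. finite F \<longrightarrow> disjoint F \<longrightarrow> (\<forall>E\<in>F. clopen_in S E \<and> E \<inter> W \<noteq> {}) \<longrightarrow> card F \<le> (N::nat)"
      using bound[OF zS] by blast
    have b: "card F \<le> N" if "finite F" "disjoint F" "\<And>E. E \<in> F \<Longrightarrow> clopen_in S E \<and> E \<inter> W \<noteq> {}" for F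
      using W(3)[THEN spec, THEN mp, THEN mp, THEN mp, OF that(1,2)] that(3) by simp
    obtain T where "open T" "z \<in> T" "S \<inter> T \<subseteq> quasi_comp S z"
      by (rule quasi_comp_nhd[OF zS W(2,1) b])
    then show ?thesis by blast
  qed
  have sub: "quasi_comp S z \<subseteq> S" if "z \<in> S" for z by (rule quasi_comp_subset[OF clopen_in_self that])
  have op: "openin (top_of_set S) (quasi_comp S z)" if z: "z \<in> S" for z
  proof (subst openin_subopen, intro ballI)
    fix w assume w: "w \<in> quasi_comp S z"
    then obtain T where T: "open T" "w \<in> T" "S \<inter> T \<subseteq> quasi_comp S w" using nhd sub[OF z] by blast
    show "\<exists>T. openin (top_of_set S) T \<and> w \<in> T \<and> T \<subseteq> quasi_comp S z"
      using T w sub[OF z] quasi_comp_antimono[OF w] by (intro exI[of _ "S \<inter> T"]) (auto intro: openin_open_Int)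
  qed
  have cl: "clopen_in S (quasi_comp S z)" if z: "z \<in> S" for z
    using op[OF z] clopen_in_self[of S] z unfolding clopen_in_def quasi_comp_def
    by (intro conjI closedin_Inter) auto
  have conn: "connected (quasi_comp S z)" if z: "z \<in> S" for z
    unfolding connected_clopen
  proof (intro allI impI)
    let ?Q = "quasi_comp S z"
    fix T assume T: "openin (top_of_set ?Q) T \<and> closedin (top_of_set ?Q) T"
    then have clT: "clopen_in S T"
      using cl[OF z] unfolding clopen_in_def by (meson openin_trans closedin_trans)
    have TQ: "T \<subseteq> ?Q" using T openin_imp_subset by blast
    show "T = {} \<or> T = ?Q"
    proof (cases "z \<in> T")
      case True
      then show ?thesis using quasi_comp_subset[OF clT] TQ by blast
    next
      case False
      then have "?Q \<subseteq> ?Q - T"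
        by (intro quasi_comp_subset clopen_in_diff cl[OF z] clT) (simp add: quasi_comp_mem)
      then show ?thesis using TQ by blast
    qed
  qed
  show ?thesis
  proof (subst openin_subopen, intro ballI)
    fix z assume z: "z \<in> C"
    then have zS: "z \<in> S" using in_components_subset[OF C] by blast
    have "quasi_comp S z \<subseteq> C"
      using quasi_comp_mem[of z S] z by (intro components_maximal[OF C conn[OF zS] sub[OF zS]]) blast
    then show "\<exists>T. openin (top_of_set S) T \<and> z \<in> T \<and> T \<subseteq> C"
      using op[OF zS] quasi_comp_mem[of z S] by blast
  qed
qed

section \<open>Application to the support and to decompositions\<close>

lemma decomposition_has_sum:
  fixes f :: "(real^'n::finite) \<times> 'n subsp \<Rightarrow> real"
  assumes "decomposition U m V G" and f: "continuous_on (U \<times> Grass m) f"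
    and K: "compact K" "K \<subseteq> U \<times> Grass m" "\<And>p. p \<in> U \<times> Grass m - K \<Longrightarrow> f p = 0"
  shows "((\<lambda>X. LINT p|X. f p) has_sum (LINT p|V. f p)) G"
proof -
  have K': "\<exists>K. compact K \<and> K \<subseteq> U \<times> Grass m \<and> (\<forall>p\<in>U \<times> Grass m - K. f p = 0)"
    using K by (intro exI[of _ K]) simp
  show ?thesis
    by (rule assms(1)[unfolded decomposition_def, THEN conjunct2, THEN conjunct2, rule_format, OF conjI[OF f K']])
qed

context open_varifold
begin

text \<open>A relatively open piece of the support differs from an open set only by points off the
  support, which form a null set.\<close>

lemma openin_spt_positive:
  assumes E: "openin (top_of_set (spt U \<mu>)) E" and W: "open W" "W \<subseteq> U" "E \<inter> W \<noteq> {}"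
  shows "emeasure \<mu> (W \<inter> E) \<noteq> 0"
proof
  assume 0: "emeasure \<mu> (W \<inter> E) = 0"
  obtain T where T: "open T" "E = spt U \<mu> \<inter> T" using E by (auto simp: openin_open)
  obtain z where z: "z \<in> E" "z \<in> W" using W(3) by blast
  have s: "W \<inter> E \<in> sets \<mu>" "U - spt U \<mu> \<in> sets \<mu>"
    using T W spt_null(4) spt_null(1) by (auto simp: sets_weight_iff null_sets_def)
  have "emeasure \<mu> (W \<inter> T) \<le> emeasure \<mu> ((W \<inter> E) \<union> (U - spt U \<mu>))"
    using T W s by (intro emeasure_mono) auto
  also have "\<dots> \<le> emeasure \<mu> (W \<inter> E) + emeasure \<mu> (U - spt U \<mu>)" by (rule emeasure_subadditive[OF s])
  also have "\<dots> = 0" using 0 spt_null(1) by (auto simp: null_sets_def)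
  finally have "emeasure \<mu> (W \<inter> T) = 0" by simp
  then show False using z T W by (auto simp: spt_iff)
qed

end

context radon_varifold
begin

text \<open>Both parts of a nontrivial clopen splitting are relatively open in the support and so
  have positive weight, while the boundary of either part vanishes.\<close>

lemma connected_spt:
  assumes ind: "indecomposable U m V"
  shows "connected (spt U \<mu>)"
  unfolding connected_clopen
proof (intro allI impI, rule ccontr)
  let ?S = "spt U \<mu>"
  fix T assume T: "openin (top_of_set ?S) T \<and> closedin (top_of_set ?S) T" and n: "\<not> (T = {} \<or> T = ?S)"
  have zb: "zero_boundary U m V T" "T \<in> sets \<mu>" using clopen_zero_boundary T by auto
  have op: "openin (top_of_set ?S) (?S - T)" using T by auto
  have TS: "T \<subseteq> ?S" using T openin_imp_subset by blast
  have "U \<inter> T \<noteq> {}" "U \<inter> (?S - T) \<noteq> {}" using n TS spt_null(3) by auto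
  then have "T \<inter> U \<noteq> {}" "(?S - T) \<inter> U \<noteq> {}" by blast+
  then have "emeasure \<mu> (U \<inter> T) \<noteq> 0" "emeasure \<mu> (U \<inter> (?S - T)) \<noteq> 0"
    using openin_spt_positive[OF conjunct1[OF T] open_U] openin_spt_positive[OF op open_U] by blast+
  moreover have "U \<inter> T = T" "U \<inter> (?S - T) \<subseteq> U - T" using TS spt_null(3) by auto
  moreover have "U - T \<in> sets \<mu>" using zb(2) open_U by (auto simp: sets_weight_iff)
  ultimately have "emeasure \<mu> T \<noteq> 0" "emeasure \<mu> (U - T) \<noteq> 0"
    using emeasure_mono[of "U \<inter> (?S - T)" "U - T" \<mu>] by auto
  then have "emeasure (completion \<mu>) T > 0" "emeasure (completion \<mu>) (U - T) > 0"
    using zb(2) \<open>U - T \<in> sets \<mu>\<close> by (simp_all add: zero_less_iff_neq_zero)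
  moreover have "T \<in> var_sets U V" using zb(2) sets_weight_subset_var_sets by blast
  ultimately show False using ind zb(1) by (auto simp: indecomposable_def)
qed

end

context regular_varifold
begin

text \<open>A clopen set missing \<open>z\<close> and meeting the half ball has positive mass there,
  so its mass in the full ball is at least \<epsilon>; disjointness and finiteness of the mass bound
  the number of such sets.\<close>

lemma clopen_family_bound:
  assumes z: "z \<in> U"
  shows "\<exists>W N. open W \<and> z \<in> W \<and>
    (\<forall>F. finite F \<longrightarrow> disjoint F \<longrightarrow> (\<forall>E\<in>F. clopen_in (spt U \<mu>) E \<and> E \<inter> W \<noteq> {}) \<longrightarrow> card F \<le> (N::nat))"
proof -
  obtain R \<epsilon> where R: "0 < R" "cball z R \<subseteq> U" "0 < \<epsilon>"
    and bound: "\<And>A. A \<in> sets \<mu> \<Longrightarrow> z \<notin> A \<Longrightarrow>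
      (\<And>g. g \<in> test_fields U \<Longrightarrow> first_var (restr_varifold m V A) g \<le> (LINT x:A|\<beta>. norm (g x))) \<Longrightarrow>
      measure \<mu> (cball z R \<inter> A) < \<epsilon> \<Longrightarrow> measure \<mu> (cball z (R / 2) \<inter> A) = 0"
    using local_mass_bound[OF z] by metis
  have BM: "cball z R \<in> sets \<mu>" using R by (simp add: sets_weight_iff)
  have finB: "emeasure \<mu> (cball z R) < \<infinity>" using R by (intro radon_onD(3)[OF radon_weight]) auto
  have fin: "emeasure \<mu> D \<noteq> \<infinity>" if "D \<subseteq> cball z R" for D
    using emeasure_mono[OF that BM] finB by (auto simp: top_unique)
  \<comment> \<open>The 1 accounts for the single member that may contain \<open>z\<close>.\<close>
  define N where "N = nat \<lceil>measure \<mu> (cball z R) / \<epsilon>\<rceil> + 1"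
  have "card F \<le> N"
    if F: "finite F" "disjoint F" "\<forall>E\<in>F. clopen_in (spt U \<mu>) E \<and> E \<inter> ball z (R / 2) \<noteq> {}" for F
  proof -
    define F' where "F' = {E \<in> F. z \<notin> E}"
    have F': "finite F'" "F' \<subseteq> F" using F by (auto simp: F'_def)
    have EM: "E \<in> sets \<mu>" and mass: "\<epsilon> \<le> measure \<mu> (cball z R \<inter> E)" if "E \<in> F'" for E
    proof -
      have E: "clopen_in (spt U \<mu>) E" "E \<inter> ball z (R / 2) \<noteq> {}" "z \<notin> E" using that F by (auto simp: F'_def)
      have zb: "zero_boundary U m V E" "E \<in> sets \<mu>"
        using clopen_zero_boundary E(1) by (auto simp: clopen_in_def)
      show "E \<in> sets \<mu>" by (rule zb)
      have fv: "first_var (restr_varifold m V E) g \<le> (LINT x:E|\<beta>. norm (g x))" if g: "g \<in> test_fields U" for g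
        using zb(1) g first_var_on_le[OF zb(2) g] by (auto simp: zero_boundary_def boundary_def)
      have sub: "ball z (R / 2) \<subseteq> cball z (R / 2)" "cball z (R / 2) \<subseteq> cball z R" using R by auto
      have "emeasure \<mu> (ball z (R / 2) \<inter> E) \<noteq> 0"
        using E(1) by (intro openin_spt_positive order_trans[OF sub(1) order_trans[OF sub(2) R(2)]] E(2)) (auto simp: clopen_in_def)
      moreover have "emeasure \<mu> (ball z (R / 2) \<inter> E) \<le> emeasure \<mu> (cball z (R / 2) \<inter> E)"
        using zb(2) sub by (intro emeasure_mono) (auto simp: sets_weight_iff)
      ultimately have "emeasure \<mu> (cball z (R / 2) \<inter> E) \<noteq> 0" by auto
      moreover have "emeasure \<mu> (cball z (R / 2) \<inter> E) \<noteq> \<infinity>" using sub by (intro fin) auto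
      ultimately have "measure \<mu> (cball z (R / 2) \<inter> E) \<noteq> 0"
        using emeasure_eq_ennreal_measure[of \<mu> "cball z (R / 2) \<inter> E"] by auto
      then show "\<epsilon> \<le> measure \<mu> (cball z R \<inter> E)" using bound[OF zb(2) E(3) fv] by (meson not_le)
    qed
    have disj: "disjoint_family_on (\<lambda>E. cball z R \<inter> E) F'"
      using F(2) F'(2) by (auto simp: disjoint_family_on_def disjoint_def)
    have "real (card F') * \<epsilon> \<le> (\<Sum>E\<in>F'. measure \<mu> (cball z R \<inter> E))"
      using mass sum_bounded_below[of F' \<epsilon>] by simp
    also have "\<dots> = measure \<mu> (\<Union>E\<in>F'. cball z R \<inter> E)"
      using BM EM fin by (intro measure_finite_Union[symmetric] F'(1) disj) auto
    also have "\<dots> \<le> measure \<mu> (cball z R)"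
      using BM EM finB F'(1) by (intro measure_mono_fmeasurable) (auto simp: fmeasurable_def)
    finally have "real (card F') \<le> measure \<mu> (cball z R) / \<epsilon>" using R(3) by (simp add: field_simps)
    then have c': "card F' \<le> nat \<lceil>measure \<mu> (cball z R) / \<epsilon>\<rceil>" by linarith
    have "card (F - F') \<le> 1"
    proof -
      have "X = Y" if "X \<in> F - F'" "Y \<in> F - F'" for X Y
        using that F(2) by (auto simp: F'_def disjoint_def)
      then show ?thesis using F(1) card_le_Suc0_iff_eq[of "F - F'"] by auto
    qed
    moreover have "card F = card F' + card (F - F')"
      using card_Un_disjoint[of F' "F - F'"] F(1) F' by (simp add: Un_absorb1)
    ultimately show ?thesis using c' by (simp add: N_def)
  qed
  then show ?thesis using R(1) by (intro exI[of _ "ball z (R / 2)"] exI[of _ N]) auto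
qed

lemma openin_component:
  assumes "C \<in> components (spt U \<mu>)"
  shows "openin (top_of_set (spt U \<mu>)) C"
  by (rule openin_components_of_bounded[OF clopen_family_bound assms]) (use spt_null(3) in blast)

lemma component_zero_boundary:
  "C \<in> components (spt U \<mu>) \<Longrightarrow> zero_boundary U m V C"
  by (intro clopen_zero_boundary openin_component closedin_component)

text \<open>The part of the support in \<open>K\<close> is compact and covered by the components,
  which are relatively open and disjoint.\<close>

lemma finite_components_compact:
  assumes K: "compact K" "K \<subseteq> U"
  shows "finite (components (spt U \<mu>) \<inter> {C. C \<inter> K \<noteq> {}})"
proof -
  let ?S = "spt U \<mu>"
  obtain F where F: "closed F" "?S = U \<inter> F" using spt_null(2) by (auto simp: closedin_closed)
  have "K \<inter> ?S = K \<inter> F" using F K by auto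
  then have cK: "compact (K \<inter> ?S)" using F K by (auto intro: compact_Int_closed)
  have "\<forall>C\<in>components ?S. \<exists>T. open T \<and> C = ?S \<inter> T"
    using openin_component by (auto simp: openin_open)
  from bchoice[OF this] obtain T where T: "\<And>C. C \<in> components ?S \<Longrightarrow> open (T C)" "\<And>C. C \<in> components ?S \<Longrightarrow> C = ?S \<inter> T C"
    by blast
  have cov: "K \<inter> ?S \<subseteq> (\<Union>C\<in>components ?S. T C)"
  proof
    fix x assume "x \<in> K \<inter> ?S"
    then obtain C where "C \<in> components ?S" "x \<in> C" using Union_components[of ?S] by blast
    then show "x \<in> (\<Union>C\<in>components ?S. T C)" using T(2)[of C] by blast
  qed
  obtain D where D: "D \<subseteq> components ?S" "finite D" "K \<inter> ?S \<subseteq> (\<Union>C\<in>D. T C)"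
    by (rule compactE_image[OF cK T(1) cov]) blast
  have "components ?S \<inter> {C. C \<inter> K \<noteq> {}} \<subseteq> D"
  proof
    fix C assume "C \<in> components ?S \<inter> {C. C \<inter> K \<noteq> {}}"
    then obtain x where C: "C \<in> components ?S" "x \<in> C" "x \<in> K" by blast
    then have xS: "x \<in> ?S" using in_components_subset by blast
    then obtain C' where C': "C' \<in> D" "x \<in> T C'" using C(3) D(3) by blast
    then have "x \<in> C'" using T(2)[of C'] D(1) xS by blast
    then show "C \<in> D" using components_nonoverlap[OF C(1), of C'] C' C(2) D(1) by blast
  qed
  then show ?thesis using D(2) finite_subset by blast
qed

text \<open>A member whose support meets the half ball has mass at least \<epsilon> near
  \<open>z\<close> as soon as one of its representing sets of zero boundary misses \<open>z\<close>.
  The sum formula bounds the number of these members, and pairwise disjointness leaves at most one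
  other.\<close>

lemma decomposition_locally_finite:
  assumes G: "decomposition U m V G" and z: "z \<in> U"
  obtains W where "open W" "z \<in> W" "W \<subseteq> U" "finite {X \<in> G. spt U (weight U X) \<inter> W \<noteq> {}}"
proof -
  obtain R \<epsilon> where R: "0 < R" "cball z R \<subseteq> U" "0 < \<epsilon>"
    and bound: "\<And>A. A \<in> sets \<mu> \<Longrightarrow> z \<notin> A \<Longrightarrow>
      (\<And>g. g \<in> test_fields U \<Longrightarrow> first_var (restr_varifold m V A) g \<le> (LINT x:A|\<beta>. norm (g x))) \<Longrightarrow>
      measure \<mu> (cball z R \<inter> A) < \<epsilon> \<Longrightarrow> measure \<mu> (cball z (R / 2) \<inter> A) = 0"
    using local_mass_bound[OF z] by metis
  let ?B = "ball z (R / 2)"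
  have "cball z (R / 2) \<subseteq> cball z R" "?B \<subseteq> cball z R" using R(1) by auto
  then have BU: "cball z (R / 2) \<subseteq> U" "?B \<subseteq> U" using R(2) by blast+
  have BM: "cball z R \<in> sets \<mu>" "cball z (R / 2) \<in> sets \<mu>" "?B \<in> sets \<mu>"
    using BU R(2) by (auto simp: sets_weight_iff)
  have fin: "emeasure \<mu> (cball z R) < \<infinity>" using R by (intro radon_onD(3)[OF radon_weight]) auto
  define G0 where "G0 = {X \<in> G. spt U (weight U X) \<inter> ?B \<noteq> {}}"
  have comp: "varifold U m X" if "X \<in> G" for X using G that by (auto simp: decomposition_def is_component_def)
  have ov: "open_varifold U m X" if "X \<in> G" for X using comp[OF that] open_U by unfold_locales
  have mass: "\<epsilon> \<le> measure (weight U X) (cball z R)"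
    if X: "X \<in> G0" and A: "A \<in> var_sets U V" "zero_boundary U m V A" "z \<notin> A" "X = restr_varifold m V A" for X A
  proof -
    obtain A' where A': "A' \<in> sets \<mu>" "z \<notin> A'" "restr_varifold m V A = restr_varifold m V A'"
      "\<And>g. g \<in> test_fields U \<Longrightarrow> first_var (restr_varifold m V A') g \<le> (LINT z:A'|\<beta>. norm (g z))"
      using zero_boundary_first_var[OF A(1-3)] by metis
    have XA: "X = restr_varifold m V A'" using A(4) A'(3) by simp
    interpret X: open_varifold U m X using X by (intro ov) (simp add: G0_def)
    have e: "emeasure X.\<mu> D = emeasure \<mu> (D \<inter> A')" if "D \<in> sets \<mu>" for D
      unfolding XA by (rule emeasure_weight_restr[OF A'(1) that])
    obtain y where "y \<in> spt U X.\<mu>" "y \<in> ?B" using X by (auto simp: G0_def)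
    then have "emeasure X.\<mu> ?B \<noteq> 0" using BU by (simp add: spt_iff)
    then have "emeasure \<mu> (?B \<inter> A') \<noteq> 0" using e BM by simp
    moreover have "emeasure \<mu> (?B \<inter> A') \<le> emeasure \<mu> (cball z (R / 2) \<inter> A')"
      using BM A'(1) by (intro emeasure_mono) auto
    ultimately have "emeasure \<mu> (cball z (R / 2) \<inter> A') \<noteq> 0" by auto
    moreover have "emeasure \<mu> (cball z (R / 2) \<inter> A') \<le> emeasure \<mu> (cball z R)"
      using BM R by (intro emeasure_mono) auto
    then have "emeasure \<mu> (cball z (R / 2) \<inter> A') \<noteq> \<infinity>" using fin by auto
    ultimately have "measure \<mu> (cball z (R / 2) \<inter> A') \<noteq> 0"
      using emeasure_eq_ennreal_measure[of \<mu> "cball z (R / 2) \<inter> A'"] by auto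
    then have "\<epsilon> \<le> measure \<mu> (cball z R \<inter> A')" using bound[OF A'(1,2,4)] by (meson not_le)
    then show ?thesis using e[OF BM(1)] by (simp add: measure_def)
  qed
  \<comment> \<open>For a member of \<open>G0 - G1\<close> every representing set of zero boundary
    contains \<open>z\<close>; two distinct such members would have disjoint representing sets with
    a common point.\<close>
  define G1 where "G1 = {X \<in> G0. \<epsilon> \<le> measure (weight U X) (cball z R)}"
  have one: "X = Y" if "X \<in> G0 - G1" "Y \<in> G0 - G1" for X Y
  proof (rule ccontr)
    assume "X \<noteq> Y"
    moreover have "X \<in> G" "Y \<in> G" using that by (auto simp: G0_def)
    ultimately obtain A B where AB: "A \<in> var_sets U V" "B \<in> var_sets U V" "A \<inter> B = {}"
      "zero_boundary U m V A" "zero_boundary U m V B" "X = restr_varifold m V A" "Y = restr_varifold m V B"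
      using G unfolding decomposition_def by metis
    show False
    proof (cases "z \<in> A")
      case True
      then show ?thesis using AB(3) that(2) mass[OF _ AB(2,5) _ AB(7)] by (auto simp: G1_def)
    next
      case False
      then show ?thesis using that(1) mass[OF _ AB(1,4) _ AB(6)] by (auto simp: G1_def)
    qed
  qed
  have finR: "finite (G0 - G1)"
  proof (cases "G0 - G1 = {}")
    case False
    then obtain X where "X \<in> G0 - G1" by blast
    then have "G0 - G1 \<subseteq> {X}" using one by blast
    then show ?thesis using finite_subset by blast
  qed (simp only: finite.emptyI)
  \<comment> \<open>A cutoff that is 1 on the ball dominates the mass of each member there, so the
    sum formula for it bounds the total.\<close>
  obtain \<phi> N where \<phi>: "smooth \<phi>" "\<And>x. 0 \<le> \<phi> x" "cball z R \<subseteq> N" "\<And>x. x \<in> N \<Longrightarrow> \<phi> x = (1::real)"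
    "compact (closure {x. \<phi> x \<noteq> 0})" "closure {x. \<phi> x \<noteq> 0} \<subseteq> U"
    by (rule smooth_Urysohn[OF compact_cball open_U R(2)]) blast
  let ?f = "\<lambda>p. \<phi> (fst p)"
  have cf: "continuous_on (U \<times> Grass m) ?f"
    by (rule continuous_on_compose2[OF smooth_imp_continuous_on[OF \<phi>(1)]]) (auto intro: continuous_intros)
  have zf: "?f p = 0" if "p \<in> U \<times> Grass m - closure {x. \<phi> x \<noteq> 0} \<times> Grass m" for p
    using that by (intro closure_support_outside) auto
  have cK: "compact (closure {x. \<phi> x \<noteq> 0} \<times> Grass m)" "closure {x. \<phi> x \<noteq> 0} \<times> Grass m \<subseteq> U \<times> Grass m"
    using \<phi>(5,6) by (auto intro: compact_Times compact_Grass)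
  have hs: "((\<lambda>X. LINT p|X. ?f p) has_sum (LINT p|V. ?f p)) G"
    by (rule decomposition_has_sum[OF G cf cK zf])
  have ge: "measure (weight U X) (cball z R) \<le> (LINT p|X. ?f p)" if X: "X \<in> G" for X
  proof -
    interpret X: open_varifold U m X by (rule ov[OF X])
    have i: "integrable X ?f" by (rule radon_integrable_continuous[OF X.radon_V cf cK zf])
    have CX: "cball z R \<times> Grass m \<in> sets X" using BM(1) by (intro X.cylinder_sets) (simp add: X.sets_weight sets_weight)
    have eX: "emeasure X.\<mu> (cball z R) = emeasure X (cball z R \<times> Grass m)"
      using BM(1) by (intro X.emeasure_weight) (simp add: X.sets_weight sets_weight)
    have "emeasure X (cball z R \<times> Grass m) < \<infinity>"
      using R(2) by (intro radon_onD(3)[OF X.radon_V] compact_Times compact_Grass) auto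
    then have "measure X (cball z R \<times> Grass m) = (LINT p|X. indicator (cball z R \<times> Grass m) p)"
      using CX by simp
    also have "\<dots> \<le> (LINT p|X. ?f p)"
      using \<phi>(2) \<phi>(3,4) by (intro integral_mono' i) (auto simp: indicator_def subset_eq)
    finally show ?thesis using eX by (simp add: measure_def)
  qed
  have nonneg: "0 \<le> (LINT p|X. ?f p)" for X :: "'n varif" using \<phi>(2) by (intro Bochner_Integration.integral_nonneg) auto
  have "finite G1 \<and> card G1 \<le> nat \<lceil>(LINT p|V. ?f p) / \<epsilon>\<rceil>"
  proof (rule finite_if_finite_subsets_card_bdd)
    fix F assume F: "F \<subseteq> G1" "finite F"
    then have FG: "F \<subseteq> G" by (auto simp: G1_def G0_def)
    have "real (card F) * \<epsilon> \<le> (\<Sum>X\<in>F. measure (weight U X) (cball z R))"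
      by (rule sum_bounded_below) (use F(1) in \<open>auto simp: G1_def\<close>)
    also have "\<dots> \<le> (\<Sum>X\<in>F. LINT p|X. ?f p)" using ge FG by (intro sum_mono) auto
    also have "\<dots> \<le> (LINT p|V. ?f p)"
      by (rule has_sum_mono_neutral[OF has_sum_finite[OF F(2)] hs]) (use FG nonneg in auto)
    finally have "real (card F) \<le> (LINT p|V. ?f p) / \<epsilon>" using R(3) by (simp add: field_simps)
    then show "card F \<le> nat \<lceil>(LINT p|V. ?f p) / \<epsilon>\<rceil>" by linarith
  qed
  moreover have "G0 = G1 \<union> (G0 - G1)" by (auto simp: G1_def)
  ultimately have "finite G0" using finR by (metis finite_UnI)
  then show thesis using that[of ?B] R(1) BU(2) by (simp add: G0_def)
qed

text \<open>Without local finiteness the supports might merely accumulate at z. With it a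
  neighbourhood of z misses all of them, and a cutoff there has integral 0 for every member, hence
  for \<open>V\<close>.\<close>

lemma spt_subset_decomposition:
  assumes G: "decomposition U m V G"
  shows "spt U \<mu> \<subseteq> (\<Union>X\<in>G. spt U (weight U X))"
proof (rule subsetI, rule ccontr)
  fix z assume z: "z \<in> spt U \<mu>" and n: "z \<notin> (\<Union>X\<in>G. spt U (weight U X))"
  have zU: "z \<in> U" using z spt_null(3) by blast
  have ov: "open_varifold U m X" if "X \<in> G" for X
    using G that open_U by unfold_locales (auto simp: decomposition_def is_component_def)
  obtain W where W: "open W" "z \<in> W" "W \<subseteq> U" "finite {X \<in> G. spt U (weight U X) \<inter> W \<noteq> {}}"
    by (rule decomposition_locally_finite[OF G zU])
  define G0 where "G0 = {X \<in> G. spt U (weight U X) \<inter> W \<noteq> {}}"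
  \<comment> \<open>A finite intersection of open sets; members outside \<open>G0\<close> already
    miss \<open>W\<close>.\<close>
  define T where "T = W \<inter> (\<Inter>X\<in>G0. U - spt U (weight U X))"
  have T: "open T" "z \<in> T" "T \<subseteq> U"
  proof -
    show "open T" unfolding T_def
      by (intro open_Int W(1) open_INT W(4)[folded G0_def] ballI open_diff_spt)
    show "z \<in> T" using W(2) n zU by (auto simp: T_def G0_def)
    show "T \<subseteq> U" using W(3) by (auto simp: T_def)
  qed
  have miss: "T \<subseteq> U - spt U (weight U X)" if "X \<in> G" for X
    using that W(3) by (cases "X \<in> G0") (auto simp: T_def G0_def)
  have zT: "{z} \<subseteq> T" using T by simp
  obtain \<phi> N where \<phi>: "smooth \<phi>" "\<And>x. 0 \<le> \<phi> x" "open N" "{z} \<subseteq> N" "\<And>x. x \<in> N \<Longrightarrow> \<phi> x = (1::real)"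
    "compact (closure {x. \<phi> x \<noteq> 0})" "closure {x. \<phi> x \<noteq> 0} \<subseteq> T"
    by (rule smooth_Urysohn[OF compact_sing T(1) zT]) blast
  let ?f = "\<lambda>p. \<phi> (fst p)"
  have cf: "continuous_on (U \<times> Grass m) ?f"
    by (rule continuous_on_compose2[OF smooth_imp_continuous_on[OF \<phi>(1)]]) (auto intro: continuous_intros)
  have zf: "?f p = 0" if "p \<in> U \<times> Grass m - closure {x. \<phi> x \<noteq> 0} \<times> Grass m" for p
    using that by (intro closure_support_outside) auto
  have cK: "compact (closure {x. \<phi> x \<noteq> 0} \<times> Grass m)" "closure {x. \<phi> x \<noteq> 0} \<times> Grass m \<subseteq> U \<times> Grass m"
    using \<phi>(6,7) T(3) by (auto intro: compact_Times compact_Grass)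
  have hs: "((\<lambda>X. LINT p|X. ?f p) has_sum (LINT p|V. ?f p)) G"
    by (rule decomposition_has_sum[OF G cf cK zf])
  have "(LINT p|X. ?f p) = 0" if X: "X \<in> G" for X
  proof -
    interpret X: open_varifold U m X by (rule ov[OF X])
    have "AE p in X. ?f p = 0"
    proof (rule AE_I)
      show "(U - spt U X.\<mu>) \<times> Grass m \<in> sets X" using X.spt_null(1) by (intro X.cylinder_sets) auto
      show "emeasure X ((U - spt U X.\<mu>) \<times> Grass m) = 0"
        using X.spt_null(1) X.emeasure_weight[of "U - spt U X.\<mu>"] by (auto simp: null_sets_def)
      show "{p \<in> space X. ?f p \<noteq> 0} \<subseteq> (U - spt U X.\<mu>) \<times> Grass m"
      proof
        fix p assume p: "p \<in> {p \<in> space X. ?f p \<noteq> 0}"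
        then have "fst p \<in> T" using \<phi>(7) closure_subset[of "{x. \<phi> x \<noteq> 0}"] by blast
        then show "p \<in> (U - spt U X.\<mu>) \<times> Grass m" using miss[OF X] p by (auto simp: X.space_V)
      qed
    qed
    then show ?thesis by (rule integral_eq_zero_AE)
  qed
  then have "((\<lambda>X. LINT p|X. ?f p) has_sum 0) G" by (intro has_sum_0) auto
  with hs have "(LINT p|V. ?f p) = 0" by (rule has_sum_unique)
  moreover have i: "integrable V ?f" by (rule radon_integrable_continuous[OF radon_V cf cK zf])
  ultimately have "AE p in V. ?f p = 0"
    using \<phi>(2) integral_nonneg_eq_0_iff_AE[OF i] by simp
  then have ae: "AE p in V. p \<notin> (N \<inter> U) \<times> Grass m" by eventually_elim (use \<phi>(5) in fastforce)
  have NU: "N \<inter> U \<in> sets \<mu>" "open (N \<inter> U)" using \<phi>(3) open_U by (auto simp: sets_weight_iff)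
  have "emeasure \<mu> (N \<inter> U) = emeasure V ((N \<inter> U) \<times> Grass m)" by (rule emeasure_weight[OF NU(1)])
  also have "\<dots> = 0" using AE_iff_measurable[OF cylinder_sets[OF NU(1)], of "\<lambda>p. p \<notin> (N \<inter> U) \<times> Grass m"] ae
    sets.sets_into_space[OF cylinder_sets[OF NU(1)]] by auto
  finally show False using z \<phi>(4) NU(2) zU by (auto simp: spt_iff)
qed

lemma component_spt:
  assumes X: "is_component U m V X"
  shows "connected (spt U (weight U X))" "spt U (weight U X) \<subseteq> spt U \<mu>"
proof -
  have "varifold U m X" "indecomposable U m X" "radon_var U X"
    using X by (auto simp: is_component_def indecomposable_def)
  then interpret X: radon_varifold U m X using open_U by unfold_locales
  show "connected (spt U X.\<mu>)" by (rule X.connected_spt) fact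
  obtain A where A: "A \<in> var_sets U V" "X = restr_varifold m V A" using X by (auto simp: is_component_def)
  obtain A' where A': "A' \<in> sets \<mu>" "X = restr_varifold m V A'"
    using var_sets_representative[OF A(1)] A(2) by metis
  show "spt U X.\<mu> \<subseteq> spt U \<mu>"
  proof
    fix z assume z: "z \<in> spt U X.\<mu>"
    show "z \<in> spt U \<mu>"
      unfolding spt_iff
    proof (intro conjI allI impI notI)
      show "z \<in> U" using z by (simp add: spt_iff)
      fix T assume T: "open T" "z \<in> T" "T \<subseteq> U" "emeasure \<mu> T = 0"
      have TM: "T \<in> sets \<mu>" using T by (simp add: sets_weight_iff)
      have "emeasure X.\<mu> T = emeasure \<mu> (T \<inter> A')" unfolding A'(2) by (rule emeasure_weight_restr[OF A'(1) TM])
      also have "\<dots> \<le> emeasure \<mu> T" using TM by (intro emeasure_mono) auto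
      finally show False using T z by (auto simp: spt_iff)
    qed
  qed
qed

lemma component_eq_Union:
  assumes C: "C \<in> components (spt U \<mu>)" and G: "decomposition U m V G"
  shows "C = \<Union>{spt U (weight U W) |W. W \<in> G \<and> C \<inter> spt U (weight U W) \<noteq> {}}"
proof (intro equalityI subsetI)
  fix z assume z: "z \<in> C"
  then have "z \<in> spt U \<mu>" using in_components_subset[OF C] by blast
  then show "z \<in> \<Union>{spt U (weight U W) |W. W \<in> G \<and> C \<inter> spt U (weight U W) \<noteq> {}}"
    using spt_subset_decomposition[OF G] z by blast
next
  fix z assume "z \<in> \<Union>{spt U (weight U W) |W. W \<in> G \<and> C \<inter> spt U (weight U W) \<noteq> {}}"
  then obtain W where W: "W \<in> G" "C \<inter> spt U (weight U W) \<noteq> {}" "z \<in> spt U (weight U W)" by blast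
  have comp: "is_component U m V W" using G W(1) by (auto simp: decomposition_def)
  have "spt U (weight U W) \<subseteq> C" by (rule components_maximal[OF C component_spt[OF comp] W(2)])
  then show "z \<in> C" using W(3) by blast
qed

end

theorem corollary5p20:
  fixes m :: nat and U :: "(real^'n::finite) set" and V :: "'n varif"
    and H :: "(real^'n) set set"
  assumes "1 \<le> m" and "m \<le> CARD('n)"
    and "open U"
    and "varifold U m V"
    and "radon_var U V"
    and "AE z in weight U V. \<exists>\<theta>. has_density U m (weight U V) z \<theta> \<and> \<theta> \<ge> 1"
    and "m > 1 \<Longrightarrow>
           (\<forall>K. compact K \<and> K \<subseteq> U \<longrightarrow>
              set_integrable (completion (weight U V)) K (\<lambda>z. norm (mean_curv U V z) ^ m)) \<and>
           (\<forall>g\<in>test_fields U. first_var V g =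
              - (LINT z|completion (weight U V). g z \<bullet> mean_curv U V z))"
  defines "H \<equiv> components (spt U (weight U V))"
  shows "(\<forall>C\<in>H. \<forall>G. decomposition U m V G \<longrightarrow>
            C = \<Union>{spt U (weight U W) |W. W \<in> G \<and> C \<inter> spt U (weight U W) \<noteq> {}}) \<and>
         (\<forall>C\<in>H. zero_boundary U m V C) \<and>
         (\<forall>K. compact K \<and> K \<subseteq> U \<longrightarrow> finite (H \<inter> {C. C \<inter> K \<noteq> {}})) \<and>
         (\<forall>C\<in>H. openin (top_of_set (spt U (weight U V))) C)"
proof -
  interpret regular_varifold U m V
    using assms(1,3-7) by unfold_locales
  show ?thesis
    unfolding H_def
    using component_eq_Union component_zero_boundary finite_components_compact openin_component by blast
qed

end
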